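(* Let $T>0$, let $D\subset\mathbb{R}^d$ be open with exhaustion $(D_k)$ as in the context, and let $a^{ij},b^i,c$ be Borel functions on $D\times[0,T]$ with $A=(a^{ij})$ symmetric and $c\le 0$. Suppose that for each $k\in\mathbb{N}$ the functions $a^{ij},b^i,c$ are bounded on $D_k\times[0,T]$ and there exist numbers $m_k>0$, $M_k>0$ such that $m_k|y|^2\le (A(x,t)y,y)\le M_k|y|^2$ for all $y\in\mathbb{R}^d$ and all $(x,t)\in D_k\times[0,T]$. Then for every Borel probability measure $\nu$ on $D$ the class $\mathcal{M}_\nu$ is nonempty.
   Context: $T>0$; $D\subset\mathbb{R}^d$ is an arbitrary open set, and $(D_k)_{k\ge1}$ is a fixed increasing sequence of bounded open sets with $\overline{D_k}\subset D_{k+1}$ and $\bigcup_k D_k=D$. The coefficients $a^{ij},b^i,c$ ($1\le i,j\le d$) are Borel functions on $D\times[0,T]$, $A=(a^{ij})$ is symmetric and nonnegative definite, and summation over repeated indices is used. Set $L\varphi=a^{ij}\partial_{x_i}\partial_{x_j}\varphi+b^i\partial_{x_i}\varphi+c\varphi$. A locally finite Borel measure $\mu$ on $D\times(0,T)$ is given by a flow of Borel measures $(\mu_t)_{t\in(0,T)}$ on $D$ if $t\mapsto\mu_t(B)$ is measurable for every Borel $B\subset D$ and $\int u\,d\mu=\int_0^T\int_D u(x,t)\,d\mu_t\,dt$ for all $u\in C_0^\infty(D\times(0,T))$. Such $\mu$ solves the Cauchy problem $\partial_t\mu=\partial_{x_i}\partial_{x_j}(a^{ij}\mu)-\partial_{x_i}(b^i\mu)+c\mu$,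 $\mu|_{t=0}=\nu$ (with $\nu$ a Borel measure on $D$) if $a^{ij},b^i,c\in L^1(\overline{D_k}\times J,|\mu|)$ for every $k$ and every compact interval $J\subset(0,T)$, and for every $\varphi\in C_0^\infty(D)$ and a.e. $t\in(0,T)$: $\int_D\varphi\,d\mu_t-\int_D\varphi\,d\nu=\lim_{\varepsilon\to0+}\int_\varepsilon^t\int_D L\varphi\,d\mu_s\,ds$. The class $\mathcal{M}_\nu$ consists of all measures $\mu$ given by flows of nonnegative Borel measures $(\mu_t)_{0<t<T}$ on $D$ that solve this Cauchy problem, satisfy $|c|\in L^1(D\times(0,T),\mu)$, and satisfy for a.e. $t\in(0,T)$: $\mu_t(D)\le\nu(D)+\int_0^t\int_D c(x,s)\,\mu_s(dx)\,ds$. *)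

theory Defs
  imports "HOL-Probability.Probability"
begin

definition pd :: "'n::finite \<Rightarrow> (real^'n \<Rightarrow> real) \<Rightarrow> real^'n \<Rightarrow> real" where
  "pd i f x = deriv (\<lambda>s. f (x + s *\<^sub>R axis i 1)) 0"

fun iter_pd :: "'n::finite list \<Rightarrow> (real^'n \<Rightarrow> real) \<Rightarrow> real^'n \<Rightarrow> real" where
  "iter_pd [] f = f"
| "iter_pd (i # is) f = pd i (iter_pd is f)"

definition smooth_fun :: "(real^'n::finite \<Rightarrow> real) \<Rightarrow> bool" where
  "smooth_fun f \<longleftrightarrow> (\<forall>is. continuous_on UNIV (iter_pd is f) \<and>
      (\<forall>i x. (\<lambda>s. iter_pd is f (x + s *\<^sub>R axis i 1)) differentiable (at 0)))"

definition test_fun :: "(real^'n::finite) set \<Rightarrow> (real^'n \<Rightarrow> real) \<Rightarrow> bool" where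
  "test_fun D \<phi> \<longleftrightarrow> smooth_fun \<phi> \<and> compact (closure {x. \<phi> x \<noteq> 0})
      \<and> closure {x. \<phi> x \<noteq> 0} \<subseteq> D"

definition Lop :: "(real^'n::finite \<Rightarrow> real \<Rightarrow> 'n \<Rightarrow> 'n \<Rightarrow> real) \<Rightarrow> (real^'n \<Rightarrow> real \<Rightarrow> 'n \<Rightarrow> real)
     \<Rightarrow> (real^'n \<Rightarrow> real \<Rightarrow> real) \<Rightarrow> (real^'n \<Rightarrow> real) \<Rightarrow> real^'n \<Rightarrow> real \<Rightarrow> real" where
  "Lop a b c \<phi> x t = (\<Sum>i\<in>UNIV. \<Sum>j\<in>UNIV. a x t i j * pd i (pd j \<phi>) x)
      + (\<Sum>i\<in>UNIV. b x t i * pd i \<phi> x) + c x t * \<phi> x"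

text \<open>The class M_nu, formulated for the flow (mu t) of nonnegative Borel measures on D;
  the measure mu on D x (0,T) is the one given by the flow.\<close>
definition in_M_class :: "(real^'n::finite) set \<Rightarrow> (nat \<Rightarrow> (real^'n) set) \<Rightarrow> real
     \<Rightarrow> (real^'n \<Rightarrow> real \<Rightarrow> 'n \<Rightarrow> 'n \<Rightarrow> real) \<Rightarrow> (real^'n \<Rightarrow> real \<Rightarrow> 'n \<Rightarrow> real)
     \<Rightarrow> (real^'n \<Rightarrow> real \<Rightarrow> real) \<Rightarrow> (real^'n) measure \<Rightarrow> (real \<Rightarrow> (real^'n) measure) \<Rightarrow> bool" where
  "in_M_class D Dk T a b c \<nu> \<mu> \<longleftrightarrow>
     \<comment> \<open>flow of nonnegative Borel measures on D\<close>
     (\<forall>t\<in>{0<..<T}. sets (\<mu> t) = sets (restrict_space borel D))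
   \<and> (\<forall>B. B \<in> sets (restrict_space borel D) \<longrightarrow>
         (\<lambda>t. emeasure (\<mu> t) B) \<in> borel_measurable (restrict_space lborel {0<..<T}))
     \<comment> \<open>the measure given by the flow is locally finite on D x (0,T)\<close>
   \<and> (\<forall>k \<alpha> \<beta>. 0 < \<alpha> \<longrightarrow> \<alpha> \<le> \<beta> \<longrightarrow> \<beta> < T \<longrightarrow>
         (\<integral>\<^sup>+ s. emeasure (\<mu> s) (closure (Dk k)) * indicator {\<alpha>..\<beta>} s \<partial>lborel) < \<infinity>)
     \<comment> \<open>coefficients in L^1(closure D_k x J, mu)\<close>
   \<and> (\<forall>k \<alpha> \<beta>. 0 < \<alpha> \<longrightarrow> \<alpha> \<le> \<beta> \<longrightarrow> \<beta> < T \<longrightarrow>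
         (\<forall>i j. (\<integral>\<^sup>+ s. (\<integral>\<^sup>+ x. ennreal \<bar>a x s i j\<bar> * indicator (closure (Dk k)) x \<partial>\<mu> s)
                        * indicator {\<alpha>..\<beta>} s \<partial>lborel) < \<infinity>)
       \<and> (\<forall>i. (\<integral>\<^sup>+ s. (\<integral>\<^sup>+ x. ennreal \<bar>b x s i\<bar> * indicator (closure (Dk k)) x \<partial>\<mu> s)
                        * indicator {\<alpha>..\<beta>} s \<partial>lborel) < \<infinity>)
       \<and> (\<integral>\<^sup>+ s. (\<integral>\<^sup>+ x. ennreal \<bar>c x s\<bar> * indicator (closure (Dk k)) x \<partial>\<mu> s)
                        * indicator {\<alpha>..\<beta>} s \<partial>lborel) < \<infinity>)
     \<comment> \<open>the weak form of the Cauchy problem\<close>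
   \<and> (\<forall>\<phi>. test_fun D \<phi> \<longrightarrow>
         (AE t in lborel. t \<in> {0<..<T} \<longrightarrow>
            ((\<lambda>\<epsilon>. set_lebesgue_integral lborel {\<epsilon>..t}
                     (\<lambda>s. \<integral>x. Lop a b c \<phi> x s \<partial>\<mu> s))
              \<longlongrightarrow> (\<integral>x. \<phi> x \<partial>\<mu> t) - (\<integral>x. \<phi> x \<partial>\<nu>)) (at_right 0)))
     \<comment> \<open>|c| in L^1(D x (0,T), mu)\<close>
   \<and> (\<integral>\<^sup>+ s. (\<integral>\<^sup>+ x. ennreal \<bar>c x s\<bar> \<partial>\<mu> s) * indicator {0<..<T} s \<partial>lborel) < \<infinity>
     \<comment> \<open>mass inequality\<close>
   \<and> (AE t in lborel. t \<in> {0<..<T} \<longrightarrow>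
         emeasure (\<mu> t) D < \<infinity> \<and>
         measure (\<mu> t) D \<le> measure \<nu> D
            + set_lebesgue_integral lborel {0<..t} (\<lambda>s. \<integral>x. c x s \<partial>\<mu> s))"

end

theory Submission
  imports Defs
begin

text \<open>
  The solution is produced by duality, directly for the Borel coefficients. Integrated against time
  dependent test functions $u$, the Cauchy problem together with the mass inequality says that a
  nonnegative measure $\mu$ on $D \times [0,T]$ satisfies
  $\int (\partial_t + L) u \, d\mu \le - \int u(\cdot,0) \, d\nu$ for all $u$ in a convex cone that contains
  $\pm \zeta(t) \varphi(x)$ and the functions $-\Psi(t)$ with $\Psi \ge 0$ nonincreasing. By the Hahn-Banach
  theorem such a $\mu$ exists, with a density, as soon as
  $(\sup u)^{d+1} \le \int W \, (((\partial_t + L) u)^-)^{d+1} \, dx \, dt$ for some locally bounded weight $W$.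
  This is a local form of the parabolic Aleksandrov-Bakelman-Pucci-Krylov estimate: lowering $u$ by a linear
  function of time and adding a small paraboloid around a maximum point gives a function $w$ on a cylinder
  that exceeds its parabolic boundary values, and then the map $(x,t) \mapsto (\nabla w, w - \nabla w \cdot x)$, whose
  Jacobian is $\partial_t w \det D^2 w$, sends the contact set of $w$ onto a set of volume at least $c (\sup u)^{d+1}$.
  Only pointwise bounds on the coefficients enter.
\<close>

section \<open>Measures dominated by a convex functional\<close>

text \<open>The obstacle is that the coefficients are merely Borel: a weak limit of solutions for
  smoothed coefficients cannot be tested against discontinuous ones, so approximation would need an
  a priori estimate and a delicate passage to the limit besides. Duality uses the estimate only for
  regular test functions and solves no equation. The exponent is dictated by geometry: a volume in
  d+1 dimensions is bounded by the integral of a determinant of size d+1. Domination by an integral,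
  and not only by a supremum, is what makes the functional countably additive and absolutely
  continuous. Nothing is uniform near the boundary of \<open>D\<close>, and mass may be lost there.
  The test functions must be at most 0 off a compact set, so that a positive maximum is interior;
  this one-sided condition yields an inequality for the mass and an equation for compactly supported
  functions.\<close>

lemma hahn_banach_dominated:
  fixes E :: "('a \<Rightarrow> real) set" and p :: "('a \<Rightarrow> real) \<Rightarrow> real"
  assumes zero: "(\<lambda>_. 0) \<in> E"
    and add: "\<And>f g. f \<in> E \<Longrightarrow> g \<in> E \<Longrightarrow> (\<lambda>x. f x + g x) \<in> E"
    and scale: "\<And>f c. f \<in> E \<Longrightarrow> (\<lambda>x. c * f x) \<in> E"
    and p_zero: "p (\<lambda>_. 0) = 0"
    and p_add: "\<And>f g. f \<in> E \<Longrightarrow> g \<in> E \<Longrightarrow> p (\<lambda>x. f x + g x) \<le> p f + p g"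
    and p_scale: "\<And>f c. f \<in> E \<Longrightarrow> c > 0 \<Longrightarrow> p (\<lambda>x. c * f x) = c * p f"
  obtains l where "\<And>f g. f \<in> E \<Longrightarrow> g \<in> E \<Longrightarrow> l (\<lambda>x. f x + g x) = l f + l g"
    and "\<And>f c. f \<in> E \<Longrightarrow> l (\<lambda>x. c * f x) = c * l f"
    and "\<And>f. f \<in> E \<Longrightarrow> l f \<le> p f"
proof -
  \<comment> \<open>Partial functionals are sets of pairs ordered by inclusion, so the union of a
    chain is an upper bound. Single-valuedness is not built in; it follows from domination.\<close>
  define \<A> where "\<A> = {g. g \<subseteq> E \<times> UNIV \<and> ((\<lambda>_. 0), 0::real) \<in> g
     \<and> (\<forall>f r f' r'. (f, r) \<in> g \<longrightarrow> (f', r') \<in> g \<longrightarrow> ((\<lambda>x. f x + f' x), r + r') \<in> g)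
     \<and> (\<forall>f r c. (f, r) \<in> g \<longrightarrow> ((\<lambda>x. c * f x), c * r) \<in> g)
     \<and> (\<forall>f r. (f, r) \<in> g \<longrightarrow> r \<le> p f)}"
  have "\<exists>M\<in>\<A>. \<forall>X\<in>\<A>. M \<subseteq> X \<longrightarrow> X = M"
  proof (rule subset_Zorn_nonempty)
    have "{((\<lambda>_. 0), 0::real)} \<in> \<A>"
      using zero p_zero unfolding \<A>_def by auto
    then show "\<A> \<noteq> {}" by blast
  next
    fix C assume C: "C \<noteq> {}" "subset.chain \<A> C"
    have CA: "\<And>X. X \<in> C \<Longrightarrow> X \<in> \<A>" using C unfolding subset.chain_def by auto
    have two: "\<exists>Z\<in>C. u \<in> Z \<and> v \<in> Z" if "X \<in> C" "Y \<in> C" "u \<in> X" "v \<in> Y" for X Y u v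
      using C that unfolding subset.chain_def by (metis (no_types, lifting) subset_chain_def C(2) subsetD)
    show "\<Union>C \<in> \<A>"
      unfolding \<A>_def
    proof (safe)
      fix f r X assume "(f, r) \<in> X" "X \<in> C" then show "f \<in> E" using CA unfolding \<A>_def by blast
    next
      show "((\<lambda>_. 0), 0) \<in> \<Union>C" using C(1) CA unfolding \<A>_def by blast
    next
      fix f r f' r' X Y assume "(f, r) \<in> X" "X \<in> C" "(f', r') \<in> Y" "Y \<in> C"
      then obtain Z where "Z \<in> C" "(f, r) \<in> Z" "(f', r') \<in> Z" using two by blast
      then show "((\<lambda>x. f x + f' x), r + r') \<in> \<Union>C" using CA unfolding \<A>_def by blast
    next
      fix f r X c assume "(f, r) \<in> X" "X \<in> C"
      then show "((\<lambda>x. c * f x), c * r) \<in> \<Union>C" using CA unfolding \<A>_def by blast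
    next
      fix f r X assume "(f, r) \<in> X" "X \<in> C"
      then show "r \<le> p f" using CA unfolding \<A>_def by blast
    qed simp
  qed
  then obtain M where M: "M \<in> \<A>" and max: "\<And>X. X \<in> \<A> \<Longrightarrow> M \<subseteq> X \<Longrightarrow> X = M" by blast
  have M0: "((\<lambda>_. 0), 0) \<in> M" and Msub: "\<And>f r. (f, r) \<in> M \<Longrightarrow> f \<in> E"
    and Madd: "\<And>f r f' r'. (f, r) \<in> M \<Longrightarrow> (f', r') \<in> M \<Longrightarrow> ((\<lambda>x. f x + f' x), r + r') \<in> M"
    and Mscale: "\<And>f r c. (f, r) \<in> M \<Longrightarrow> ((\<lambda>x. c * f x), c * r) \<in> M"
    and Mle: "\<And>f r. (f, r) \<in> M \<Longrightarrow> r \<le> p f"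
    using M unfolding \<A>_def by blast+
  \<comment> \<open>Two values at \<open>f\<close> put the zero function paired with their
    difference into \<open>M\<close>, and \<open>p\<close> is 0 there.\<close>
  have uniq: "r = s" if "(f, r) \<in> M" "(f, s) \<in> M" for f r s
  proof -
    have "r \<le> s" if "(f, r) \<in> M" "(f, s) \<in> M" for r s
      using Mle[OF Madd[OF that(1) Mscale[OF that(2), of "-1"]]] p_zero by simp
    from this[OF that] this[OF that(2) that(1)] show ?thesis by linarith
  qed
  have tot: "\<exists>r. (f0, r) \<in> M" if f0: "f0 \<in> E" for f0
  proof (rule ccontr)
    assume no: "\<not> (\<exists>r. (f0, r) \<in> M)"
    define S where "S = (\<lambda>(f, r). r - p (\<lambda>x. f x - f0 x)) ` M"
    have minus: "(\<lambda>x. f x - f0 x) \<in> E" if "f \<in> E" for f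
      using add[OF that scale[OF f0, of "-1"]] by simp
    \<comment> \<open>A value at \<open>f0\<close> must lie above every left side and below every
      right side. Writing \<open>f + g\<close> as \<open>(f - f0) + (g + f0)\<close> shows that the
      supremum \<alpha> of the left sides is such a number.\<close>
    have key: "r - p (\<lambda>x. f x - f0 x) \<le> p (\<lambda>x. g x + f0 x) - s" if "(f, r) \<in> M" "(g, s) \<in> M" for f r g s
    proof -
      have "r + s \<le> p (\<lambda>x. f x + g x)" using Mle[OF Madd[OF that]] .
      also have "(\<lambda>x. f x + g x) = (\<lambda>x. (f x - f0 x) + (g x + f0 x))" by auto
      also have "p \<dots> \<le> p (\<lambda>x. f x - f0 x) + p (\<lambda>x. g x + f0 x)"
        by (intro p_add minus add f0 Msub[OF that(1)] Msub[OF that(2)])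
      finally show ?thesis by simp
    qed
    have bdd: "bdd_above S"
      unfolding S_def by (rule bdd_aboveI[of _ "p (\<lambda>x. (\<lambda>_. 0) x + f0 x) - 0"]) (use key[OF _ M0] in auto)
    define \<alpha> where "\<alpha> = Sup S"
    have lo: "r - p (\<lambda>x. f x - f0 x) \<le> \<alpha>" if "(f, r) \<in> M" for f r
      unfolding \<alpha>_def by (rule cSup_upper[OF _ bdd]) (use that in \<open>force simp: S_def\<close>)
    have hi: "\<alpha> \<le> p (\<lambda>x. g x + f0 x) - s" if "(g, s) \<in> M" for g s
      unfolding \<alpha>_def by (rule cSup_least) (use M0 key[OF _ that] in \<open>auto simp: S_def\<close>)
    define X where "X = {((\<lambda>x. f x + c * f0 x), r + c * \<alpha>) | f r c. (f, r) \<in> M}"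
    have XI: "(g, s) \<in> X" if "(f, r) \<in> M" "g = (\<lambda>x. f x + c * f0 x)" "s = r + c * \<alpha>" for f r g s c
      unfolding X_def using that by blast
    have "X \<in> \<A>"
      unfolding \<A>_def
    proof (safe)
      fix f r assume "(f, r) \<in> X" then show "f \<in> E"
        unfolding X_def using add scale f0 Msub by blast
    next
      show "((\<lambda>_. 0), 0) \<in> X"
        by (rule XI[OF M0, of _ 0]) auto
    next
      fix f r f' r' assume "(f, r) \<in> X" "(f', r') \<in> X"
      then obtain g s c g' s' c' where *: "f = (\<lambda>x. g x + c * f0 x)" "r = s + c * \<alpha>" "(g, s) \<in> M"
        "f' = (\<lambda>x. g' x + c' * f0 x)" "r' = s' + c' * \<alpha>" "(g', s') \<in> M"
        unfolding X_def by blast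
      have "((\<lambda>x. (g x + g' x) + (c + c') * f0 x), (s + s') + (c + c') * \<alpha>) \<in> X"
        by (rule XI[OF Madd[OF *(3) *(6)] refl refl])
      then show "((\<lambda>x. f x + f' x), r + r') \<in> X" by (simp add: * algebra_simps)
    next
      fix f r d assume "(f, r) \<in> X"
      then obtain g s c where *: "f = (\<lambda>x. g x + c * f0 x)" "r = s + c * \<alpha>" "(g, s) \<in> M"
        unfolding X_def by blast
      have "((\<lambda>x. (d * g x) + (d * c) * f0 x), (d * s) + (d * c) * \<alpha>) \<in> X"
        by (rule XI[OF Mscale[OF *(3), of d] refl refl])
      then show "((\<lambda>x. d * f x), d * r) \<in> X" by (simp add: * algebra_simps)
    next
      fix f r assume "(f, r) \<in> X"
      then obtain g s c where *: "f = (\<lambda>x. g x + c * f0 x)" "r = s + c * \<alpha>" "(g, s) \<in> M"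
        unfolding X_def by blast
      show "r \<le> p f"
      \<comment> \<open>Homogeneity reduces the coefficient of \<open>f0\<close> to 1 or -1, where
        \<open>hi\<close> or \<open>lo\<close> is the bound that determined \<alpha>.\<close>
      proof (cases c "0::real" rule: linorder_cases)
        case equal then show ?thesis using Mle[OF *(3)] * by simp
      next
        case greater
        have e: "(\<lambda>x. c * ((1/c) * g x + f0 x)) = f" using greater * by (auto simp: field_simps)
        have inE: "(\<lambda>x. (1/c) * g x + f0 x) \<in> E" using add[OF scale[OF Msub[OF *(3)]] f0] by blast
        have "\<alpha> \<le> p (\<lambda>x. (1/c) * g x + f0 x) - (1/c) * s" using hi[OF Mscale[OF *(3)]] by blast
        then have "c * \<alpha> \<le> c * (p (\<lambda>x. (1/c) * g x + f0 x) - (1/c) * s)" using greater by simp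
        also have "\<dots> = p f - s" using greater p_scale[OF inE greater] unfolding e by (simp add: algebra_simps)
        finally show ?thesis using * by simp
      next
        case less
        define e where "e = - c"
        have ep: "e > 0" using less e_def by simp
        have e: "(\<lambda>x. e * ((1/e) * g x - f0 x)) = f" using ep * by (auto simp: field_simps e_def)
        have inE: "(\<lambda>x. (1/e) * g x - f0 x) \<in> E" using minus[OF scale[OF Msub[OF *(3)]]] by blast
        have "(1/e) * s - p (\<lambda>x. (1/e) * g x - f0 x) \<le> \<alpha>" using lo[OF Mscale[OF *(3)]] by blast
        then have "e * ((1/e) * s - p (\<lambda>x. (1/e) * g x - f0 x)) \<le> e * \<alpha>" using ep by simp
        moreover have "e * ((1/e) * s - p (\<lambda>x. (1/e) * g x - f0 x)) = s - p f"
          using ep p_scale[OF inE ep] unfolding e by (simp add: algebra_simps)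
        ultimately show ?thesis using * e_def by simp
      qed
    qed simp
    moreover have "M \<subseteq> X"
    proof
      fix z assume "z \<in> M"
      then obtain f r where z: "z = (f, r)" "(f, r) \<in> M" by (cases z) auto
      show "z \<in> X" unfolding z(1) by (rule XI[OF z(2), of _ 0]) auto
    qed
    ultimately have "X = M" using max by blast
    moreover have "(f0, \<alpha>) \<in> X"
      by (rule XI[OF M0, of _ 1]) auto
    ultimately show False using no by auto
  qed
  define l where "l f = (THE r. (f, r) \<in> M)" for f
  have lM: "(f, l f) \<in> M" if "f \<in> E" for f
    unfolding l_def using tot[OF that] uniq by (metis theI)
  show ?thesis
  proof
    show "l (\<lambda>x. f x + g x) = l f + l g" if "f \<in> E" "g \<in> E" for f g
      using uniq[OF lM[OF add[OF that]] Madd[OF lM[OF that(1)] lM[OF that(2)]]] .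
    show "l (\<lambda>x. c * f x) = c * l f" if "f \<in> E" for f c
      using uniq[OF lM[OF scale[OF that]] Mscale[OF lM[OF that]]] .
    show "l f \<le> p f" if "f \<in> E" for f using Mle[OF lM[OF that]] .
  qed
qed

text \<open>
  This makes $f \mapsto \inf_{s>0} (s + s^{-n} \int (f^+)^{n+1})$ sublinear. Up to a constant factor it is
  the $L^{n+1}$ norm of $f^+$, so it serves as the dominating functional and no Minkowski inequality is needed.
\<close>

lemma perspective_power_add_le:
  fixes a b s t :: real
  assumes "0 \<le> a" "0 \<le> b" "0 < s" "0 < t"
  shows "(a + b) ^ Suc n / (s + t) ^ n \<le> a ^ Suc n / s ^ n + b ^ Suc n / t ^ n"
proof -
  have cvx: "convex_on {0::real..} (\<lambda>x. x ^ Suc n)"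
  proof (cases "even n")
    case True then show ?thesis by (intro convex_power_odd) simp
  next
    case False then show ?thesis by (intro convex_on_subset[OF convex_power_even]) auto
  qed
  \<comment> \<open>Jensen's inequality at the points \<open>a / s\<close> and \<open>b / t\<close>
    with these weights; multiplication by \<open>s + t\<close> gives the claim.\<close>
  define u v where "u = s / (s + t)" and "v = t / (s + t)"
  have uv: "0 \<le> u" "0 \<le> v" "u + v = 1"
    using assms by (auto simp: u_def v_def add_divide_distrib[symmetric])
  have "(u * (a / s) + v * (b / t)) ^ Suc n \<le> u * (a / s) ^ Suc n + v * (b / t) ^ Suc n"
  proof -
    have u: "1 - v = u" using uv by simp
    have "v \<le> 1" using uv by simp
    then show ?thesis
      using convex_onD[OF cvx uv(2), of "a / s" "b / t"] assms unfolding u real_scaleR_def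
      by (auto simp del: power_Suc)
  qed
  moreover have "u * (a / s) + v * (b / t) = (a + b) / (s + t)"
    using assms by (simp add: u_def v_def add_divide_distrib)
  ultimately have "(s + t) * ((a + b) / (s + t)) ^ Suc n
      \<le> (s + t) * (u * (a / s) ^ Suc n + v * (b / t) ^ Suc n)"
    using assms by (intro mult_left_mono) auto
  moreover have "(s + t) * ((a + b) / (s + t)) ^ Suc n = (a + b) ^ Suc n / (s + t) ^ n"
    using assms by (simp add: power_divide)
  moreover have "(s + t) * (u * (a / s) ^ Suc n + v * (b / t) ^ Suc n) = a ^ Suc n / s ^ n + b ^ Suc n / t ^ n"
    using assms by (simp add: power_divide u_def v_def distrib_left)
  ultimately show ?thesis by simp
qed

section \<open>Linear constraints and domination by powers of the positive part\<close>

definition pos_power_integral :: "'a measure \<Rightarrow> nat \<Rightarrow> ('a \<Rightarrow> real) \<Rightarrow> real" where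
  "pos_power_integral M q f = (\<integral>x. (max 0 (f x)) ^ q \<partial>M)"

definition bounded_measurable :: "'a measure \<Rightarrow> ('a \<Rightarrow> real) set" where
  "bounded_measurable M = {f \<in> borel_measurable M. \<exists>B. \<forall>x. \<bar>f x\<bar> \<le> B}"

lemma bounded_measurable_add:
  "f \<in> bounded_measurable M \<Longrightarrow> g \<in> bounded_measurable M \<Longrightarrow> (\<lambda>x. f x + g x) \<in> bounded_measurable M"
  unfolding bounded_measurable_def by (auto intro: order_trans[OF abs_triangle_ineq add_mono])

lemma bounded_measurable_scale:
  "f \<in> bounded_measurable M \<Longrightarrow> (\<lambda>x. c * f x) \<in> bounded_measurable M"
  unfolding bounded_measurable_def by (auto simp: abs_mult intro!: exI[of _ "\<bar>c\<bar> * _"] mult_left_mono)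

lemma (in finite_measure) integrable_bounded_measurable:
  assumes "f \<in> bounded_measurable M" shows "integrable M f"
proof -
  obtain B where "\<And>x. \<bar>f x\<bar> \<le> B" "f \<in> borel_measurable M"
    using assms unfolding bounded_measurable_def by auto
  then show ?thesis by (intro integrable_const_bound[of _ B]) auto
qed

lemma (in finite_measure) integrable_pos_power:
  assumes "f \<in> bounded_measurable M" shows "integrable M (\<lambda>x. (max 0 (f x)) ^ q)"
proof -
  obtain B where B: "\<And>x. \<bar>f x\<bar> \<le> B" and [measurable]: "f \<in> borel_measurable M"
    using assms unfolding bounded_measurable_def by auto
  have "norm ((max 0 (f x)) ^ q) \<le> B ^ q" for x
    using B[of x] by (auto simp: power_abs intro!: power_mono)
  then show ?thesis by (intro integrable_const_bound[of _ "B ^ q"]) auto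
qed

lemma (in finite_measure) pos_power_integral_add:
  assumes f: "f \<in> bounded_measurable M" and g: "g \<in> bounded_measurable M" and "0 < s" "0 < t"
  shows "pos_power_integral M (Suc n) (\<lambda>x. f x + g x) / (s + t) ^ n
     \<le> pos_power_integral M (Suc n) f / s ^ n + pos_power_integral M (Suc n) g / t ^ n"
proof -
  have "(max 0 (f x + g x)) ^ Suc n / (s + t) ^ n
      \<le> (max 0 (f x)) ^ Suc n / s ^ n + (max 0 (g x)) ^ Suc n / t ^ n" for x
  proof -
    have "(max 0 (f x + g x)) ^ Suc n / (s + t) ^ n \<le> (max 0 (f x) + max 0 (g x)) ^ Suc n / (s + t) ^ n"
      using assms by (intro divide_right_mono power_mono) auto
    also have "\<dots> \<le> (max 0 (f x)) ^ Suc n / s ^ n + (max 0 (g x)) ^ Suc n / t ^ n"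
      using assms by (intro perspective_power_add_le) auto
    finally show ?thesis .
  qed
  then have "(\<integral>x. (max 0 (f x + g x)) ^ Suc n / (s + t) ^ n \<partial>M)
    \<le> (\<integral>x. (max 0 (f x)) ^ Suc n / s ^ n + (max 0 (g x)) ^ Suc n / t ^ n \<partial>M)"
    by (intro integral_mono Bochner_Integration.integrable_add integrable_divide integrable_pos_power f g bounded_measurable_add)
  also have "\<dots> = (\<integral>x. (max 0 (f x)) ^ Suc n / s ^ n \<partial>M) + (\<integral>x. (max 0 (g x)) ^ Suc n / t ^ n \<partial>M)"
    by (intro Bochner_Integration.integral_add integrable_divide integrable_pos_power f g)
  finally show ?thesis unfolding pos_power_integral_def by simp
qed

lemma pos_power_integral_scale:
  assumes "c > 0" shows "pos_power_integral M q (\<lambda>x. c * f x) = c ^ q * pos_power_integral M q f"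
proof -
  have "max 0 (c * f x) = c * max 0 (f x)" for x using assms by (auto simp: max_def zero_le_mult_iff mult_le_0_iff)
  then show ?thesis unfolding pos_power_integral_def by (simp add: power_mult_distrib)
qed

lemma pos_power_integral_nonneg: "0 \<le> pos_power_integral M q f"
  unfolding pos_power_integral_def by (intro Bochner_Integration.integral_nonneg) auto

text \<open>The dominating functional is an infimal convolution: an infimum of \<open>r + s\<close>
  plus the scaled integral for \<open>g - f\<close>, over all constraints \<open>(f, r)\<close> and
  all \<open>s > 0\<close>. Choosing \<open>f = g\<close> makes \<open>l\<close> obey the
  constraint; choosing the zero constraint gives the integral bound. The assumption
  \<open>key\<close> says that the constraints are compatible with that bound: it keeps the infimum
  finite and makes it 0 at the zero function.\<close>

lemma (in finite_measure) exists_dominated_functional: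
  fixes K :: "(('a \<Rightarrow> real) \<times> real) set" and n :: nat
  assumes KE: "\<And>f r. (f, r) \<in> K \<Longrightarrow> f \<in> bounded_measurable M"
    and K0: "((\<lambda>_. 0), 0) \<in> K"
    and Kadd: "\<And>f r g s. (f, r) \<in> K \<Longrightarrow> (g, s) \<in> K \<Longrightarrow> ((\<lambda>x. f x + g x), r + s) \<in> K"
    and Kscale: "\<And>f r c. (f, r) \<in> K \<Longrightarrow> c > 0 \<Longrightarrow> ((\<lambda>x. c * f x), c * r) \<in> K"
    and key: "\<And>f r. (f, r) \<in> K \<Longrightarrow> r < 0 \<Longrightarrow> (- r) ^ Suc n \<le> pos_power_integral M (Suc n) (\<lambda>x. - f x)"
  shows "\<exists>l. (\<forall>f\<in>bounded_measurable M. \<forall>g\<in>bounded_measurable M. l (\<lambda>x. f x + g x) = l f + l g)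
    \<and> (\<forall>f\<in>bounded_measurable M. \<forall>c. l (\<lambda>x. c * f x) = c * l f)
    \<and> (\<forall>(f, r)\<in>K. l f \<le> r)
    \<and> (\<forall>f\<in>bounded_measurable M. \<forall>s>0. l f \<le> s + pos_power_integral M (Suc n) f / s ^ n)"
proof -
  let ?E = "bounded_measurable M" and ?I = "pos_power_integral M (Suc n)"
  define S where "S g = {r + s + ?I (\<lambda>x. g x - f x) / s ^ n | f r s. (f, r) \<in> K \<and> s > 0}" for g
  have SE: thesis if "z \<in> S g"
    "\<And>f r s. z = r + s + ?I (\<lambda>x. g x - f x) / s ^ n \<Longrightarrow> (f, r) \<in> K \<Longrightarrow> s > 0 \<Longrightarrow> thesis" for z g thesis
    using that(1) unfolding S_def by (elim CollectE exE conjE) (rule that(2))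
  have Ediff: "(\<lambda>x. f x - g x) \<in> ?E" if "f \<in> ?E" "g \<in> ?E" for f g
    using bounded_measurable_add[OF that(1) bounded_measurable_scale[OF that(2), of "-1"]] by simp
  have E0: "(\<lambda>_. 0) \<in> ?E" using KE[OF K0] .
  have Eneg: "(\<lambda>x. - f x) \<in> ?E" if "f \<in> ?E" for f
    using bounded_measurable_scale[OF that, of "-1"] by simp
  \<comment> \<open>If \<open>s\<close> is at least \<open>- r\<close> this is trivial; otherwise
    \<open>(- r) ^ n\<close> in \<open>key\<close> may be replaced by the smaller
    \<open>s ^ n\<close>.\<close>
  have keys: "- r \<le> s + ?I (\<lambda>x. - f x) / s ^ n" if "(f, r) \<in> K" "s > 0" for f r s
  proof (cases "r < 0 \<and> s < - r")
    case False
    have "0 \<le> ?I (\<lambda>x. - f x) / s ^ n" using that by (intro divide_nonneg_nonneg pos_power_integral_nonneg) auto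
    then show ?thesis using False that by auto
  next
    case True
    have "(- r) * s ^ n \<le> (- r) * (- r) ^ n" using True that by (intro mult_left_mono power_mono) auto
    also have "\<dots> \<le> ?I (\<lambda>x. - f x)" using key[OF that(1)] True by simp
    finally have "- r \<le> ?I (\<lambda>x. - f x) / s ^ n" using that by (simp add: pos_le_divide_eq)
    then show ?thesis using that by simp
  qed
  \<comment> \<open>Applying \<open>keys\<close> with \<open>s + 1\<close> and splitting this
    parameter into \<open>s\<close> for \<open>g - f\<close> and 1 for \<open>- g\<close> gives a
    bound that depends on \<open>g\<close> alone.\<close>
  have lower: "- 1 - ?I (\<lambda>x. - g x) \<le> z" if gE: "g \<in> ?E" and zS: "z \<in> S g" for g z
  proof -
    obtain f r s where z: "z = r + s + ?I (\<lambda>x. g x - f x) / s ^ n" "(f, r) \<in> K" "s > 0"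
      by (rule SE[OF zS]) blast
    have "- r \<le> (s + 1) + ?I (\<lambda>x. - f x) / (s + 1) ^ n" using keys[OF z(2), of "s + 1"] z by simp
    also have "(\<lambda>x. - f x) = (\<lambda>x. (g x - f x) + (- g x))" by auto
    also have "?I \<dots> / (s + 1) ^ n \<le> ?I (\<lambda>x. g x - f x) / s ^ n + ?I (\<lambda>x. - g x) / 1 ^ n"
      by (intro pos_power_integral_add Ediff Eneg gE KE[OF z(2)] z) auto
    finally show ?thesis using z by simp
  qed
  have bdd: "bdd_below (S g)" if "g \<in> ?E" for g using lower[OF that] unfolding bdd_below_def by blast
  have ne: "S g \<noteq> {}" for g
  proof -
    have "0 + 1 + ?I (\<lambda>x. g x - 0) / 1 ^ n \<in> S g"
      unfolding S_def using K0 by (intro CollectI exI[of _ "\<lambda>_. 0"] exI[of _ 0] exI[of _ 1]) auto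
    then show ?thesis by blast
  qed
  define p where "p g = Inf (S g)" for g
  have p_le: "p g \<le> r + s + ?I (\<lambda>x. g x - f x) / s ^ n" if "g \<in> ?E" "(f, r) \<in> K" "s > 0" for g f r s
    unfolding p_def by (rule cInf_lower[OF _ bdd[OF that(1)]]) (use that in \<open>auto simp: S_def\<close>)
  have I0: "?I (\<lambda>x. 0) = 0" by (simp add: pos_power_integral_def)
  have p0: "p (\<lambda>_. 0) = 0"
  proof (rule antisym)
    show "p (\<lambda>_. 0) \<le> 0"
    proof (rule field_le_epsilon)
      fix e :: real assume "e > 0"
      then show "p (\<lambda>_. 0) \<le> 0 + e" using p_le[OF E0 K0, of e] I0 by simp
    qed
    show "0 \<le> p (\<lambda>_. 0)"
      unfolding p_def
    proof (rule cInf_greatest[OF ne])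
      fix z assume "z \<in> S (\<lambda>_. 0)"
      then obtain f r s where z: "z = r + s + ?I (\<lambda>x. 0 - f x) / s ^ n" "(f, r) \<in> K" "s > 0"
        by (rule SE) blast
      then show "0 \<le> z" using keys[OF z(2,3)] by simp
    qed
  qed
  have p_add: "p (\<lambda>x. f x + g x) \<le> p f + p g" if fE: "f \<in> ?E" and gE: "g \<in> ?E" for f g
  proof -
    have "p (\<lambda>x. f x + g x) \<le> y + z" if "y \<in> S f" "z \<in> S g" for y z
    proof -
      obtain f1 r1 s1 where y: "y = r1 + s1 + ?I (\<lambda>x. f x - f1 x) / s1 ^ n" "(f1, r1) \<in> K" "s1 > 0"
        by (rule SE[OF \<open>y \<in> S f\<close>]) blast
      obtain f2 r2 s2 where z: "z = r2 + s2 + ?I (\<lambda>x. g x - f2 x) / s2 ^ n" "(f2, r2) \<in> K" "s2 > 0"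
        by (rule SE[OF \<open>z \<in> S g\<close>]) blast
      have "p (\<lambda>x. f x + g x) \<le> (r1 + r2) + (s1 + s2) + ?I (\<lambda>x. (f x + g x) - (f1 x + f2 x)) / (s1 + s2) ^ n"
        by (intro p_le Kadd bounded_measurable_add fE gE) (use y z in auto)
      also have "(\<lambda>x. (f x + g x) - (f1 x + f2 x)) = (\<lambda>x. (f x - f1 x) + (g x - f2 x))" by auto
      also have "?I \<dots> / (s1 + s2) ^ n \<le> ?I (\<lambda>x. f x - f1 x) / s1 ^ n + ?I (\<lambda>x. g x - f2 x) / s2 ^ n"
        by (intro pos_power_integral_add Ediff fE gE) (use y z KE in auto)
      finally show ?thesis using y z by simp
    qed
    then have "p (\<lambda>x. f x + g x) - z \<le> p f" if "z \<in> S g" for z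
      unfolding p_def[of f] using that by (intro cInf_greatest[OF ne]) (auto simp: algebra_simps)
    then have "p (\<lambda>x. f x + g x) - p f \<le> p g"
      unfolding p_def[of g] by (intro cInf_greatest[OF ne]) (auto simp: algebra_simps)
    then show ?thesis by simp
  qed
  have p_scale_le: "p (\<lambda>x. c * f x) \<le> c * p f" if fE: "f \<in> ?E" and c: "c > 0" for f c
  proof -
    have "p (\<lambda>x. c * f x) / c \<le> z" if "z \<in> S f" for z
    proof -
      obtain f1 r1 s1 where y: "z = r1 + s1 + ?I (\<lambda>x. f x - f1 x) / s1 ^ n" "(f1, r1) \<in> K" "s1 > 0"
        by (rule SE[OF \<open>z \<in> S f\<close>]) blast
      have "p (\<lambda>x. c * f x) \<le> c * r1 + c * s1 + ?I (\<lambda>x. c * f x - c * f1 x) / (c * s1) ^ n"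
        by (intro p_le Kscale bounded_measurable_scale fE) (use y c in auto)
      also have "(\<lambda>x. c * f x - c * f1 x) = (\<lambda>x. c * (f x - f1 x))" by (auto simp: algebra_simps)
      also have "c * r1 + c * s1 + ?I \<dots> / (c * s1) ^ n = c * z"
        unfolding pos_power_integral_scale[OF c] using c y(3) by (simp add: y(1) power_mult_distrib distrib_left)
      finally show ?thesis using c by (simp add: field_simps)
    qed
    then have "p (\<lambda>x. c * f x) / c \<le> p f" unfolding p_def[of f] by (intro cInf_greatest[OF ne])
    then show ?thesis using c by (simp add: field_simps)
  qed
  have p_scale: "p (\<lambda>x. c * f x) = c * p f" if fE: "f \<in> ?E" and c: "c > 0" for f c
  proof (rule antisym)
    have "p (\<lambda>x. (1/c) * (c * f x)) \<le> (1/c) * p (\<lambda>x. c * f x)"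
      using c by (intro p_scale_le bounded_measurable_scale fE) auto
    then show "c * p f \<le> p (\<lambda>x. c * f x)" using c by (simp add: field_simps)
  qed (rule p_scale_le[OF that])
  obtain l where l: "\<And>f g. f \<in> ?E \<Longrightarrow> g \<in> ?E \<Longrightarrow> l (\<lambda>x. f x + g x) = l f + l g"
    "\<And>f c. f \<in> ?E \<Longrightarrow> l (\<lambda>x. c * f x) = c * l f" "\<And>f. f \<in> ?E \<Longrightarrow> l f \<le> p f"
    by (rule hahn_banach_dominated[of ?E p])
      (rule E0, erule (1) bounded_measurable_add, erule bounded_measurable_scale, rule p0, erule (1) p_add,
       erule (1) p_scale, rule that)
  have lK: "l f \<le> r" if "(f, r) \<in> K" for f r
  proof (rule field_le_epsilon)
    fix e :: real assume "e > 0"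
    then show "l f \<le> r + e" using l(3)[OF KE[OF that]] p_le[OF KE[OF that] that, of e] I0 by simp
  qed
  have lI: "l f \<le> s + ?I f / s ^ n" if "f \<in> ?E" "s > 0" for f s
    using l(3)[OF that(1)] p_le[OF that(1) K0 that(2)] by simp
  show ?thesis
  proof (intro exI[of _ l] conjI ballI allI impI, goal_cases)
    case (1 f g) then show ?case by (rule l(1))
  next
    case (2 f c) then show ?case by (rule l(2))
  next
    case (3 z) then show ?case using lK by (cases z) simp
  next
    case (4 f s) then show ?case by (rule lI)
  qed
qed

text \<open>Domination by the positive part forces \<open>l\<close> to be positive, since the
  negative of a nonnegative function has no positive part. On an indicator the bound reads
  \<open>s + measure M A / s ^ n\<close>; for small \<open>s\<close> it gives continuity at the
  empty set and vanishing on null sets. So \<open>l\<close> on indicators is a measure, absolutely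
  continuous with respect to \<open>M\<close>.\<close>

lemma (in finite_measure) exists_dominated_measure:
  fixes K :: "(('a \<Rightarrow> real) \<times> real) set" and n :: nat
  assumes spU: "space M = UNIV"
    and KE: "\<And>f r. (f, r) \<in> K \<Longrightarrow> f \<in> bounded_measurable M"
    and K0: "((\<lambda>_. 0), 0) \<in> K"
    and Kadd: "\<And>f r g s. (f, r) \<in> K \<Longrightarrow> (g, s) \<in> K \<Longrightarrow> ((\<lambda>x. f x + g x), r + s) \<in> K"
    and Kscale: "\<And>f r c. (f, r) \<in> K \<Longrightarrow> c > 0 \<Longrightarrow> ((\<lambda>x. c * f x), c * r) \<in> K"
    and key: "\<And>f r. (f, r) \<in> K \<Longrightarrow> r < 0 \<Longrightarrow> (- r) ^ Suc n \<le> pos_power_integral M (Suc n) (\<lambda>x. - f x)"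
  obtains N where "sets N = sets M" "finite_measure N" "absolutely_continuous M N"
    "\<And>f r. (f, r) \<in> K \<Longrightarrow> (\<integral>x. f x \<partial>N) \<le> r"
proof -
  let ?E = "bounded_measurable M" and ?I = "pos_power_integral M (Suc n)"
  have "\<exists>l. (\<forall>f\<in>?E. \<forall>g\<in>?E. l (\<lambda>x. f x + g x) = l f + l g)
    \<and> (\<forall>f\<in>?E. \<forall>c. l (\<lambda>x. c * f x) = c * l f) \<and> (\<forall>(f, r)\<in>K. l f \<le> r)
    \<and> (\<forall>f\<in>?E. \<forall>s>0. l f \<le> s + ?I f / s ^ n)"
    by (rule exists_dominated_functional[where K = K])
      (erule KE, rule K0, erule (1) Kadd, erule (1) Kscale, erule (1) key)
  then obtain l where l: "(\<forall>f\<in>?E. \<forall>g\<in>?E. l (\<lambda>x. f x + g x) = l f + l g)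
    \<and> (\<forall>f\<in>?E. \<forall>c. l (\<lambda>x. c * f x) = c * l f) \<and> (\<forall>(f, r)\<in>K. l f \<le> r)
    \<and> (\<forall>f\<in>?E. \<forall>s>0. l f \<le> s + ?I f / s ^ n)"
    by (elim exE)
  note ladd = l[THEN conjunct1, rule_format]
    and lscale = l[THEN conjunct2, THEN conjunct1, rule_format]
    and lle = l[THEN conjunct2, THEN conjunct2, THEN conjunct2, rule_format]
  have lK: "l f \<le> r" if "(f, r) \<in> K" for f r
    using bspec[OF l[THEN conjunct2, THEN conjunct2, THEN conjunct1] that] by simp
  have E0: "(\<lambda>_. 0) \<in> ?E" using KE[OF K0] .
  have l0: "l (\<lambda>_. 0) = 0" using lscale[OF E0, of 0] by simp
  have ind0: "indicator {} = (\<lambda>_::'a. 0 :: real)" by auto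
  have lpos: "0 \<le> l f" if "f \<in> ?E" "\<And>x. 0 \<le> f x" for f
  proof -
    have neg: "(\<lambda>x. (- 1) * f x) \<in> ?E" by (rule bounded_measurable_scale[OF that(1)])
    have "?I (\<lambda>x. (- 1) * f x) = 0" unfolding pos_power_integral_def using that(2) by (simp add: max_absorb1)
    then have "l (\<lambda>x. (- 1) * f x) \<le> 0 + e" if "e > 0" for e using lle[OF neg that] by simp
    then have "l (\<lambda>x. (- 1) * f x) \<le> 0" by (rule field_le_epsilon)
    then show ?thesis using lscale[OF that(1), of "- 1"] by simp
  qed
  have ldiff: "l (\<lambda>x. f x - g x) = l f - l g" if "f \<in> ?E" "g \<in> ?E" for f g
    using ladd[OF that(1) bounded_measurable_scale[OF that(2), of "-1"]] lscale[OF that(2), of "-1"] by simp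
  have Ediff: "(\<lambda>x. f x - g x) \<in> ?E" if "f \<in> ?E" "g \<in> ?E" for f g
    using bounded_measurable_add[OF that(1) bounded_measurable_scale[OF that(2), of "-1"]] by simp
  have lmono: "l f \<le> l g" if "f \<in> ?E" "g \<in> ?E" "\<And>x. f x \<le> g x" for f g
    using lpos[OF Ediff[OF that(2,1)]] ldiff[OF that(2,1)] that(3) by simp
  have indE: "indicator A \<in> ?E" if "A \<in> sets M" for A
    using that unfolding bounded_measurable_def by (auto intro!: exI[of _ 1] simp: indicator_def)
  define m where "m A = ennreal (l (indicator A))" for A
  have m_nn: "0 \<le> l (indicator A)" if "A \<in> sets M" for A by (rule lpos[OF indE[OF that]]) simp
  have mI: "?I (indicator A) = measure M A" if "A \<in> sets M" for A
  proof -
    have "(\<lambda>x. (max 0 (indicator A x :: real)) ^ Suc n) = indicator A" by (auto simp: indicator_def)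
    then show ?thesis using that unfolding pos_power_integral_def by (simp only: integral_indicator) (simp add: fmeasurable_eq_sets)
  qed
  have l_ind_le: "l (indicator A) \<le> s + measure M A / s ^ n" if "A \<in> sets M" "s > 0" for A s
    using lle[OF indE[OF that(1)] that(2)] mI[OF that(1)] by simp
  have "countably_additive (sets M) m"
  proof (rule sets.empty_continuous_imp_countably_additive)
    show "positive (sets M) m" unfolding positive_def m_def ind0 using l0 by simp
    show "additive (sets M) m"
      unfolding additive_def
    proof (intro ballI impI)
      fix A B assume *: "A \<in> sets M" "B \<in> sets M" "A \<inter> B = {}"
      have "(indicator (A \<union> B) :: _ \<Rightarrow> real) = (\<lambda>x. indicator A x + indicator B x)"
        using * by (intro ext) (auto simp: indicator_def)
      then show "m (A \<union> B) = m A + m B"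
        unfolding m_def using ladd[OF indE[OF *(1)] indE[OF *(2)]] m_nn * by (simp add: ennreal_plus)
    qed
    show "\<forall>A\<in>sets M. m A \<noteq> \<infinity>" by (simp add: m_def)
    fix A :: "nat \<Rightarrow> 'a set" assume A: "range A \<subseteq> sets M" "decseq A" "(\<Inter>i. A i) = {}"
    have As: "A i \<in> sets M" for i using A by auto
    have lim: "(\<lambda>i. measure M (A i)) \<longlonglongrightarrow> 0"
      using finite_Lim_measure_decseq[OF A(1,2)] A(3) by simp
    have "(\<lambda>i. l (indicator (A i))) \<longlonglongrightarrow> 0"
    proof (rule LIMSEQ_I)
      \<comment> \<open>The threshold below is chosen so that \<open>s = e / 2\<close> in
        \<open>l_ind_le\<close> makes each of its two terms at most \<open>e / 2\<close>.\<close>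
      fix e :: real assume e: "e > 0"
      have "\<forall>\<^sub>F i in sequentially. measure M (A i) < (e/2) * (e/2) ^ n"
        using e by (intro order_tendstoD[OF lim]) auto
      then obtain k where k: "\<And>i. i \<ge> k \<Longrightarrow> measure M (A i) < (e/2) * (e/2) ^ n"
        unfolding eventually_sequentially by blast
      have "norm (l (indicator (A i)) - 0) < e" if "i \<ge> k" for i
      proof -
        have "measure M (A i) / (e/2) ^ n < e / 2"
          using k[OF that] e by (simp add: pos_divide_less_eq)
        moreover have "l (indicator (A i)) \<le> e / 2 + measure M (A i) / (e/2) ^ n"
          using l_ind_le[OF As] e by simp
        moreover have "\<bar>l (indicator (A i))\<bar> = l (indicator (A i))" using m_nn[OF As] by simp
        ultimately show ?thesis unfolding diff_0_right real_norm_def by linarith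
      qed
      then show "\<exists>k. \<forall>i\<ge>k. norm (l (indicator (A i)) - 0) < e" by blast
    qed
    then show "(\<lambda>i. m (A i)) \<longlonglongrightarrow> 0" unfolding m_def ennreal_0[symmetric] by (rule tendsto_ennrealI)
  qed
  define N where "N = measure_of (space M) (sets M) m"
  have setsN [simp, measurable_cong]: "sets N = sets M" by (simp add: N_def)
  have spN: "space N = UNIV" by (simp add: N_def spU)
  have emN: "emeasure N A = ennreal (l (indicator A))" if "A \<in> sets M" for A
    unfolding N_def using that \<open>countably_additive (sets M) m\<close> l0
    by (subst emeasure_measure_of_sigma) (auto simp: sets.sigma_algebra_axioms positive_def m_def ind0)
  have mN: "measure N A = l (indicator A)" if "A \<in> sets M" for A
    using emN[OF that] m_nn[OF that] by (simp add: measure_def)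
  interpret N: finite_measure N by (rule finite_measureI) (use emN[OF sets.top] in \<open>simp add: spN spU\<close>)
  have ac: "absolutely_continuous M N"
    unfolding absolutely_continuous_def
  proof
    fix A assume "A \<in> null_sets M"
    then have A: "A \<in> sets M" "measure M A = 0" by (auto simp: measure_def)
    have "l (indicator A) \<le> 0 + e" if "e > 0" for e using l_ind_le[OF A(1) that] A(2) by simp
    then have "l (indicator A) \<le> 0" by (rule field_le_epsilon)
    then show "A \<in> null_sets N" using emN[OF A(1)] A(1) by (auto simp: ennreal_neg)
  qed
  \<comment> \<open>This inequality carries the constraints over from \<open>l\<close> to
    \<open>N\<close>. The function is approximated from below by multiples of a mesh
    \<open>e\<close>; because it is bounded, finitely many values occur and finite additivity of
    \<open>l\<close> evaluates the approximation.\<close>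
  have integral_le: "(\<integral>x. f x \<partial>N) \<le> l f" if fE: "f \<in> ?E" for f
  proof -
    define L where "L = l (\<lambda>_. 1)"
    have E1: "(\<lambda>_. 1) \<in> ?E" using indE[OF sets.top] spU by simp
    have L0: "0 \<le> L" unfolding L_def by (rule lpos[OF E1]) simp
    obtain B where B: "\<And>x. \<bar>f x\<bar> \<le> B" and [measurable]: "f \<in> borel_measurable M"
      using fE unfolding bounded_measurable_def by auto
    have main: "(\<integral>x. f x \<partial>N) \<le> l f + e * (2 * L)" if e: "e > 0" for e
    proof -
      define J where "J = {\<lfloor>- B / e\<rfloor> .. \<lfloor>B / e\<rfloor>}"
      define A where "A k = {x \<in> space M. \<lfloor>f x / e\<rfloor> = k}" for k
      have Am[measurable]: "A k \<in> sets M" for k unfolding A_def by measurable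
      define g where "g x = (\<Sum>k\<in>J. (e * real_of_int k) * indicator (A k) x)" for x
      have gval: "g x = e * real_of_int \<lfloor>f x / e\<rfloor>" for x
      proof -
        have "- B \<le> f x" "f x \<le> B" using B[of x] by linarith+
        from this[THEN divide_right_mono[OF _ less_imp_le[OF e]]] have "- B / e \<le> f x / e" "f x / e \<le> B / e" .
        then have "\<lfloor>f x / e\<rfloor> \<in> J" unfolding J_def by (auto intro: floor_mono)
        then show ?thesis unfolding g_def A_def
          by (subst sum.remove[of _ "\<lfloor>f x / e\<rfloor>"]) (auto simp: J_def spU intro!: sum.neutral)
      qed
      define u where "u k = (\<lambda>x. (e * real_of_int k) * indicator (A k) x)" for k
      have uE: "u k \<in> ?E" for k unfolding u_def by (rule bounded_measurable_scale[OF indE[OF Am]])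
      have lu: "l (u k) = (e * real_of_int k) * measure N (A k)" for k
        unfolding u_def lscale[OF indE[OF Am]] mN[OF Am] ..
      have sumE: "(\<lambda>x. \<Sum>k\<in>F. u k x) \<in> ?E
         \<and> l (\<lambda>x. \<Sum>k\<in>F. u k x) = (\<Sum>k\<in>F. (e * real_of_int k) * measure N (A k))"
        if "finite F" for F using that
      proof (induction F)
        case empty then show ?case using E0 l0 by simp
      next
        case (insert k F)
        have "(\<lambda>x. \<Sum>k\<in>insert k F. u k x) = (\<lambda>x. u k x + (\<Sum>k\<in>F. u k x))" using insert by simp
        then show ?case using insert bounded_measurable_add[OF uE] ladd[OF uE] lu by simp
      qed
      have "g = (\<lambda>x. \<Sum>k\<in>J. u k x)" by (simp add: g_def u_def fun_eq_iff)
      then have gE: "g \<in> ?E" and lg: "l g = (\<Sum>k\<in>J. (e * real_of_int k) * measure N (A k))"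
        using sumE[of J] unfolding J_def by auto
      have gN: "integrable N g" "(\<integral>x. g x \<partial>N) = (\<Sum>k\<in>J. (e * real_of_int k) * measure N (A k))"
        unfolding g_def by (auto simp: spN less_top[symmetric])
      have fg: "g x \<le> f x" "f x \<le> g x + e" for x
      proof -
        have "real_of_int \<lfloor>f x / e\<rfloor> \<le> f x / e" "f x / e \<le> real_of_int \<lfloor>f x / e\<rfloor> + 1" by linarith+
        from this[THEN mult_left_mono[OF _ less_imp_le[OF e]]] have "e * real_of_int \<lfloor>f x / e\<rfloor> \<le> f x"
          "f x \<le> e * (real_of_int \<lfloor>f x / e\<rfloor> + 1)" using e by simp_all
        then show "g x \<le> f x" "f x \<le> g x + e" unfolding gval by (simp_all add: distrib_left)
      qed
      have fN: "integrable N f" using B by (intro N.integrable_const_bound[of _ B]) auto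
      have "(\<integral>x. f x \<partial>N) \<le> (\<integral>x. g x + e \<partial>N)" using fg fN gN by (intro integral_mono) auto
      also have "\<dots> = l g + e * measure N UNIV" using gN lg by (simp add: spN mult.commute)
      also have "measure N UNIV = L" unfolding L_def using mN[OF sets.top] spU by simp
      also have "l g \<le> l f" by (rule lmono[OF gE fE]) (use fg in auto)
      finally show ?thesis using mult_nonneg_nonneg[OF L0, of e] e by (simp add: algebra_simps)
    qed
    show ?thesis
    proof (rule field_le_epsilon)
      fix e :: real assume e: "e > 0"
      \<comment> \<open>Adding 1 to the denominator covers a total mass \<open>L\<close> equal to
        0.\<close>
      have "(e / (2 * L + 1)) * (2 * L) \<le> e" using L0 e by (simp add: field_simps)
      then show "(\<integral>x. f x \<partial>N) \<le> l f + e" using main[of "e / (2 * L + 1)"] L0 e by simp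
    qed
  qed
  show ?thesis
    by (rule that[OF setsN N.finite_measure_axioms ac]) (use integral_le KE lK in \<open>blast intro: order_trans\<close>)
qed

section \<open>Partial derivatives and quadratic forms\<close>

lemma has_real_derivative_along_axis:
  fixes f :: "real^'n \<Rightarrow> real"
  assumes "\<And>x. ((\<lambda>s. f (x + s *\<^sub>R axis i 1)) has_real_derivative g x) (at 0)"
  shows "((\<lambda>s. f (x + s *\<^sub>R axis i 1)) has_real_derivative g (x + s *\<^sub>R axis i 1)) (at s)"
proof -
  have "((\<lambda>r. f ((x + s *\<^sub>R axis i 1) + r *\<^sub>R axis i 1)) has_real_derivative g (x + s *\<^sub>R axis i 1)) (at 0)"
    by (rule assms)
  then have "((\<lambda>r. f (x + (r + s) *\<^sub>R axis i 1)) has_real_derivative g (x + s *\<^sub>R axis i 1)) (at 0)"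
    by (simp add: algebra_simps)
  then show ?thesis using DERIV_shift[of "\<lambda>s. f (x + s *\<^sub>R axis i 1)" _ 0 s] by simp
qed

lemma mvt_along_axis:
  fixes f :: "real^'n \<Rightarrow> real"
  assumes "\<And>x. ((\<lambda>s. f (x + s *\<^sub>R axis i 1)) has_real_derivative g x) (at 0)"
  obtains \<xi> where "\<bar>\<xi>\<bar> \<le> \<bar>s\<bar>" "f (x + s *\<^sub>R axis i 1) - f x = s * g (x + \<xi> *\<^sub>R axis i 1)"
proof -
  note D = has_real_derivative_along_axis[of f i g x, OF assms]
  consider "s = 0" | "s > 0" | "s < 0" by linarith
  then show ?thesis
  proof cases
    case 1 then show ?thesis using that[of 0] by simp
  next
    case 2
    obtain z where "0 < z" "z < s" "f (x + s *\<^sub>R axis i 1) - f (x + 0 *\<^sub>R axis i 1) = (s - 0) * g (x + z *\<^sub>R axis i 1)"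
      using MVT2[OF 2, of "\<lambda>s. f (x + s *\<^sub>R axis i 1)" "\<lambda>s. g (x + s *\<^sub>R axis i 1)", OF D] by blast
    then show ?thesis using that[of z] by simp
  next
    case 3
    obtain z where "s < z" "z < 0" "f (x + 0 *\<^sub>R axis i 1) - f (x + s *\<^sub>R axis i 1) = (0 - s) * g (x + z *\<^sub>R axis i 1)"
      using MVT2[OF 3, of "\<lambda>s. f (x + s *\<^sub>R axis i 1)" "\<lambda>s. g (x + s *\<^sub>R axis i 1)", OF D] by blast
    then show ?thesis using that[of z] by simp
  qed
qed

text \<open>The increment is made one coordinate at a time, each by the one-dimensional mean value
  theorem; the induction runs over the set \<open>S\<close> of coordinates in which \<open>h\<close>
  may be nonzero.\<close>

lemma has_derivative_continuous_partials:
  fixes f :: "real^'n \<Rightarrow> real"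
  assumes D: "\<And>i x. ((\<lambda>s. f (x + s *\<^sub>R axis i 1)) has_real_derivative g i x) (at 0)"
    and cont: "\<And>i. continuous_on UNIV (g i)"
  shows "(f has_derivative (\<lambda>h. \<Sum>i\<in>UNIV. g i x * h $ i)) (at x)"
proof -
  have main: "\<forall>e>0. \<exists>d>0. \<forall>h. norm h < d \<longrightarrow> (\<forall>i. i \<notin> S \<longrightarrow> h $ i = 0) \<longrightarrow>
      \<bar>f (x + h) - f x - (\<Sum>i\<in>S. g i x * h $ i)\<bar> \<le> e * norm h" if "finite S" for S :: "'n set"
    using that
  proof (induction S)
    case empty
    have "\<bar>f (x + h) - f x - (\<Sum>i\<in>{}. g i x * h $ i)\<bar> \<le> e * norm h" if "\<forall>i. h $ i = 0" for h e
    proof -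
      have "h = 0" using that by (simp add: vec_eq_iff)
      then show ?thesis by simp
    qed
    then show ?case by (auto intro: exI[of _ 1])
  next
    case (insert k S)
    show ?case
    proof (intro allI impI)
      fix e :: real assume e: "e > 0"
      obtain d1 where d1: "d1 > 0" "\<And>h. norm h < d1 \<Longrightarrow> (\<And>i. i \<notin> S \<Longrightarrow> h $ i = 0) \<Longrightarrow>
        \<bar>f (x + h) - f x - (\<Sum>i\<in>S. g i x * h $ i)\<bar> \<le> e / 2 * norm h"
        using insert.IH[rule_format, of "e / 2"] e by auto
      obtain d2 where d2: "d2 > 0" "\<And>y. dist y x < d2 \<Longrightarrow> dist (g k y) (g k x) < e / 2"
        using cont[of k] e unfolding continuous_on_iff by (metis UNIV_I half_gt_zero)
      show "\<exists>d>0. \<forall>h. norm h < d \<longrightarrow> (\<forall>i. i \<notin> insert k S \<longrightarrow> h $ i = 0) \<longrightarrow>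
        \<bar>f (x + h) - f x - (\<Sum>i\<in>insert k S. g i x * h $ i)\<bar> \<le> e * norm h"
      \<comment> \<open>The intermediate point differs from \<open>x\<close> by \<open>h'\<close>
        and a step along axis \<open>k\<close>, each of norm at most \<open>norm h\<close>; hence
        half of \<open>d2\<close>.\<close>
      proof (intro exI[of _ "min d1 (d2 / 2)"] conjI allI impI)
        show "0 < min d1 (d2 / 2)" using d1 d2 by simp
        fix h :: "real^'n" assume h: "norm h < min d1 (d2 / 2)" and supp: "\<forall>i. i \<notin> insert k S \<longrightarrow> h $ i = 0"
        define h' where "h' = (\<chi> i. if i = k then 0 else h $ i)"
        have hh: "h = h' + (h $ k) *\<^sub>R axis k 1" by (auto simp: h'_def vec_eq_iff axis_def)
        have nh': "norm h' \<le> norm h" by (rule norm_le_componentwise_cart) (simp add: h'_def)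
        have nk: "\<bar>h $ k\<bar> \<le> norm h" by (rule component_le_norm_cart)
        have s': "h' $ i = 0" if "i \<notin> S" for i using supp that insert.hyps by (auto simp: h'_def)
        obtain \<xi> where \<xi>: "\<bar>\<xi>\<bar> \<le> \<bar>h $ k\<bar>" "f (x + h' + (h $ k) *\<^sub>R axis k 1) - f (x + h') = (h $ k) * g k (x + h' + \<xi> *\<^sub>R axis k 1)"
          using mvt_along_axis[of f k "g k" "h $ k" "x + h'"] D by blast
        have "dist (x + h' + \<xi> *\<^sub>R axis k 1) x \<le> norm h' + \<bar>\<xi>\<bar>"
          using norm_triangle_ineq[of h' "\<xi> *\<^sub>R axis k 1"] by (simp add: dist_norm algebra_simps norm_axis_1)
        also have "\<dots> < d2" using nh' \<xi>(1) nk h by simp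
        finally have "\<bar>g k (x + h' + \<xi> *\<^sub>R axis k 1) - g k x\<bar> \<le> e / 2" using d2(2) by (force simp: dist_real_def)
        then have *: "\<bar>h $ k\<bar> * \<bar>g k (x + h' + \<xi> *\<^sub>R axis k 1) - g k x\<bar> \<le> norm h * (e / 2)"
          using nk by (intro mult_mono) auto
        then have A: "\<bar>f (x + h) - f (x + h') - g k x * h $ k\<bar> \<le> norm h * (e / 2)"
        proof -
          have xh: "x + h' + (h $ k) *\<^sub>R axis k 1 = x + h" using hh by (metis add.assoc)
          have "f (x + h) - f (x + h') - g k x * h $ k = h $ k * (g k (x + h' + \<xi> *\<^sub>R axis k 1) - g k x)"
            using \<xi>(2)[unfolded xh] by (simp add: right_diff_distrib)
          then show ?thesis using * by (simp add: abs_mult)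
        qed
        have "\<bar>f (x + h') - f x - (\<Sum>i\<in>S. g i x * h' $ i)\<bar> \<le> e / 2 * norm h'" using d1(2)[of h'] nh' h s' by simp
        also have "\<dots> \<le> e / 2 * norm h" using nh' e by simp
        also have "(\<Sum>i\<in>S. g i x * h' $ i) = (\<Sum>i\<in>S. g i x * h $ i)"
          using insert.hyps by (intro sum.cong) (auto simp: h'_def)
        finally have B: "\<bar>f (x + h') - f x - (\<Sum>i\<in>S. g i x * h $ i)\<bar> \<le> e / 2 * norm h" .
        have "\<bar>f (x + h) - f x - (\<Sum>i\<in>insert k S. g i x * h $ i)\<bar>
          \<le> \<bar>f (x + h) - f (x + h') - g k x * h $ k\<bar> + \<bar>f (x + h') - f x - (\<Sum>i\<in>S. g i x * h $ i)\<bar>"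
          using insert.hyps by simp
        also have "\<dots> \<le> e * norm h" using A B by (simp add: algebra_simps)
        finally show "\<bar>f (x + h) - f x - (\<Sum>i\<in>insert k S. g i x * h $ i)\<bar> \<le> e * norm h" .
      qed
    qed
  qed
  show ?thesis
    unfolding has_derivative_at_alt
  proof (intro conjI allI impI)
    show "bounded_linear (\<lambda>h. \<Sum>i\<in>UNIV. g i x * h $ i)"
      by (intro bounded_linear_sum bounded_linear_mult_right[THEN bounded_linear_compose] bounded_linear_vec_nth)
    fix e :: real assume "e > 0"
    then obtain d where "d > 0" "\<And>h. norm h < d \<Longrightarrow> \<bar>f (x + h) - f x - (\<Sum>i\<in>UNIV. g i x * h $ i)\<bar> \<le> e * norm h"
      using main[of UNIV] by auto
    from this(1) this(2)[of "_ - x"]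
    show "\<exists>d>0. \<forall>y. norm (y - x) < d \<longrightarrow> norm (f y - f x - (\<Sum>i\<in>UNIV. g i x * (y - x) $ i)) \<le> e * norm (y - x)"
      by (intro exI[of _ d]) auto
  qed
qed

text \<open>The second difference on the left is symmetric in \<open>i\<close> and \<open>j\<close>,
  whereas differentiating first along \<open>i\<close> and then along \<open>j\<close> expresses it
  through \<open>h i j\<close>. Comparing the two orders as \<open>s\<close> tends to 0 gives the
  symmetry of the Hessian.\<close>

lemma mixed_partials_mean_value:
  fixes f :: "real^'n \<Rightarrow> real"
  assumes D: "\<And>i x. ((\<lambda>s. f (x + s *\<^sub>R axis i 1)) has_real_derivative g i x) (at 0)"
    and DD: "\<And>i j x. ((\<lambda>s. g i (x + s *\<^sub>R axis j 1)) has_real_derivative h i j x) (at 0)"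
    and s: "s > 0"
  obtains y where "dist y x \<le> 2 * s"
    "f (x + s *\<^sub>R axis i 1 + s *\<^sub>R axis j 1) - f (x + s *\<^sub>R axis i 1) - f (x + s *\<^sub>R axis j 1) + f x = s * s * h i j y"
proof -
  define \<psi> where "\<psi> y = f (y + s *\<^sub>R axis j 1) - f y" for y
  have D\<psi>: "((\<lambda>r. \<psi> (y + r *\<^sub>R axis i 1)) has_real_derivative (g i (y + s *\<^sub>R axis j 1) - g i y)) (at 0)" for y
  proof -
    have "((\<lambda>r. f ((y + s *\<^sub>R axis j 1) + r *\<^sub>R axis i 1) - f (y + r *\<^sub>R axis i 1)) has_real_derivative
       (g i (y + s *\<^sub>R axis j 1) - g i y)) (at 0)"
      by (intro DERIV_diff D)
    then show ?thesis by (simp add: \<psi>_def algebra_simps)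
  qed
  obtain \<xi> where \<xi>: "\<bar>\<xi>\<bar> \<le> \<bar>s\<bar>" "\<psi> (x + s *\<^sub>R axis i 1) - \<psi> x = s * (g i (x + \<xi> *\<^sub>R axis i 1 + s *\<^sub>R axis j 1) - g i (x + \<xi> *\<^sub>R axis i 1))"
    using mvt_along_axis[of \<psi> i, OF D\<psi>] by blast
  obtain \<eta> where \<eta>: "\<bar>\<eta>\<bar> \<le> \<bar>s\<bar>" "g i (x + \<xi> *\<^sub>R axis i 1 + s *\<^sub>R axis j 1) - g i (x + \<xi> *\<^sub>R axis i 1)
      = s * h i j (x + \<xi> *\<^sub>R axis i 1 + \<eta> *\<^sub>R axis j 1)"
    using mvt_along_axis[of "g i" j, OF DD] by blast
  show ?thesis
  proof (rule that[of "x + \<xi> *\<^sub>R axis i 1 + \<eta> *\<^sub>R axis j 1"])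
    show "dist (x + \<xi> *\<^sub>R axis i 1 + \<eta> *\<^sub>R axis j 1) x \<le> 2 * s"
      using norm_triangle_ineq[of "\<xi> *\<^sub>R axis i (1::real)" "\<eta> *\<^sub>R axis j 1"] \<xi>(1) \<eta>(1) s
      by (simp add: dist_norm algebra_simps norm_axis_1)
    show "f (x + s *\<^sub>R axis i 1 + s *\<^sub>R axis j 1) - f (x + s *\<^sub>R axis i 1) - f (x + s *\<^sub>R axis j 1) + f x
       = s * s * h i j (x + \<xi> *\<^sub>R axis i 1 + \<eta> *\<^sub>R axis j 1)"
      using \<xi>(2) \<eta>(2) by (simp add: \<psi>_def)
  qed
qed

lemma mixed_partials_commute:
  fixes f :: "real^'n \<Rightarrow> real"
  assumes D: "\<And>i x. ((\<lambda>s. f (x + s *\<^sub>R axis i 1)) has_real_derivative g i x) (at 0)"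
    and DD: "\<And>i j x. ((\<lambda>s. g i (x + s *\<^sub>R axis j 1)) has_real_derivative h i j x) (at 0)"
    and cont: "\<And>i j. continuous_on UNIV (h i j)"
  shows "h i j x = h j i x"
proof (rule ccontr)
  assume "h i j x \<noteq> h j i x"
  then have e: "\<bar>h i j x - h j i x\<bar> / 2 > 0" (is "?e > 0") by simp
  obtain d1 where d1: "d1 > 0" "\<And>y. dist y x < d1 \<Longrightarrow> dist (h i j y) (h i j x) < ?e"
    using cont[of i j] e unfolding continuous_on_iff by (metis UNIV_I)
  obtain d2 where d2: "d2 > 0" "\<And>y. dist y x < d2 \<Longrightarrow> dist (h j i y) (h j i x) < ?e"
    using cont[of j i] e unfolding continuous_on_iff by (metis UNIV_I)
  define s where "s = min d1 d2 / 3"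
  have s: "s > 0" "2 * s < d1" "2 * s < d2" using d1 d2 by (auto simp: s_def)
  obtain y where y: "dist y x \<le> 2 * s"
    "f (x + s *\<^sub>R axis i 1 + s *\<^sub>R axis j 1) - f (x + s *\<^sub>R axis i 1) - f (x + s *\<^sub>R axis j 1) + f x = s * s * h i j y"
    using mixed_partials_mean_value[of f g h, OF D DD s(1)] by blast
  obtain z where z: "dist z x \<le> 2 * s"
    "f (x + s *\<^sub>R axis j 1 + s *\<^sub>R axis i 1) - f (x + s *\<^sub>R axis j 1) - f (x + s *\<^sub>R axis i 1) + f x = s * s * h j i z"
    using mixed_partials_mean_value[of f g h, OF D DD s(1)] by blast
  have comm: "x + s *\<^sub>R axis j 1 + s *\<^sub>R axis i 1 = x + s *\<^sub>R axis i 1 + s *\<^sub>R axis j 1" by (simp add: algebra_simps)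
  have "s * s * h i j y = s * s * h j i z" using y(2) z(2)[unfolded comm] by linarith
  then have "h i j y = h j i z" using s by simp
  moreover have "dist (h i j y) (h i j x) < ?e" "dist (h j i z) (h j i x) < ?e"
    using d1(2)[of y] d2(2)[of z] y(1) z(1) s by auto
  ultimately show False unfolding dist_real_def by (smt (verit) field_sum_of_halves)
qed

section \<open>Nonnegative quadratic forms: entries, trace and products\<close>

definition quad_form :: "('n::finite \<Rightarrow> 'n \<Rightarrow> real) \<Rightarrow> ('n \<Rightarrow> real) \<Rightarrow> real" where
  "quad_form Q y = (\<Sum>i\<in>UNIV. \<Sum>j\<in>UNIV. Q i j * y i * y j)"

lemma quad_form_shift:
  "quad_form Q (\<lambda>i. y i + t * (if i = k then 1 else 0))
    = quad_form Q y + t * (\<Sum>i\<in>UNIV. Q i k * y i) + t * (\<Sum>j\<in>UNIV. Q k j * y j) + t * t * Q k k"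
proof -
  let ?d = "\<lambda>i. if i = k then 1 else (0::real)"
  have e: "Q i j * (y i + t * ?d i) * (y j + t * ?d j)
     = Q i j * y i * y j + (if j = k then t * (Q i j * y i) else 0) + (if i = k then t * (Q i j * y j) else 0)
       + (if i = k then (if j = k then t * t * Q i j else 0) else 0)" for i j
    by (simp add: algebra_simps)
  have s: "(\<Sum>j\<in>UNIV. if i = k then F j else 0) = (if i = k then (\<Sum>j\<in>UNIV. F j) else (0::real))" for i and F :: "'a \<Rightarrow> real"
    by simp
  show ?thesis
    unfolding quad_form_def e sum.distrib s by (simp add: sum_distrib_left)
qed

lemma quad_form_delta: "quad_form Q (\<lambda>i. if i = k then 1 else 0) = Q k k"
proof -
  have "quad_form Q (\<lambda>i. 0 + 1 * (if i = k then 1 else 0)) = quad_form Q (\<lambda>i. 0) + 1 * 1 * Q k k"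
    unfolding quad_form_shift by simp
  then show ?thesis by (simp add: quad_form_def)
qed

lemma quad_form_pair:
  assumes "\<And>i j. Q i j = Q j i"
  shows "quad_form Q (\<lambda>i. (if i = j then 1 else 0) + t * (if i = k then 1 else 0)) = Q j j + 2 * t * Q j k + t * t * Q k k"
  unfolding quad_form_shift quad_form_delta using assms[of j k] by (simp add: if_distrib[of "\<lambda>x. _ * x"] cong: if_cong)

text \<open>The test vectors \<open>e_i + e_j\<close> and \<open>e_i - e_j\<close> bound an entry by
  the mean of two diagonal entries. In this way the trace of the negative Hessian controls its
  determinant without any eigenvalues.\<close>

lemma psd_entry_le:
  assumes "\<And>i j. Q i j = Q j i" and psd: "\<And>y. 0 \<le> quad_form Q y"
  shows "\<bar>Q i j\<bar> \<le> (\<Sum>k\<in>UNIV. Q k k)"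
proof -
  have d: "0 \<le> Q k k" for k using psd[of "\<lambda>i. if i = k then 1 else 0"] by (simp add: quad_form_delta)
  have t: "Q k k \<le> (\<Sum>k\<in>UNIV. Q k k)" for k using d by (intro member_le_sum) auto
  have pair: "0 \<le> Q i i + 2 * s * Q i j + s * s * Q j j" for s
    using psd[of "\<lambda>k. (if k = i then 1 else 0) + s * (if k = j then 1 else 0)"]
    unfolding quad_form_pair[of Q, OF assms(1)] .
  have "0 \<le> Q i i + 2 * Q i j + Q j j" "0 \<le> Q i i - 2 * Q i j + Q j j"
    using pair[of 1] pair[of "-1"] by simp_all
  then show ?thesis using t[of i] t[of j] by linarith
qed

lemma psd_zero_diag:
  assumes sym: "\<And>i j. Q i j = Q j i" and psd: "\<And>y. 0 \<le> quad_form Q y" and "Q k k = 0"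
  shows "Q j k = 0"
proof (rule ccontr)
  assume n: "Q j k \<noteq> 0"
  have "0 \<le> Q j j + 2 * t * Q j k" for t
    using psd[of "\<lambda>i. (if i = j then 1 else 0) + t * (if i = k then 1 else 0)"]
    unfolding quad_form_pair[of Q, OF sym] assms(3) by simp
  \<comment> \<open>At this \<open>t\<close> the supposedly nonnegative expression equals
    -1.\<close>
  from this[of "- (Q j j + 1) / (2 * Q j k)"] show False using n by (simp add: field_simps)
qed

text \<open>Induction on the number of nonzero diagonal entries: one step of Gaussian
  elimination splits off a rank one matrix.\<close>

lemma psd_trace_product_nonneg:
  assumes "\<And>i j. Q i j = Q j i" and "\<And>y. 0 \<le> quad_form Q y" and P: "\<And>y. 0 \<le> quad_form P y"
  shows "0 \<le> (\<Sum>i\<in>UNIV. \<Sum>j\<in>UNIV. P i j * Q i j)"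
  using assms(1,2)
proof (induction "card {i. Q i i \<noteq> 0}" arbitrary: Q rule: less_induct)
  case less
  note sym = less.prems(1) and psd = less.prems(2)
  show ?case
  proof (cases "\<exists>k. Q k k \<noteq> 0")
    case False
    then have "Q i j = 0" for i j using psd_zero_diag[of Q j i] sym psd by auto
    then show ?thesis by simp
  next
    case True
    then obtain k where k: "Q k k \<noteq> 0" by blast
    have kpos: "Q k k > 0" using psd[of "\<lambda>i. if i = k then 1 else 0"] k by (simp add: quad_form_delta)
    \<comment> \<open>The Schur complement: a rank one matrix is subtracted so that row and column
      \<open>k\<close> become 0.\<close>
    define Q' where "Q' i j = Q i j - Q i k * Q j k / Q k k" for i j
    have sym': "Q' i j = Q' j i" for i j unfolding Q'_def using sym[of i j] by (simp add: mult.commute)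
    have psd': "0 \<le> quad_form Q' y" for y
    proof -
      \<comment> \<open>At \<open>y\<close> the form of \<open>Q'\<close> is the minimum of the form
        of \<open>Q\<close> over the line \<open>y + t e_k\<close>, attained at
        \<open>t = - b / Q k k\<close>. This is why it stays nonnegative.\<close>
      define b where "b = (\<Sum>i\<in>UNIV. Q i k * y i)"
      have bb: "b = (\<Sum>j\<in>UNIV. Q k j * y j)" unfolding b_def using sym by (metis (no_types, lifting) sum.cong)
      have bsq: "b * b = (\<Sum>i\<in>UNIV. \<Sum>j\<in>UNIV. Q i k * Q j k * y i * y j)"
        unfolding b_def sum_product by (simp add: algebra_simps)
      have "quad_form Q' y = quad_form Q y - b * b / Q k k"
        unfolding quad_form_def Q'_def bsq
        by (simp add: algebra_simps sum_subtractf sum_divide_distrib)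
      moreover have "0 \<le> quad_form Q (\<lambda>i. y i + (- b / Q k k) * (if i = k then 1 else 0))" by (rule psd)
      moreover have "quad_form Q (\<lambda>i. y i + (- b / Q k k) * (if i = k then 1 else 0)) = quad_form Q y - b * b / Q k k"
        unfolding quad_form_shift b_def[symmetric] bb[symmetric] using k by (simp add: field_simps)
      ultimately show ?thesis by simp
    qed
    have "{i. Q' i i \<noteq> 0} \<subset> {i. Q i i \<noteq> 0}"
    proof
      show "{i. Q' i i \<noteq> 0} \<subseteq> {i. Q i i \<noteq> 0}"
      proof safe
        fix i assume "Q i i = 0" "Q' i i \<noteq> 0"
        then show False using psd_zero_diag[of Q i k, OF sym psd] sym[of i k] by (simp add: Q'_def)
      qed
      have "k \<in> {i. Q i i \<noteq> 0}" "k \<notin> {i. Q' i i \<noteq> 0}" using k by (auto simp: Q'_def)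
      then show "{i. Q' i i \<noteq> 0} \<noteq> {i. Q i i \<noteq> 0}" by blast
    qed
    then have "card {i. Q' i i \<noteq> 0} < card {i. Q i i \<noteq> 0}" by (intro psubset_card_mono) auto
    from less.hyps[OF this sym' psd'] have "0 \<le> (\<Sum>i\<in>UNIV. \<Sum>j\<in>UNIV. P i j * Q' i j)" .
    moreover have "0 \<le> quad_form P (\<lambda>i. Q i k) / Q k k" using P kpos by simp
    moreover have "(\<Sum>i\<in>UNIV. \<Sum>j\<in>UNIV. P i j * Q i j) = (\<Sum>i\<in>UNIV. \<Sum>j\<in>UNIV. P i j * Q' i j) + quad_form P (\<lambda>i. Q i k) / Q k k"
      unfolding quad_form_def Q'_def sum_divide_distrib sum.distrib[symmetric] by (simp add: algebra_simps)
    ultimately show ?thesis by simp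
  qed
qed

section \<open>The parabolic Aleksandrov-Bakelman-Pucci-Krylov estimate\<close>

text \<open>The change of variables theorems of the library need a well-ordered index type,
  which a finite type does not provide.\<close>

typedef 'a spacetime = "UNIV :: 'a option set" by auto

lemma range_Abs_spacetime: "(UNIV :: 'a spacetime set) = range Abs_spacetime"
  using type_definition.Abs_image[OF type_definition_spacetime] by (rule sym)

instance spacetime :: (finite) finite
  by standard (simp add: range_Abs_spacetime)

definition spacetime_rank :: "'a::finite spacetime \<Rightarrow> nat" where
  "spacetime_rank = (SOME f. inj f)"

lemma inj_spacetime_rank: "inj (spacetime_rank :: 'a::finite spacetime \<Rightarrow> nat)"
proof -
  have "\<exists>f :: 'a spacetime \<Rightarrow> nat. inj f"
    using finite_imp_inj_to_nat_seg[of "UNIV :: 'a spacetime set"] by auto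
  then show ?thesis unfolding spacetime_rank_def by (rule someI_ex)
qed

instantiation spacetime :: (finite) wellorder
begin

definition less_eq_spacetime :: "'a spacetime \<Rightarrow> 'a spacetime \<Rightarrow> bool" where
  "less_eq_spacetime a b \<longleftrightarrow> spacetime_rank a \<le> spacetime_rank b"

definition less_spacetime :: "'a spacetime \<Rightarrow> 'a spacetime \<Rightarrow> bool" where
  "less_spacetime a b \<longleftrightarrow> spacetime_rank a < spacetime_rank b"

instance
proof
  fix P :: "'a spacetime \<Rightarrow> bool" and a
  assume step: "\<And>x. (\<And>y. y < x \<Longrightarrow> P y) \<Longrightarrow> P x"
  show "P a"
    by (induction a rule: measure_induct_rule[of spacetime_rank]) (rule step, simp add: less_spacetime_def)
qed (auto simp: less_eq_spacetime_def less_spacetime_def dest: injD[OF inj_spacetime_rank])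

end

abbreviation sp :: "'a \<Rightarrow> 'a spacetime" where "sp i \<equiv> Abs_spacetime (Some i)"
abbreviation tm :: "'a spacetime" where "tm \<equiv> Abs_spacetime None"

lemma spacetime_distinct [simp]: "sp i \<noteq> tm" "tm \<noteq> sp i" "sp i = sp j \<longleftrightarrow> i = j"
  by (simp_all add: Abs_spacetime_inject)

lemma spacetime_cases: obtains i where "k = sp i" | "k = tm"
  by (metis Abs_spacetime_cases not_None_eq)

lemma UNIV_spacetime: "(UNIV :: 'a spacetime set) = insert tm (range sp)"
  by (auto intro: spacetime_cases)

lemma prod_spacetime: "(\<Prod>k\<in>(UNIV :: 'a::finite spacetime set). f k) = f tm * (\<Prod>i\<in>UNIV. f (sp i))"
proof -
  have "tm \<notin> range (sp :: 'a \<Rightarrow> _)" by auto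
  moreover have "inj (sp :: 'a \<Rightarrow> _)" by (auto intro: injI)
  ultimately show ?thesis unfolding UNIV_spacetime by (simp add: prod.reindex o_def)
qed

lemma CARD_spacetime: "CARD('a::finite spacetime) = CARD('a) + 1"
proof -
  have "tm \<notin> range (sp :: 'a \<Rightarrow> _)" by auto
  moreover have "inj (sp :: 'a \<Rightarrow> _)" by (auto intro: injI)
  ultimately show ?thesis unfolding UNIV_spacetime by (simp add: card_image)
qed

section \<open>Points of space-time as vectors\<close>

definition st_join :: "(real^'n) \<times> real \<Rightarrow> real^('n::finite spacetime)" where
  "st_join p = (\<chi> k. case Rep_spacetime k of Some i \<Rightarrow> fst p $ i | None \<Rightarrow> snd p)"

definition st_split :: "real^('n::finite spacetime) \<Rightarrow> (real^'n) \<times> real" where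
  "st_split z = (\<chi> i. z $ sp i, z $ tm)"

lemma st_join_nth [simp]: "st_join p $ sp i = fst p $ i" "st_join p $ tm = snd p"
  by (simp_all add: st_join_def Abs_spacetime_inverse)

lemma st_split_sel [simp]: "fst (st_split z) $ i = z $ sp i" "snd (st_split z) = z $ tm"
  by (simp_all add: st_split_def)

lemma vec_eq_spacetime: "(z :: real^('n::finite spacetime)) = z' \<longleftrightarrow> (\<forall>i. z $ sp i = z' $ sp i) \<and> z $ tm = z' $ tm"
  by (metis spacetime_cases vec_eq_iff)

lemma st_split_join [simp]: "st_split (st_join p) = p"
  by (simp add: st_split_def prod_eq_iff)

lemma st_join_split [simp]: "st_join (st_split z) = z"
  by (simp add: vec_eq_spacetime)

lemma linear_st_join: "linear (st_join :: _ \<Rightarrow> real^('n::finite spacetime))"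
  by (auto simp: linear_iff vec_eq_spacetime)

lemma linear_st_split: "linear (st_split :: real^('n::finite spacetime) \<Rightarrow> _)"
  by (auto simp: linear_iff st_split_def prod_eq_iff vec_eq_iff)

lemma borel_measurable_st_join [measurable]: "st_join \<in> borel_measurable borel"
  by (intro borel_measurable_continuous_onI linear_continuous_on linear_conv_bounded_linear[THEN iffD1] linear_st_join)

text \<open>Lebesgue measure is determined by its values on boxes, and the preimage of a box is a
  box in space times an interval in time. Integrals can thus be moved between the product, on which
  Fubini acts, and the vector space, on which change of variables acts.\<close>

lemma lborel_eq_distr_st_join: "(lborel :: (real^('n::finite spacetime)) measure) = distr lborel borel st_join"
proof (rule lborel_eqI)
  fix l u :: "real^('n spacetime)"
  assume le: "\<And>b. b \<in> Basis \<Longrightarrow> l \<bullet> b \<le> u \<bullet> b"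
  have le': "l $ k \<le> u $ k" for k using le[of "axis k 1"] by (simp add: inner_axis axis_in_Basis_iff)
  have "st_join -` box l u = box (fst (st_split l)) (fst (st_split u)) \<times> {l $ tm <..< u $ tm}"
    by (auto simp: mem_box_cart) (metis spacetime_cases st_join_nth fst_conv snd_conv)+
  then have "emeasure (distr lborel borel st_join) (box l u)
    = emeasure (lborel \<Otimes>\<^sub>M lborel) (box (fst (st_split l)) (fst (st_split u)) \<times> {l $ tm <..< u $ tm})"
    by (subst emeasure_distr) (auto simp: lborel_prod)
  also have "\<dots> = ennreal (\<Prod>i\<in>UNIV. (u - l) $ sp i) * ennreal (u $ tm - l $ tm)"
  proof -
    have "(\<Prod>b\<in>Basis. (fst (st_split u) - fst (st_split l)) \<bullet> b) = (\<Prod>i\<in>UNIV. (u - l) $ sp i)"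
      unfolding Basis_vec_def by (simp add: UNION_singleton_eq_range prod.reindex inj_on_def axis_eq_axis inner_axis o_def)
    then have "emeasure lborel (box (fst (st_split l)) (fst (st_split u))) = ennreal (\<Prod>i\<in>UNIV. (u - l) $ sp i)"
      by (subst emeasure_lborel_box) (auto simp: Basis_vec_def inner_axis le')
    then show ?thesis using le' by (subst lborel.emeasure_pair_measure_Times) auto
  qed
  also have "\<dots> = ennreal (\<Prod>k\<in>UNIV. (u - l) $ k)"
    using le' by (simp add: prod_spacetime ennreal_mult'[symmetric] prod_nonneg mult.commute)
  also have "(\<Prod>k\<in>UNIV. (u - l) $ k) = (\<Prod>b\<in>Basis. (u - l) \<bullet> b)"
    unfolding Basis_vec_def by (simp add: UNION_singleton_eq_range prod.reindex inj_on_def axis_eq_axis inner_axis o_def)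
  finally show "emeasure (distr lborel borel st_join) (box l u) = ennreal (\<Prod>b\<in>Basis. (u - l) \<bullet> b)" .
qed simp

text \<open>\<open>G\<close>, \<open>H\<close>, \<open>ut\<close> and \<open>Gt\<close> are the
  spatial gradient, the Hessian, the time derivative and the time derivative of the gradient. The
  gradient must be differentiable in space and time jointly because it is a component of the map
  whose Jacobian is integrated.\<close>

definition parabolic_reg ::
  "((real^'n) \<times> real \<Rightarrow> real) \<Rightarrow> ((real^'n) \<times> real \<Rightarrow> real^'n) \<Rightarrow> ((real^'n) \<times> real \<Rightarrow> real^'n^'n)
    \<Rightarrow> ((real^'n) \<times> real \<Rightarrow> real) \<Rightarrow> ((real^'n) \<times> real \<Rightarrow> real^'n) \<Rightarrow> bool" where
  "parabolic_reg u G H ut Gt \<longleftrightarrow>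
     (\<forall>p. (u has_derivative (\<lambda>q. G p \<bullet> fst q + ut p * snd q)) (at p))
   \<and> (\<forall>p. (G has_derivative (\<lambda>q. H p *v fst q + snd q *\<^sub>R Gt p)) (at p))
   \<and> (\<forall>p i j. H p $ i $ j = H p $ j $ i)
   \<and> continuous_on UNIV ut \<and> continuous_on UNIV H \<and> continuous_on UNIV Gt"

text \<open>Contact with a plane from above is replaced by its pointwise consequences: slope bound,
  time derivative and Hessian nonpositive. These conditions are visibly closed, and they are all
  that the Jacobian bound uses.\<close>

definition contact_set ::
  "((real^'n) \<times> real \<Rightarrow> real) \<Rightarrow> ((real^'n) \<times> real \<Rightarrow> real^'n) \<Rightarrow> ((real^'n) \<times> real \<Rightarrow> real^'n^'n)
    \<Rightarrow> ((real^'n) \<times> real \<Rightarrow> real) \<Rightarrow> ((real^'n) \<times> real) set \<Rightarrow> real \<Rightarrow> real \<Rightarrow> ((real^'n) \<times> real) set" where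
  "contact_set w G H wt Q m s = {p \<in> Q. m \<le> w p \<and> norm (G p) \<le> s \<and> wt p \<le> 0
     \<and> (\<forall>y. 0 \<le> quad_form (\<lambda>i j. - H p $ i $ j) y)}"

lemma parabolic_reg_continuous:
  assumes "parabolic_reg u G H ut Gt"
  shows "continuous_on UNIV u" "continuous_on UNIV G" "continuous_on UNIV ut" "continuous_on UNIV H" "continuous_on UNIV Gt"
  using assms unfolding parabolic_reg_def
  by (auto intro!: continuous_at_imp_continuous_on has_derivative_continuous)

lemma quad_form_matrix: "quad_form (\<lambda>i j. A $ i $ j) (\<lambda>i. y $ i) = y \<bullet> (A *v y)"
  by (simp add: quad_form_def inner_vec_def matrix_vector_mult_def sum_distrib_left algebra_simps)

text \<open>If \<open>c\<close> were positive, \<open>g'\<close> would be positive just to the right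
  of 0 and \<open>g\<close> would rise above \<open>g 0\<close> by the mean value theorem. A maximum
  from one side is enough because \<open>g' 0 = 0\<close> is given.\<close>

lemma second_derivative_at_max:
  fixes g g' :: "real \<Rightarrow> real"
  assumes d: "d > 0" and D: "\<And>s. (g has_real_derivative g' s) (at s)" and D2: "(g' has_real_derivative c) (at 0)"
    and max: "\<And>s. 0 < s \<Longrightarrow> s < d \<Longrightarrow> g s \<le> g 0" and 0: "g' 0 = 0"
  shows "c \<le> 0"
proof (rule ccontr)
  assume "\<not> c \<le> 0"
  then obtain e where e: "e > 0" "\<And>h. 0 < h \<Longrightarrow> h < e \<Longrightarrow> g' 0 < g' (0 + h)"
    using DERIV_pos_inc_right[OF D2] by auto
  define s where "s = min d e / 2"
  have s: "0 < s" "s < d" "s < e" using d e by (auto simp: s_def)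
  obtain z where "0 < z" "z < s" "g s - g 0 = (s - 0) * g' z" using MVT2[OF s(1), of g g', OF D] by blast
  then show False using e(2)[of z] 0 s max[of s] by (simp add: zero_less_mult_iff) (smt (verit) mult_pos_pos)
qed

text \<open>The point is found at the last time at which $w(x,t) - y \cdot (x - x_1)$
  reaches the height $h$.\<close>

lemma contact_point_exists:
  fixes w :: "(real^'n) \<times> real \<Rightarrow> real"
  assumes reg: "parabolic_reg w G H wt Gt"
    and r: "r > 0" and th: "\<theta> > 0" and t1: "t1 \<in> {0..T}"
    and top: "m + \<theta> \<le> w (x1, t1)"
    and bd: "\<And>x t. x \<in> cball x1 r \<Longrightarrow> t \<in> {0..T} \<Longrightarrow> dist x1 x = r \<or> t = T \<Longrightarrow> w (x, t) \<le> m"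
    and y: "norm y \<le> \<theta> / (4 * r)" and h: "m + \<theta> / 2 \<le> h" "h \<le> m + \<theta>"
  shows "\<exists>p\<in>contact_set w G H wt (cball x1 r \<times> {0..T}) (m + \<theta> / 4) (\<theta> / (4 * r)).
     G p = y \<and> w p - y \<bullet> (fst p - x1) = h"
proof -
  let ?Q = "cball x1 r \<times> {0..T}"
  have Dw: "\<And>p. (w has_derivative (\<lambda>q. G p \<bullet> fst q + wt p * snd q)) (at p)"
    and DG: "\<And>p. (G has_derivative (\<lambda>q. H p *v fst q + snd q *\<^sub>R Gt p)) (at p)"
    using reg unfolding parabolic_reg_def by auto
  define F where "F p = w p - y \<bullet> (fst p - x1)" for p
  have Fc: "continuous_on UNIV F" unfolding F_def
    by (intro continuous_intros continuous_on_fst continuous_on_id parabolic_reg_continuous[OF reg])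
  have inn: "\<bar>y \<bullet> (x - x1)\<bar> \<le> \<theta> / 4" if "x \<in> cball x1 r" for x
  proof -
    have "\<bar>y \<bullet> (x - x1)\<bar> \<le> norm y * norm (x - x1)" by (rule Cauchy_Schwarz_ineq2)
    also have "\<dots> \<le> \<theta> / (4 * r) * r" using y that r th by (intro mult_mono) (auto simp: dist_norm norm_minus_commute)
    finally show ?thesis using r by simp
  qed
  \<comment> \<open>The tilt by \<open>y\<close> changes \<open>w\<close> by at most
    \<open>\<theta> / 4\<close> on the ball, while \<open>h\<close> exceeds \<open>m\<close> by at
    least \<open>\<theta> / 2\<close>. So the height \<open>h\<close> is not reached on the lateral
    boundary or at time \<open>T\<close>.\<close>
  have bdF: "F (x, t) < h" if "x \<in> cball x1 r" "t \<in> {0..T}" "dist x1 x = r \<or> t = T" for x t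
    using bd[OF that] inn[OF that(1)] h th unfolding F_def by auto
  define C where "C = {p \<in> ?Q. h \<le> F p}"
  have Fcl: "closed {p. h \<le> F p}" by (intro closed_Collect_le continuous_on_const Fc)
  have "C = ?Q \<inter> {p. h \<le> F p}" by (auto simp: C_def)
  then have "compact C" using Fcl by (simp add: compact_Int_closed compact_Times)
  moreover have "(x1, t1) \<in> C" using top h t1 r by (simp add: C_def F_def)
  ultimately obtain q where q: "q \<in> C" "\<And>p. p \<in> C \<Longrightarrow> snd p \<le> snd q"
    using continuous_attains_sup[of C snd] continuous_on_snd[OF continuous_on_id] by (metis empty_iff)
  obtain xs ts where qe: "q = (xs, ts)" by force
  have xs: "xs \<in> cball x1 r" and ts: "ts \<in> {0..T}" and Fq: "h \<le> F (xs, ts)" using q(1) by (auto simp: C_def qe)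
  have tsT: "ts < T" using bdF[OF xs ts] Fq ts by fastforce
  have dxs: "dist x1 xs < r" using bdF[OF xs ts] Fq xs by fastforce
  have after: "F (x, t) < h" if "x \<in> cball x1 r" "ts < t" "t \<le> T" for x t
  proof (rule ccontr)
    assume "\<not> F (x, t) < h"
    then have "(x, t) \<in> C" using that ts by (auto simp: C_def)
    then show False using q(2)[of "(x, t)"] that qe by auto
  qed
  \<comment> \<open>Later times decrease to \<open>ts\<close>. Hence \<open>(xs, ts)\<close> is a
    spatial maximum of \<open>F\<close> with value \<open>h\<close>, which fixes the gradient and
    the sign of the Hessian; as all later values stay below \<open>h\<close>, the time derivative is
    not positive.\<close>
  have slice: "F (x, ts) \<le> h" if x: "x \<in> cball x1 r" for x
  proof (rule tendsto_upperbound)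
    have "continuous_on UNIV (\<lambda>t. F (x, t))" by (intro continuous_on_compose2[OF Fc] continuous_intros) auto
    then have "isCont (\<lambda>t. F (x, t)) ts" by (simp add: continuous_on_eq_continuous_at)
    then show "((\<lambda>t. F (x, t)) \<longlongrightarrow> F (x, ts)) (at_right ts)"
      unfolding isCont_def by (rule tendsto_mono[rotated]) (simp add: at_le)
    show "\<forall>\<^sub>F t in at_right ts. F (x, t) \<le> h"
      unfolding eventually_at_right_field using tsT after[OF x] by (intro exI[of _ T]) (auto intro: less_imp_le)
  qed simp
  have Fh: "F (xs, ts) = h" using slice[OF xs] Fq by simp
  have DF: "(F has_derivative (\<lambda>q. (G p - y) \<bullet> fst q + wt p * snd q)) (at p)" for p
    unfolding F_def by (rule has_derivative_eq_rhs, rule has_derivative_diff[OF Dw])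
      (auto intro!: derivative_eq_intros simp: inner_diff_left)
  have Gy: "G (xs, ts) = y"
  proof -
    have D: "((\<lambda>x. F (x, ts)) has_derivative (\<lambda>v. (G (xs, ts) - y) \<bullet> v)) (at xs)"
      using has_derivative_compose[of "\<lambda>x. (x, ts)" "\<lambda>v. (v, 0)" xs UNIV F, OF _ DF]
      by (simp add: has_derivative_Pair has_derivative_ident has_derivative_const)
    have "(\<lambda>v. (G (xs, ts) - y) \<bullet> v) = (\<lambda>v. 0)"
    proof (rule differential_zero_maxmin[of xs "ball x1 r" "\<lambda>x. F (x, ts)"])
      show "xs \<in> ball x1 r" using dxs by simp
      show "((\<lambda>x. F (x, ts)) has_derivative (\<lambda>v. (G (xs, ts) - y) \<bullet> v)) (at xs)" by (rule D)
      show "(\<forall>y\<in>ball x1 r. F (y, ts) \<le> F (xs, ts)) \<or> (\<forall>y\<in>ball x1 r. F (xs, ts) \<le> F (y, ts))"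
        using slice Fh by auto
    qed auto
    then have "(G (xs, ts) - y) \<bullet> (G (xs, ts) - y) = 0" by metis
    then show ?thesis by simp
  qed
  have wt0: "wt (xs, ts) \<le> 0"
  proof (rule ccontr)
    assume n: "\<not> wt (xs, ts) \<le> 0"
    have "((\<lambda>t. F (xs, t)) has_derivative (\<lambda>v. wt (xs, ts) * v)) (at ts)"
      using has_derivative_compose[of "\<lambda>t. (xs, t)" "\<lambda>v. (0, v)" ts UNIV F, OF _ DF]
      by (simp add: has_derivative_Pair has_derivative_ident has_derivative_const)
    then have "((\<lambda>t. F (xs, t)) has_real_derivative wt (xs, ts)) (at ts)" by (simp add: has_field_derivative_def)
    from DERIV_pos_inc_right[OF this] n obtain e where
      e: "e > 0" "\<And>d. 0 < d \<Longrightarrow> d < e \<Longrightarrow> F (xs, ts) < F (xs, ts + d)" by auto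
    define d where "d = min (e / 2) (T - ts)"
    have "0 < d" "d < e" "ts + d \<le> T" using e tsT by (auto simp: d_def)
    then show False using e(2)[of d] after[OF xs, of "ts + d"] Fh by auto
  qed
  have psd: "0 \<le> quad_form (\<lambda>i j. - H (xs, ts) $ i $ j) z" for z
  proof -
    define v :: "real^'n" where "v = (\<chi> i. z i)"
    have "v \<bullet> (H (xs, ts) *v v) \<le> 0"
    \<comment> \<open>The range of \<open>s\<close> keeps the segment inside the ball;
      \<open>norm v + 1\<close> avoids a division by 0.\<close>
    proof (rule second_derivative_at_max[where g = "\<lambda>s. F (xs + s *\<^sub>R v, ts)" and g' = "\<lambda>s. (G (xs + s *\<^sub>R v, ts) - y) \<bullet> v"
          and d = "(r - dist x1 xs) / (norm v + 1)"])
      have lin: "((\<lambda>s. (xs + s *\<^sub>R v, ts)) has_derivative (\<lambda>s. (s *\<^sub>R v, 0))) (at s)" for s :: real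
        by (auto intro!: derivative_eq_intros)
      have "((\<lambda>s. F (xs + s *\<^sub>R v, ts)) has_derivative (\<lambda>q. (G (xs + s *\<^sub>R v, ts) - y) \<bullet> (q *\<^sub>R v) + wt (xs + s *\<^sub>R v, ts) * 0)) (at s)" for s
        using has_derivative_compose[OF lin DF] by simp
      then show "((\<lambda>s. F (xs + s *\<^sub>R v, ts)) has_real_derivative (G (xs + s *\<^sub>R v, ts) - y) \<bullet> v) (at s)" for s
        by (simp add: has_field_derivative_def mult_commute_abs)
      have "((\<lambda>s. G (xs + s *\<^sub>R v, ts)) has_derivative (\<lambda>q. H (xs, ts) *v (q *\<^sub>R v))) (at 0)"
        using has_derivative_compose[OF lin[of 0] DG[of "(xs + 0 *\<^sub>R v, ts)"]] by simp
      then have "((\<lambda>s. (G (xs + s *\<^sub>R v, ts) - y) \<bullet> v) has_derivative (\<lambda>q. (H (xs, ts) *v (q *\<^sub>R v) - 0) \<bullet> v)) (at 0)"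
        by (intro has_derivative_inner_left has_derivative_diff has_derivative_const)
      then show "((\<lambda>s. (G (xs + s *\<^sub>R v, ts) - y) \<bullet> v) has_real_derivative v \<bullet> (H (xs, ts) *v v)) (at 0)"
        by (simp add: has_field_derivative_def matrix_vector_mult_scaleR inner_commute mult_commute_abs)
      show "0 < (r - dist x1 xs) / (norm v + 1)" using dxs by (intro divide_pos_pos) (auto intro: add_nonneg_pos)
      show "F (xs + s *\<^sub>R v, ts) \<le> F (xs + 0 *\<^sub>R v, ts)" if s: "0 < s" "s < (r - dist x1 xs) / (norm v + 1)" for s
      proof -
        have "s * (norm v + 1) < r - dist x1 xs" using s(2) by (subst (asm) pos_less_divide_eq) (auto intro: add_nonneg_pos)
        then have "norm (s *\<^sub>R v) \<le> r - dist x1 xs" using s by (simp add: algebra_simps)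
        then have "xs + s *\<^sub>R v \<in> cball x1 r"
          using norm_triangle_ineq[of "xs - x1" "s *\<^sub>R v"] by (simp add: dist_norm norm_minus_commute algebra_simps)
        then show ?thesis using slice Fh by simp
      qed
      show "(G (xs + 0 *\<^sub>R v, ts) - y) \<bullet> v = 0" using Gy by simp
    qed
    moreover have "quad_form (\<lambda>i j. - H (xs, ts) $ i $ j) z = - (v \<bullet> (H (xs, ts) *v v))"
      unfolding quad_form_matrix[symmetric] by (simp add: quad_form_def v_def sum_negf)
    ultimately show ?thesis by simp
  qed
  have "m + \<theta> / 4 \<le> w (xs, ts)" using Fh inn[OF xs] h th unfolding F_def by auto
  then have "(xs, ts) \<in> contact_set w G H wt ?Q (m + \<theta> / 4) (\<theta> / (4 * r))"
    unfolding contact_set_def using xs ts Gy y wt0 psd by simp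
  then show ?thesis using Gy Fh unfolding F_def by (intro bexI[of _ "(xs, ts)"]) auto
qed


text \<open>In the Leibniz expansion only permutations fixing \<open>tm\<close> survive, because the
  time row vanishes off the corner. The entries in the time column above the corner, which later
  hold the mixed derivative \<open>Gt\<close>, therefore never occur. Each of the
  \<open>(d + 1)!\<close> products is at most \<open>K ^ (d + 1)\<close>.\<close>

lemma det_block_bound:
  fixes A :: "real^('n::finite spacetime)^'n spacetime"
  assumes row: "\<And>i. A $ tm $ sp i = 0" and last: "\<bar>A $ tm $ tm\<bar> \<le> K" and K: "\<And>i j. \<bar>A $ sp i $ sp j\<bar> \<le> K"
  shows "\<bar>det A\<bar> \<le> fact (CARD('n) + 1) * K ^ (CARD('n) + 1)"
proof -
  have K0: "0 \<le> K" using last by linarith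
  have "\<bar>\<Prod>k\<in>UNIV. A $ k $ \<pi> k\<bar> \<le> K ^ CARD('n spacetime)" if \<pi>: "\<pi> permutes UNIV" for \<pi>
  proof (cases "\<pi> tm = tm")
    case False
    then obtain i where "\<pi> tm = sp i" by (metis spacetime_cases)
    then have "A $ tm $ \<pi> tm = 0" using row by simp
    then have "(\<Prod>k\<in>UNIV. A $ k $ \<pi> k) = 0" by (intro prod_zero) auto
    then show ?thesis using K0 by (metis abs_zero zero_le_power)
  next
    case True
    have "\<bar>A $ k $ \<pi> k\<bar> \<le> K" for k
    proof (cases k rule: spacetime_cases)
      case (1 i)
      have "\<pi> k \<noteq> tm" using permutes_inj[OF \<pi>] True 1 by (metis injD spacetime_distinct(1))
      then obtain j where "\<pi> k = sp j" by (metis spacetime_cases)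
      then show ?thesis using K 1 by simp
    next
      case 2 then show ?thesis using True last by simp
    qed
    then have "(\<Prod>k\<in>UNIV. \<bar>A $ k $ \<pi> k\<bar>) \<le> (\<Prod>k\<in>(UNIV :: 'n spacetime set). K)" by (intro prod_mono) auto
    then show ?thesis by (simp add: abs_prod)
  qed
  then have "\<bar>of_int (sign \<pi>) * (\<Prod>k\<in>UNIV. A $ k $ \<pi> k)\<bar> \<le> K ^ CARD('n spacetime)" if "\<pi> permutes UNIV" for \<pi>
    using that by (simp add: abs_mult sign_def)
  then have "\<bar>det A\<bar> \<le> (\<Sum>\<pi> | \<pi> permutes (UNIV :: 'n spacetime set). K ^ CARD('n spacetime))"
    unfolding det_def by (intro order_trans[OF sum_abs] sum_mono) auto
  also have "\<dots> = fact (CARD('n spacetime)) * K ^ CARD('n spacetime)"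
    by (simp add: card_permutations[OF refl finite])
  finally show ?thesis by (simp add: CARD_spacetime)
qed

text \<open>The inequality half of the area formula: values taken several times only enlarge the
  right side. Compactness of \<open>S\<close> and continuity of the Jacobian make it
  integrable.\<close>

lemma measure_image_le_nn_integral:
  fixes f :: "real^'m::{finite,wellorder} \<Rightarrow> real^'m::_"
  assumes S: "compact S" and D: "\<And>x. x \<in> S \<Longrightarrow> (f has_derivative f' x) (at x)"
    and cont: "continuous_on S (\<lambda>x. det (matrix (f' x)))"
    and sub: "cbox l u \<subseteq> f ` S"
  shows "emeasure lborel (cbox l u) \<le> (\<integral>\<^sup>+x. ennreal \<bar>det (matrix (f' x))\<bar> * indicator S x \<partial>lborel)"
proof -
  let ?d = "\<lambda>x. \<bar>det (matrix (f' x))\<bar>"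
  have int: "set_integrable lborel S ?d"
    unfolding set_integrable_def by (rule borel_integrable_compact[OF S]) (intro continuous_intros cont)
  have hk: "?d integrable_on S" "integral S ?d = (LINT x:S|lborel. ?d x)"
    using set_borel_integral_eq_integral[OF int] by auto
  have Sl: "S \<in> sets lebesgue" using S by (simp add: borel_compact)
  have "measure lebesgue (cbox l u) \<le> measure lebesgue (f ` S)"
    by (intro measure_mono_fmeasurable sub measurable_differentiable_image[OF Sl _ hk(1)])
      (auto intro: has_derivative_at_withinI D)
  also have "\<dots> \<le> integral S ?d"
    by (rule measure_differentiable_image[OF Sl _ hk(1)]) (auto intro: has_derivative_at_withinI D)
  finally have "measure lebesgue (cbox l u) \<le> (LINT x:S|lborel. ?d x)" unfolding hk(2) .
  moreover have "emeasure lborel (cbox l u) = ennreal (measure lebesgue (cbox l u))"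
    using emeasure_lborel_cbox_finite[of l u]
    by (subst measure_completion) (auto intro!: emeasure_eq_ennreal_measure)
  ultimately have "emeasure lborel (cbox l u) \<le> ennreal (LINT x:S|lborel. ?d x)"
    by (simp add: ennreal_leI)
  also have "\<dots> = (\<integral>\<^sup>+x. ennreal (indicator S x *\<^sub>R ?d x) \<partial>lborel)"
    unfolding set_lebesgue_integral_def using int unfolding set_integrable_def
    by (intro nn_integral_eq_integral[symmetric]) auto
  also have "\<dots> = (\<integral>\<^sup>+x. ennreal (?d x) * indicator S x \<partial>lborel)"
    by (intro nn_integral_cong) (auto simp: indicator_def)
  finally show ?thesis .
qed

lemma closed_contact_set:
  assumes reg: "parabolic_reg w G H wt Gt" and Q: "closed Q"
  shows "closed (contact_set w G H wt Q m s)"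
proof -
  note c = parabolic_reg_continuous[OF reg]
  have Hc: "continuous_on UNIV (\<lambda>p. H p $ i $ j)" for i j by (intro continuous_intros c)
  have "contact_set w G H wt Q m s = Q \<inter> {p. m \<le> w p} \<inter> {p. norm (G p) \<le> s} \<inter> {p. wt p \<le> 0}
      \<inter> (\<Inter>y. {p. 0 \<le> quad_form (\<lambda>i j. - H p $ i $ j) y})"
    by (auto simp: contact_set_def)
  moreover have cl: "closed {p. 0 \<le> quad_form (\<lambda>i j. - H p $ i $ j) y}" for y
    unfolding quad_form_def by (intro closed_Collect_le continuous_intros Hc)
  ultimately show ?thesis
    by (simp only:) (intro closed_Int closed_INT ballI Q; (rule cl | intro closed_Collect_le continuous_intros c))
qed

text \<open>The left side is the volume of a box of pairs of a slope and a height. Each slope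
  coordinate ranges over an interval of length \<open>\<theta> / (2 * r * CARD('n))\<close> centred
  at 0, which keeps the norm of the slope below \<open>\<theta> / (4 * r)\<close>; the height ranges
  over the interval from \<open>m + \<theta> / 2\<close> to \<open>m + \<theta>\<close>. By
  \<open>contact_point_exists\<close> every such pair comes from the contact set.\<close>

lemma parabolic_abp:
  fixes w :: "(real^'n) \<times> real \<Rightarrow> real"
  assumes reg: "parabolic_reg w G H wt Gt"
    and r: "r > 0" and th: "\<theta> > 0" and t1: "t1 \<in> {0..T}"
    and top: "m + \<theta> \<le> w (x1, t1)"
    and bd: "\<And>x t. x \<in> cball x1 r \<Longrightarrow> t \<in> {0..T} \<Longrightarrow> dist x1 x = r \<or> t = T \<Longrightarrow> w (x, t) \<le> m"
  shows "ennreal ((\<theta> / (2 * r * CARD('n))) ^ CARD('n) * (\<theta> / 2))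
    \<le> (\<integral>\<^sup>+p. ennreal (fact (CARD('n) + 1) * (- wt p - (\<Sum>i\<in>UNIV. H p $ i $ i)) ^ (CARD('n) + 1))
         * indicator (contact_set w G H wt (cball x1 r \<times> {0..T}) (m + \<theta> / 4) (\<theta> / (4 * r))) p \<partial>lborel)"
proof -
  define \<Gamma> where "\<Gamma> = contact_set w G H wt (cball x1 r \<times> {0..T}) (m + \<theta> / 4) (\<theta> / (4 * r))"
  have Dw: "\<And>p. (w has_derivative (\<lambda>q. G p \<bullet> fst q + wt p * snd q)) (at p)"
    and DG: "\<And>p. (G has_derivative (\<lambda>q. H p *v fst q + snd q *\<^sub>R Gt p)) (at p)"
    and Hsym: "\<And>p i j. H p $ i $ j = H p $ j $ i"
    using reg unfolding parabolic_reg_def by auto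
  note c = parabolic_reg_continuous[OF reg]
  have blj: "bounded_linear (st_join :: (real^'n) \<times> real \<Rightarrow> _)" and bls: "bounded_linear (st_split :: _ \<Rightarrow> (real^'n) \<times> real)"
    using linear_st_join linear_st_split linear_conv_bounded_linear by blast+
  have "\<Gamma> \<subseteq> cball x1 r \<times> {0..T}" by (auto simp: \<Gamma>_def contact_set_def)
  moreover have "closed \<Gamma>" unfolding \<Gamma>_def by (intro closed_contact_set[OF reg] closed_Times) auto
  ultimately have comp: "compact \<Gamma>"
    unfolding compact_eq_bounded_closed
    using bounded_subset[OF compact_imp_bounded[OF compact_Times[OF compact_cball compact_Icc]]] by blast
  define S where "S = st_join ` \<Gamma>"
  have compS: "compact S" unfolding S_def
    by (intro compact_continuous_image comp linear_continuous_on blj)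
  define \<Phi> where "\<Phi> p = (G p, w p - G p \<bullet> (fst p - x1))" for p
  define \<Phi>' where "\<Phi>' p q = (H p *v fst q + snd q *\<^sub>R Gt p, wt p * snd q - (H p *v fst q + snd q *\<^sub>R Gt p) \<bullet> (fst p - x1))" for p q
  have D\<Phi>: "(\<Phi> has_derivative \<Phi>' p) (at p)" for p
    unfolding \<Phi>_def \<Phi>'_def
    by (rule has_derivative_eq_rhs, rule has_derivative_Pair[OF DG has_derivative_diff[OF Dw has_derivative_inner[OF DG]]])
      (auto intro!: derivative_eq_intros simp: fun_eq_iff inner_commute)
  define f where "f z = st_join (\<Phi> (st_split z))" for z
  define f' where "f' z v = st_join (\<Phi>' (st_split z) (st_split v))" for z v
  have Df: "(f has_derivative f' z) (at z)" for z
    unfolding f_def f'_def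
    by (rule has_derivative_compose[OF has_derivative_compose[OF bounded_linear_imp_has_derivative[OF bls] D\<Phi>]
          bounded_linear_imp_has_derivative[OF blj], unfolded o_def])
  \<comment> \<open>The Jacobian matrix of \<Phi> after a row operation: its time row is that of
    \<open>wt\<close> minus the combination of the space rows with coefficients
    \<open>fst p - x1\<close>, and adding this combination back leaves only \<open>wt\<close> in the
    corner.\<close>
  define A where "A p = (\<chi> k l. case (Rep_spacetime k, Rep_spacetime l) of (Some i, Some j) \<Rightarrow> H p $ i $ j
      | (Some i, None) \<Rightarrow> Gt p $ i | (None, Some j) \<Rightarrow> 0 | (None, None) \<Rightarrow> wt p)" for p
  have A_nth: "A p $ sp i $ sp j = H p $ i $ j" "A p $ sp i $ tm = Gt p $ i" "A p $ tm $ sp j = 0" "A p $ tm $ tm = wt p" for p i j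
    by (simp_all add: A_def Abs_spacetime_inverse)
  have det_eq: "det (matrix (f' z)) = det (A (st_split z))" for z
  proof -
    define p where "p = st_split z"
    \<comment> \<open>The combination of space rows that leads from \<open>A p\<close> back to the
      Jacobian matrix without changing the determinant.\<close>
    define x where "x = (\<Sum>i\<in>UNIV. (- (fst p $ i - x1 $ i)) *\<^sub>R row (sp i) (A p))"
    have ax: "st_split (axis (sp j) 1) = (axis j 1, 0)" "st_split (axis tm 1) = (0, 1 :: real)" for j :: 'n
      by (auto simp: st_split_def axis_def vec_eq_iff prod_eq_iff)
    have Hax: "(H p *v axis j 1) $ i = H p $ i $ j" for i j
      by (simp add: matrix_vector_mul_component inner_axis)
    have rs: "row (sp i) (A p) \<in> {row j (A p) |j. j \<noteq> tm}" for i
      by (rule CollectI, rule exI[of _ "sp i"]) simp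
    have "x \<in> vec.span {row j (A p) |j. j \<noteq> tm}"
      unfolding x_def scalar_mult_eq_scaleR[symmetric]
      by (intro vec.span_sum vec.span_scale vec.span_base rs)
    then have "det (\<chi> k. if k = tm then row tm (A p) + x else row k (A p)) = det (A p)" by (rule det_row_span)
    moreover have "(\<chi> k. if k = tm then row tm (A p) + x else row k (A p)) = matrix (f' z)"
    proof -
      have e1: "row tm (A p) $ sp j + x $ sp j = f' z (axis (sp j) 1) $ tm" for j
        by (simp add: row_def x_def f'_def p_def[symmetric] \<Phi>'_def ax A_nth inner_vec_def Hax sum_negf[symmetric] algebra_simps)
      have e2: "row tm (A p) $ tm + x $ tm = f' z (axis tm 1) $ tm"
        by (simp add: row_def x_def f'_def p_def[symmetric] \<Phi>'_def ax A_nth inner_vec_def sum_negf[symmetric] sum_subtractf algebra_simps)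
      have e3: "row (sp i) (A p) $ sp j = f' z (axis (sp j) 1) $ sp i" for i j
        by (simp add: row_def f'_def p_def[symmetric] \<Phi>'_def ax A_nth Hax)
      have e4: "row (sp i) (A p) $ tm = f' z (axis tm 1) $ sp i" for i
        by (simp add: row_def f'_def p_def[symmetric] \<Phi>'_def ax A_nth)
      have "(\<chi> k. if k = tm then row tm (A p) + x else row k (A p)) $ k $ l = matrix (f' z) $ k $ l" for k l
        by (cases k rule: spacetime_cases; cases l rule: spacetime_cases) (simp_all add: matrix_def e1 e2 e3 e4)
      then show ?thesis by (simp add: vec_eq_iff)
    qed
    ultimately show ?thesis by (simp add: p_def)
  qed
  have contA: "continuous_on UNIV (\<lambda>p. A p $ k $ l)" for k l
  proof (cases k rule: spacetime_cases; cases l rule: spacetime_cases)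
  qed (auto simp: A_nth intro!: continuous_intros c)
  have contdet: "continuous_on UNIV (\<lambda>p. det (A p))"
    unfolding det_def by (intro continuous_intros contA)
  have cdet: "continuous_on S (\<lambda>z. det (matrix (f' z)))"
    unfolding det_eq by (intro continuous_on_compose2[OF contdet] linear_continuous_on bls) auto
  define lo up :: "real^'n spacetime" where
    "lo = st_join ((\<chi> i. - (\<theta> / (4 * r * CARD('n)))), m + \<theta> / 2)" and
    "up = st_join ((\<chi> i. \<theta> / (4 * r * CARD('n))), m + \<theta>)"
  have sub: "cbox lo up \<subseteq> f ` S"
  proof
    fix z assume z: "z \<in> cbox lo up"
    define y where "y = fst (st_split z)"
    have zz: "- (\<theta> / (4 * r * CARD('n))) \<le> z $ sp i \<and> z $ sp i \<le> \<theta> / (4 * r * CARD('n))" "m + \<theta> / 2 \<le> z $ tm" "z $ tm \<le> m + \<theta>" for i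
      using z unfolding mem_box_cart lo_def up_def by (metis st_join_nth fst_conv snd_conv vec_lambda_beta)+
    have "norm y \<le> (\<Sum>i\<in>UNIV. \<bar>y $ i\<bar>)" by (rule norm_le_l1_cart)
    also have "\<dots> \<le> (\<Sum>i\<in>(UNIV :: 'n set). \<theta> / (4 * r * CARD('n)))"
      using zz(1) by (intro sum_mono) (auto simp: y_def abs_le_iff minus_le_iff)
    also have "\<dots> = \<theta> / (4 * r)" using r by simp
    finally have "norm y \<le> \<theta> / (4 * r)" .
    from contact_point_exists[OF reg r th t1 top bd this zz(2,3)] obtain p where
      p: "p \<in> \<Gamma>" "G p = y" "w p - y \<bullet> (fst p - x1) = z $ tm" unfolding \<Gamma>_def by blast
    have "f (st_join p) = z" unfolding f_def \<Phi>_def vec_eq_spacetime using p by (simp add: y_def)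
    then show "z \<in> f ` S" using p(1) unfolding S_def by blast
  qed
  have "ennreal ((\<theta> / (2 * r * CARD('n))) ^ CARD('n) * (\<theta> / 2)) = emeasure lborel (cbox lo up)"
  proof -
    have le: "lo $ k \<le> up $ k" for k
      using th r by (cases k rule: spacetime_cases) (auto simp: lo_def up_def)
    have "(\<Prod>b\<in>Basis. (up - lo) \<bullet> b) = (\<Prod>k\<in>UNIV. (up - lo) $ k)"
      unfolding Basis_vec_def by (simp add: UNION_singleton_eq_range prod.reindex inj_on_def axis_eq_axis inner_axis o_def)
    also have "\<dots> = (\<theta> / (2 * r * CARD('n))) ^ CARD('n) * (\<theta> / 2)"
      unfolding prod_spacetime by (simp add: lo_def up_def mult.assoc)
    finally have eq: "(\<Prod>b\<in>Basis. (up - lo) \<bullet> b) = (\<theta> / (2 * r * CARD('n))) ^ CARD('n) * (\<theta> / 2)" .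
    have "emeasure lborel (cbox lo up) = ennreal (\<Prod>b\<in>Basis. (up - lo) \<bullet> b)"
      by (rule emeasure_lborel_cbox) (auto simp: Basis_vec_def inner_axis le)
    then show ?thesis unfolding eq by simp
  qed
  also have "\<dots> \<le> (\<integral>\<^sup>+z. ennreal \<bar>det (matrix (f' z))\<bar> * indicator S z \<partial>lborel)"
    by (rule measure_image_le_nn_integral[OF compS Df cdet sub])
  also have "\<dots> = (\<integral>\<^sup>+z. ennreal \<bar>det (A (st_split z))\<bar> * indicator S z \<partial>distr lborel borel st_join)"
    unfolding lborel_eq_distr_st_join[symmetric] det_eq ..
  also have "\<dots> = (\<integral>\<^sup>+p. ennreal \<bar>det (A (st_split (st_join p)))\<bar> * indicator S (st_join p) \<partial>lborel)"
  proof (rule nn_integral_distr)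
    have [measurable]: "(\<lambda>z. det (A (st_split z))) \<in> borel_measurable borel"
      by (intro borel_measurable_continuous_onI continuous_on_compose2[OF contdet] linear_continuous_on bls) auto
    have [measurable]: "S \<in> sets borel" using compS by (rule borel_compact)
    show "(\<lambda>z. ennreal \<bar>det (A (st_split z))\<bar> * indicator S z) \<in> borel_measurable (distr lborel borel st_join)"
      by measurable
  qed simp
  also have "\<dots> = (\<integral>\<^sup>+p. ennreal \<bar>det (A p)\<bar> * indicator \<Gamma> p \<partial>lborel)"
  proof -
    have "st_join p \<in> S \<longleftrightarrow> p \<in> \<Gamma>" for p
      unfolding S_def by (metis imageE imageI st_split_join)
    then have "indicator S (st_join p) = (indicator \<Gamma> p :: ennreal)" for p
      by (simp add: indicator_def)
    then show ?thesis by simp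
  qed
  also have "\<dots> \<le> (\<integral>\<^sup>+p. ennreal (fact (CARD('n) + 1) * (- wt p - (\<Sum>i\<in>UNIV. H p $ i $ i)) ^ (CARD('n) + 1)) * indicator \<Gamma> p \<partial>lborel)"
  proof (intro nn_integral_mono, goal_cases)
    case (1 p)
    show ?case
    proof (cases "p \<in> \<Gamma>")
      case True
      then have wt: "wt p \<le> 0" and psd: "\<And>y. 0 \<le> quad_form (\<lambda>i j. - H p $ i $ j) y"
        by (auto simp: \<Gamma>_def contact_set_def)
      have e: "\<bar>H p $ i $ j\<bar> \<le> - (\<Sum>k\<in>UNIV. H p $ k $ k)" for i j
        using psd_entry_le[OF _ psd, of i j] Hsym by (simp add: sum_negf)
      have e0: "0 \<le> - (\<Sum>k\<in>UNIV. H p $ k $ k)" using e[of undefined undefined] by (meson abs_ge_zero order_trans)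
      have "\<bar>det (A p)\<bar> \<le> fact (CARD('n) + 1) * (- wt p - (\<Sum>i\<in>UNIV. H p $ i $ i)) ^ (CARD('n) + 1)"
      proof (rule det_block_bound)
        show "\<bar>A p $ tm $ tm\<bar> \<le> - wt p - (\<Sum>i\<in>UNIV. H p $ i $ i)" using wt e0 by (simp add: A_nth)
        show "\<bar>A p $ sp i $ sp j\<bar> \<le> - wt p - (\<Sum>i\<in>UNIV. H p $ i $ i)" for i j using wt e[of i j] by (simp add: A_nth)
      qed (simp add: A_nth)
      then show ?thesis using True by (simp add: ennreal_leI)
    qed simp
  qed
  finally show ?thesis unfolding \<Gamma>_def .
qed

section \<open>Linear structure of the regularity class\<close>

lemma parabolic_regD:
  assumes "parabolic_reg u G H ut Gt"
  shows "(u has_derivative (\<lambda>q. G p \<bullet> fst q + ut p * snd q)) (at p)"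
    and "(G has_derivative (\<lambda>q. H p *v fst q + snd q *\<^sub>R Gt p)) (at p)"
    and "H p $ i $ j = H p $ j $ i"
  using assms unfolding parabolic_reg_def by blast+

lemma parabolic_reg_add:
  assumes "parabolic_reg u G H ut Gt" "parabolic_reg u' G' H' ut' Gt'"
  shows "parabolic_reg (\<lambda>p. u p + u' p) (\<lambda>p. G p + G' p) (\<lambda>p. H p + H' p) (\<lambda>p. ut p + ut' p) (\<lambda>p. Gt p + Gt' p)"
proof -
  note [continuous_intros] = parabolic_reg_continuous[OF assms(1)] parabolic_reg_continuous[OF assms(2)]
  have "((\<lambda>p. u p + u' p) has_derivative (\<lambda>q. (G p + G' p) \<bullet> fst q + (ut p + ut' p) * snd q)) (at p)" for p
    by (rule has_derivative_eq_rhs[OF has_derivative_add[OF assms[THEN parabolic_regD(1)]]])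
      (simp add: fun_eq_iff algebra_simps)
  moreover have "((\<lambda>p. G p + G' p) has_derivative (\<lambda>q. (H p + H' p) *v fst q + snd q *\<^sub>R (Gt p + Gt' p))) (at p)" for p
    by (rule has_derivative_eq_rhs[OF has_derivative_add[OF assms[THEN parabolic_regD(2)]]])
      (simp add: fun_eq_iff algebra_simps matrix_vector_mult_add_rdistrib)
  ultimately show ?thesis
    using assms[THEN parabolic_regD(3)] unfolding parabolic_reg_def by (auto intro!: continuous_intros)
qed

lemma parabolic_reg_scale:
  assumes "parabolic_reg u G H ut Gt"
  shows "parabolic_reg (\<lambda>p. c * u p) (\<lambda>p. c *\<^sub>R G p) (\<lambda>p. c *\<^sub>R H p) (\<lambda>p. c * ut p) (\<lambda>p. c *\<^sub>R Gt p)"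
proof -
  note [continuous_intros] = parabolic_reg_continuous[OF assms(1)]
  have "((\<lambda>p. c * u p) has_derivative (\<lambda>q. (c *\<^sub>R G p) \<bullet> fst q + (c * ut p) * snd q)) (at p)" for p
    by (rule has_derivative_eq_rhs[OF has_derivative_mult_right[OF parabolic_regD(1)[OF assms]]])
      (simp add: fun_eq_iff algebra_simps)
  moreover have "((\<lambda>p. c *\<^sub>R G p) has_derivative (\<lambda>q. (c *\<^sub>R H p) *v fst q + snd q *\<^sub>R (c *\<^sub>R Gt p))) (at p)" for p
    by (rule has_derivative_eq_rhs[OF has_derivative_scaleR_right[OF parabolic_regD(2)[OF assms]]])
      (simp add: fun_eq_iff algebra_simps scaleR_matrix_vector_assoc[symmetric])
  ultimately show ?thesis
    using parabolic_regD(3)[OF assms] unfolding parabolic_reg_def by (auto intro!: continuous_intros)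
qed

lemma parabolic_reg_time:
  assumes "\<And>t. (f has_real_derivative f' t) (at t)" and "continuous_on UNIV f'"
  shows "parabolic_reg (\<lambda>p. f (snd p)) (\<lambda>_. 0) (\<lambda>_. 0) (\<lambda>p. f' (snd p)) (\<lambda>_ :: (real^'n) \<times> real. 0)"
proof -
  have "((\<lambda>p :: (real^'n) \<times> real. f (snd p)) has_derivative (\<lambda>q. f' (snd p) * snd q)) (at p)" for p
    using assms(1)[of "snd p"] unfolding has_field_derivative_def
    by (rule has_derivative_compose[OF has_derivative_snd[OF has_derivative_ident]])
  then show ?thesis unfolding parabolic_reg_def
    by (auto intro!: continuous_intros continuous_on_compose2[OF assms(2)])
qed

lemma parabolic_reg_square_dist:
  "parabolic_reg (\<lambda>p. (fst p - x1) \<bullet> (fst p - x1)) (\<lambda>p. 2 *\<^sub>R (fst p - x1)) (\<lambda>_. 2 *\<^sub>R mat 1) (\<lambda>_. 0)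
     (\<lambda>_ :: (real^'n) \<times> real. 0)"
proof -
  have "(2 *\<^sub>R mat 1 :: real^'n^'n) $ i $ j = (2 *\<^sub>R mat 1) $ j $ i" for i j by (simp add: mat_def)
  moreover have "((\<lambda>p :: (real^'n) \<times> real. (fst p - x1) \<bullet> (fst p - x1)) has_derivative
      (\<lambda>q. (2 *\<^sub>R (fst p - x1)) \<bullet> fst q + 0 * snd q)) (at p)" for p
    by (auto intro!: derivative_eq_intros simp: inner_commute fun_eq_iff)
  moreover have "((\<lambda>p :: (real^'n) \<times> real. 2 *\<^sub>R (fst p - x1)) has_derivative
      (\<lambda>q. (2 *\<^sub>R mat 1) *v fst q + snd q *\<^sub>R 0)) (at p)" for p
    by (auto intro!: derivative_eq_intros simp: fun_eq_iff scaleR_matrix_vector_assoc[symmetric])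
  ultimately show ?thesis unfolding parabolic_reg_def by (auto intro: continuous_on_const)
qed

text \<open>This is the time derivative plus \<open>L\<close>, the operator dual to the Cauchy
  problem. The derivatives are arguments, matching those of \<open>parabolic_reg\<close>, so that
  linear combinations of test functions are treated without computing partial derivatives
  again.\<close>

definition backward_op ::
  "(real^'n::finite \<Rightarrow> real \<Rightarrow> 'n \<Rightarrow> 'n \<Rightarrow> real) \<Rightarrow> (real^'n \<Rightarrow> real \<Rightarrow> 'n \<Rightarrow> real) \<Rightarrow> (real^'n \<Rightarrow> real \<Rightarrow> real)
    \<Rightarrow> ((real^'n) \<times> real \<Rightarrow> real) \<Rightarrow> ((real^'n) \<times> real \<Rightarrow> real^'n) \<Rightarrow> ((real^'n) \<times> real \<Rightarrow> real^'n^'n)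
    \<Rightarrow> ((real^'n) \<times> real \<Rightarrow> real) \<Rightarrow> (real^'n) \<times> real \<Rightarrow> real" where
  "backward_op a b c u G H ut p = ut p
     + (\<Sum>i\<in>UNIV. \<Sum>j\<in>UNIV. a (fst p) (snd p) i j * H p $ i $ j)
     + (\<Sum>i\<in>UNIV. b (fst p) (snd p) i * G p $ i) + c (fst p) (snd p) * u p"

text \<open>\<open>A\<close> minus \<open>m0\<close> times the identity is still a nonnegative form,
  so its trace product with \<open>Q\<close> is nonnegative. The role of \<open>Q\<close> is played
  by the negative Hessian at a contact point.\<close>

lemma ellipticity_trace_le:
  assumes ell: "\<And>y. m0 * (\<Sum>i\<in>UNIV. y i * y i) \<le> quad_form A y"
    and sym: "\<And>i j. Q i j = Q j i" and psd: "\<And>y. 0 \<le> quad_form Q y"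
  shows "m0 * (\<Sum>i\<in>UNIV. Q i i) \<le> (\<Sum>i\<in>UNIV. \<Sum>j\<in>UNIV. A i j * Q i j)"
proof -
  define P where "P i j = A i j - (if i = j then m0 else 0)" for i j
  have "quad_form P y = quad_form A y - m0 * (\<Sum>i\<in>UNIV. y i * y i)" for y
    unfolding quad_form_def P_def
    by (simp add: left_diff_distrib sum_subtractf sum_distrib_left mult.assoc if_distrib[of "\<lambda>x. x * _"] cong: if_cong)
  then have "0 \<le> quad_form P y" for y using ell[of y] by simp
  then have "0 \<le> (\<Sum>i\<in>UNIV. \<Sum>j\<in>UNIV. P i j * Q i j)" by (rule psd_trace_product_nonneg[OF sym psd])
  also have "\<dots> = (\<Sum>i\<in>UNIV. \<Sum>j\<in>UNIV. A i j * Q i j) - m0 * (\<Sum>i\<in>UNIV. Q i i)"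
    unfolding P_def
    by (simp add: left_diff_distrib sum_subtractf sum_distrib_left if_distrib[of "\<lambda>x. x * _"] cong: if_cong)
  finally show ?thesis by simp
qed

lemma sum_coeff_le:
  fixes v :: "real^'n" and M :: real
  assumes "\<And>i. \<bar>b i\<bar> \<le> M"
  shows "(\<Sum>i\<in>UNIV. b i * v $ i) \<le> CARD('n) * M * norm v"
proof -
  have "b i * v $ i \<le> M * norm v" for i
  proof -
    have "b i * v $ i \<le> \<bar>b i\<bar> * \<bar>v $ i\<bar>" by (metis abs_ge_self abs_mult)
    also have "\<dots> \<le> M * norm v" using assms[of i] component_le_norm_cart[of v i] by (intro mult_mono) auto
    finally show ?thesis .
  qed
  then have "(\<Sum>i\<in>UNIV. b i * v $ i) \<le> (\<Sum>i\<in>(UNIV::'n set). M * norm v)" by (intro sum_mono)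
  then show ?thesis by simp
qed

text \<open>The paraboloid added at a maximum point has height \<open>s * abp_slope\<close>, where
  \<open>s\<close> is the supremum: small enough for its second and first order terms to be absorbed by the slope
  \<open>s / (2 * T)\<close> in time.\<close>

definition abp_slope :: "nat \<Rightarrow> real \<Rightarrow> real \<Rightarrow> real \<Rightarrow> real" where
  "abp_slope d T r M = min (1/8) (1 / (2 * T * (3 * d * M / r + 2 * d * M / r\<^sup>2 + 1)))"

text \<open>The volume inequality solved for \<open>s ^ (d + 1)\<close>: the reciprocal of the box
  volume at \<open>\<theta> = s * abp_slope\<close>, with \<open>fact (d + 1)\<close> coming from
  the determinant and \<open>min 1 m0\<close> from ellipticity.\<close>

definition abp_const :: "nat \<Rightarrow> real \<Rightarrow> real \<Rightarrow> real \<Rightarrow> real \<Rightarrow> real" where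
  "abp_const d T r m0 M = fact (d + 1) * (2 * r * d) ^ d * 2 / (abp_slope d T r M * min 1 m0) ^ (d + 1)"

text \<open>On the contact set everything but \<open>g\<close> is absorbed. There the gradient of
  \<open>w\<close> is at most \<open>\<theta> / (4 * r)\<close>, so the drift term needs no bound on
  the gradient of \<open>u\<close>, and \<open>u\<close> is nonnegative, so \<open>c * u\<close> has
  a favourable sign. The drift and paraboloid errors add up to at most \<open>\<theta> * K1\<close>,
  which the slope \<delta> in time outweighs. What remains bounds \<open>- wt\<close> plus the trace
  of the negative Hessian by the positive part of \<open>g\<close>, up to the ellipticity
  constant.\<close>

lemma parabolic_estimate_at_max:
  fixes u :: "(real^'n) \<times> real \<Rightarrow> real"
  assumes reg: "parabolic_reg u G H ut Gt"
    and r: "r > 0" and T: "T > 0" and m0: "m0 > 0" and M: "M \<ge> 0" and s: "s > 0" and t1: "t1 \<in> {0..T}"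
    and max: "\<And>x t. t \<in> {0..T} \<Longrightarrow> u (x, t) - s / (2 * T) * (T - t) \<le> u (x1, t1) - s / (2 * T) * (T - t1)"
    and maxval: "s / 2 \<le> u (x1, t1) - s / (2 * T) * (T - t1)"
    and final: "\<And>x. u (x, T) \<le> 0"
    and ell: "\<And>x t y. x \<in> cball x1 r \<Longrightarrow> t \<in> {0..T} \<Longrightarrow> m0 * (\<Sum>i\<in>UNIV. y i * y i) \<le> quad_form (a x t) y"
    and aM: "\<And>x t i j. x \<in> cball x1 r \<Longrightarrow> t \<in> {0..T} \<Longrightarrow> \<bar>a x t i j\<bar> \<le> M"
    and bM: "\<And>x t i. x \<in> cball x1 r \<Longrightarrow> t \<in> {0..T} \<Longrightarrow> \<bar>b x t i\<bar> \<le> M"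
    and c0: "\<And>x t. x \<in> cball x1 r \<Longrightarrow> t \<in> {0..T} \<Longrightarrow> c x t \<le> 0"
    and g: "\<And>x t. x \<in> cball x1 r \<Longrightarrow> t \<in> {0..T} \<Longrightarrow> - backward_op a b c u G H ut (x, t) \<le> g (x, t)"
    and gm: "g \<in> borel_measurable borel"
  shows "ennreal (s ^ (CARD('n) + 1)) \<le> ennreal (abp_const CARD('n) T r m0 M)
     * (\<integral>\<^sup>+p. ennreal ((max 0 (g p)) ^ (CARD('n) + 1)) * indicator (cball x1 r \<times> {0..T}) p \<partial>lborel)"
proof -
  define d where "d = CARD('n)"
  have d: "d \<ge> 1" unfolding d_def by (simp add: Suc_leI)
  define \<delta> where "\<delta> = s / (2 * T)"
  define K1 where "K1 = 3 * d * M / r + 2 * d * M / r\<^sup>2 + 1"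
  have K1: "K1 \<ge> 1" using M r by (simp add: K1_def)
  define \<kappa> where "\<kappa> = abp_slope d T r M"
  have \<kappa>: "\<kappa> > 0" "\<kappa> \<le> 1/8" "\<kappa> \<le> 1 / (2 * T * K1)"
  proof -
    have "\<kappa> = min (1/8) (1 / (2 * T * K1))" by (simp add: \<kappa>_def abp_slope_def K1_def)
    then show "\<kappa> > 0" "\<kappa> \<le> 1/8" "\<kappa> \<le> 1 / (2 * T * K1)" using T K1 by auto
  qed
  define \<theta> where "\<theta> = s * \<kappa>"
  have th: "\<theta> > 0" "\<theta> \<le> s / 8" using \<kappa> s by (auto simp: \<theta>_def)
  have thK: "\<theta> * K1 \<le> \<delta>"
  proof -
    have "\<kappa> * K1 \<le> 1 / (2 * T * K1) * K1" using \<kappa>(3) K1 by (intro mult_right_mono) auto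
    also have "\<dots> = 1 / (2 * T)" using K1 by simp
    finally have "s * (\<kappa> * K1) \<le> s * (1 / (2 * T))" using s by (intro mult_left_mono) auto
    then show ?thesis by (simp add: \<theta>_def \<delta>_def mult.assoc)
  qed
  define m where "m = u (x1, t1) - \<delta> * (T - t1)"
  have m: "s / 2 \<le> m" using maxval by (simp add: m_def \<delta>_def)
  \<comment> \<open>With this factor the paraboloid lowers \<open>w\<close> by exactly \<theta> on
    the lateral boundary and by nothing at the centre.\<close>
  define k where "k = - \<theta> / r\<^sup>2"
  define w where "w p = u p + (\<theta> - \<delta> * (T - snd p)) + k * ((fst p - x1) \<bullet> (fst p - x1))" for p
  define Gw where "Gw p = G p + 0 + k *\<^sub>R 2 *\<^sub>R (fst p - x1)" for p
  define Hw where "Hw p = H p + 0 + k *\<^sub>R (2 *\<^sub>R mat 1)" for p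
  define wt where "wt p = ut p + \<delta> + k * 0" for p
  have regw: "parabolic_reg w Gw Hw wt (\<lambda>p. Gt p + 0 + k *\<^sub>R 0)"
    unfolding w_def Gw_def Hw_def wt_def
    by (intro parabolic_reg_add parabolic_reg_scale parabolic_reg_square_dist reg
        parabolic_reg_time[where f = "\<lambda>t. \<theta> - \<delta> * (T - t)" and f' = "\<lambda>_. \<delta>"]) (auto intro!: derivative_eq_intros)
  let ?Q = "cball x1 r \<times> {0..T}"
  have top: "m + \<theta> \<le> w (x1, t1)" by (simp add: w_def m_def)
  \<comment> \<open>On the lateral boundary the paraboloid cancels the lift by \<theta>. At the
    final time \<open>w\<close> is at most \<theta>, which is at most \<open>s / 8\<close> and hence
    below \<open>m\<close>.\<close>
  have bd: "w (x, t) \<le> m" if x: "x \<in> cball x1 r" and t: "t \<in> {0..T}" and or: "dist x1 x = r \<or> t = T" for x t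
    using or
  proof
    assume "dist x1 x = r"
    then have "(x - x1) \<bullet> (x - x1) = r\<^sup>2" by (simp add: dist_norm norm_minus_commute power2_norm_eq_inner[symmetric])
    then show ?thesis using max[OF t, of x] r by (simp add: w_def k_def m_def \<delta>_def)
  next
    assume "t = T"
    moreover have "k * ((x - x1) \<bullet> (x - x1)) \<le> 0" using th r by (simp add: k_def mult_nonpos_nonneg)
    ultimately show ?thesis using final[of x] m th s by (simp add: w_def)
  qed
  define \<Gamma> where "\<Gamma> = contact_set w Gw Hw wt ?Q (m + \<theta> / 4) (\<theta> / (4 * r))"
  \<comment> \<open>The minimum with 1 lets a single factor serve both the time derivative and the
    trace of the Hessian.\<close>
  define m1 where "m1 = min 1 m0"
  have m1: "0 < m1" "m1 \<le> 1" "m1 \<le> m0" using m0 by (auto simp: m1_def)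
  define I where "I = (\<integral>\<^sup>+p. ennreal ((max 0 (g p)) ^ (d + 1)) * indicator ?Q p \<partial>lborel)"
  have pt: "m1 * (- wt p - (\<Sum>i\<in>UNIV. Hw p $ i $ i)) \<le> max 0 (g p)" "0 \<le> - wt p - (\<Sum>i\<in>UNIV. Hw p $ i $ i)"
    if p: "p \<in> \<Gamma>" for p
  proof -
    obtain x t where pe: "p = (x, t)" by force
    have x: "x \<in> cball x1 r" and t: "t \<in> {0..T}" and wm: "m + \<theta> / 4 \<le> w p" and Gs: "norm (Gw p) \<le> \<theta> / (4 * r)"
      and wt0: "wt p \<le> 0" and psd: "\<And>y. 0 \<le> quad_form (\<lambda>i j. - Hw p $ i $ j) y"
      using p by (auto simp: \<Gamma>_def contact_set_def pe)
    have Hsym: "- Hw p $ i $ j = - Hw p $ j $ i" for i j using parabolic_regD(3)[OF regw] by simp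
    have diag: "0 \<le> - Hw p $ i $ i" for i
      using psd[of "\<lambda>j. if j = i then 1 else 0"] unfolding quad_form_delta .
    have tr0: "0 \<le> (\<Sum>i\<in>UNIV. - Hw p $ i $ i)" by (rule sum_nonneg) (rule diag)
    then show "0 \<le> - wt p - (\<Sum>i\<in>UNIV. Hw p $ i $ i)" using wt0 by (simp add: sum_negf)
    have kx: "k * ((x - x1) \<bullet> (x - x1)) \<le> 0" using th r by (simp add: k_def mult_nonpos_nonneg)
    have nx: "norm (x - x1) \<le> r" using x by (simp add: dist_norm norm_minus_commute)
    \<comment> \<open>Here the lower bound on \<open>w\<close> in the contact set is used:
      \<open>w\<close> exceeds \<open>m\<close>, hence \<theta>, and the other two terms lower
      \<open>w\<close> below \<open>u + \<theta>\<close>.\<close>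
    have upos: "0 \<le> u p"
    proof -
      have "0 \<le> \<delta> * (T - t)" using t s T by (simp add: \<delta>_def)
      moreover have "w p = u p + (\<theta> - \<delta> * (T - t)) + k * ((x - x1) \<bullet> (x - x1))" by (simp add: w_def pe)
      ultimately show ?thesis using wm kx m th s by linarith
    qed
    have "m0 * (\<Sum>i\<in>UNIV. - Hw p $ i $ i) \<le> (\<Sum>i\<in>UNIV. \<Sum>j\<in>UNIV. a x t i j * - Hw p $ i $ j)"
      by (rule ellipticity_trace_le[OF ell[OF x t] Hsym psd])
    moreover have "m1 * (\<Sum>i\<in>UNIV. - Hw p $ i $ i) \<le> m0 * (\<Sum>i\<in>UNIV. - Hw p $ i $ i)"
      using tr0 m1 by (intro mult_right_mono) auto
    moreover have "m1 * (- wt p) \<le> - wt p" using wt0 m1 mult_right_mono[of m1 1 "- wt p"] by simp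
    ultimately have A: "m1 * (- wt p - (\<Sum>i\<in>UNIV. Hw p $ i $ i)) \<le> - wt p - (\<Sum>i\<in>UNIV. \<Sum>j\<in>UNIV. a x t i j * Hw p $ i $ j)"
      by (simp add: sum_negf right_diff_distrib)
    have B: "(\<Sum>i\<in>UNIV. \<Sum>j\<in>UNIV. a x t i j * Hw p $ i $ j)
       = (\<Sum>i\<in>UNIV. \<Sum>j\<in>UNIV. a x t i j * H p $ i $ j) + 2 * k * (\<Sum>i\<in>UNIV. a x t i i)"
    proof -
      have "a x t i j * Hw p $ i $ j = a x t i j * H p $ i $ j + (if i = j then 2 * k * a x t i j else 0)" for i j
        by (simp add: Hw_def mat_def algebra_simps)
      then show ?thesis by (simp add: sum.distrib sum_distrib_left)
    qed
    have C: "(\<Sum>i\<in>UNIV. a x t i i) \<le> d * M"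
    proof -
      have "(\<Sum>i\<in>UNIV. a x t i i) \<le> (\<Sum>i\<in>(UNIV::'n set). M)" using aM[OF x t] by (intro sum_mono) (auto simp: abs_le_iff)
      then show ?thesis by (simp add: d_def)
    qed
    have D1: "(\<Sum>i\<in>UNIV. b x t i * G p $ i) = (\<Sum>i\<in>UNIV. b x t i * Gw p $ i) + (- 2 * k) * (\<Sum>i\<in>UNIV. b x t i * (x - x1) $ i)"
      by (simp add: Gw_def pe algebra_simps sum.distrib sum_subtractf sum_distrib_left sum_negf)
    have D2: "(\<Sum>i\<in>UNIV. b x t i * Gw p $ i) \<le> d * M * (\<theta> / (4 * r))"
      using order_trans[OF sum_coeff_le[of "b x t", OF bM[OF x t]] mult_left_mono[OF Gs]] M by (simp add: d_def)
    have D3: "(\<Sum>i\<in>UNIV. b x t i * (x - x1) $ i) \<le> d * M * r"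
      using order_trans[OF sum_coeff_le[of "b x t", OF bM[OF x t]] mult_left_mono[OF nx]] M by (simp add: d_def)
    have k0: "0 \<le> - 2 * k" using th r by (simp add: k_def)
    \<comment> \<open>Three errors: drift against the contact slope, drift against the gradient of
      the paraboloid, and the Hessian of the paraboloid. Rounding the first up from
      \<open>d * M / (4 * r)\<close> to \<open>d * M / r\<close> and adding the second gives the
      factor 3 in \<open>K1\<close>.\<close>
    have E: "(\<Sum>i\<in>UNIV. b x t i * G p $ i) + (- 2 * k) * (\<Sum>i\<in>UNIV. a x t i i) \<le> \<theta> * K1"
    proof -
      have "(\<Sum>i\<in>UNIV. b x t i * G p $ i) + (- 2 * k) * (\<Sum>i\<in>UNIV. a x t i i)
         \<le> d * M * (\<theta> / (4 * r)) + (- 2 * k) * (d * M * r) + (- 2 * k) * (d * M)"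
        unfolding D1 using mult_left_mono[OF D3 k0] mult_left_mono[OF C k0] D2 by linarith
      also have "\<dots> = \<theta> * (d * M / (4 * r) + 2 * d * M / r + 2 * d * M / r\<^sup>2)"
        using r by (simp add: k_def field_simps power2_eq_square)
      also have "\<dots> \<le> \<theta> * K1"
      proof (rule mult_left_mono)
        have "d * M / (4 * r) \<le> d * M / r" using M r by (intro divide_left_mono) auto
        moreover have "3 * d * M / r = d * M / r + 2 * d * M / r" by (simp add: add_divide_distrib[symmetric])
        ultimately show "d * M / (4 * r) + 2 * d * M / r + 2 * d * M / r\<^sup>2 \<le> K1"
          unfolding K1_def by linarith
      qed (use th in auto)
      finally show ?thesis .
    qed
    have cu: "c x t * u p \<le> 0" using c0[OF x t] upos by (simp add: mult_nonpos_nonneg)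
    have "- wt p - (\<Sum>i\<in>UNIV. \<Sum>j\<in>UNIV. a x t i j * Hw p $ i $ j)
      = - backward_op a b c u G H ut p + (\<Sum>i\<in>UNIV. b x t i * G p $ i) + c x t * u p - \<delta> + (- 2 * k) * (\<Sum>i\<in>UNIV. a x t i i)"
      unfolding B backward_op_def by (simp add: wt_def pe)
    also have "\<dots> \<le> g p" using E thK cu g[OF x t] unfolding pe by linarith
    finally show "m1 * (- wt p - (\<Sum>i\<in>UNIV. Hw p $ i $ i)) \<le> max 0 (g p)" using A by linarith
  qed
  have "ennreal ((\<theta> / (2 * r * d)) ^ d * (\<theta> / 2))
    \<le> (\<integral>\<^sup>+p. ennreal (fact (d + 1) * (- wt p - (\<Sum>i\<in>UNIV. Hw p $ i $ i)) ^ (d + 1)) * indicator \<Gamma> p \<partial>lborel)"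
    unfolding \<Gamma>_def d_def by (rule parabolic_abp[OF regw r th(1) t1 top bd])
  also have "\<dots> \<le> (\<integral>\<^sup>+p. ennreal (fact (d + 1) / m1 ^ (d + 1)) * (ennreal ((max 0 (g p)) ^ (d + 1)) * indicator ?Q p) \<partial>lborel)"
  proof (intro nn_integral_mono, goal_cases)
    case (1 p)
    show ?case
    proof (cases "p \<in> \<Gamma>")
      case True
      then have pQ: "p \<in> ?Q" by (auto simp: \<Gamma>_def contact_set_def)
      have "(- wt p - (\<Sum>i\<in>UNIV. Hw p $ i $ i)) ^ (d + 1) \<le> (max 0 (g p) / m1) ^ (d + 1)"
        using pt[OF True] m1 by (intro power_mono) (auto simp: pos_le_divide_eq mult.commute)
      then have "fact (d + 1) * (- wt p - (\<Sum>i\<in>UNIV. Hw p $ i $ i)) ^ (d + 1) \<le> fact (d + 1) * (max 0 (g p) / m1) ^ (d + 1)"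
        by (intro mult_left_mono) auto
      also have "\<dots> = fact (d + 1) / m1 ^ (d + 1) * (max 0 (g p)) ^ (d + 1)" by (simp add: power_divide del: power_Suc)
      finally show ?thesis using True pQ m1 by (simp add: ennreal_mult[symmetric] ennreal_leI del: power_Suc)
    qed simp
  qed
  also have "\<dots> = ennreal (fact (d + 1) / m1 ^ (d + 1)) * I"
  proof -
    have "(\<lambda>p. ennreal ((max 0 (g p)) ^ (d + 1)) * indicator B p) \<in> borel_measurable lborel"
      if [measurable]: "B \<in> sets borel" for B using gm by measurable
    moreover have "?Q \<in> sets borel" by (intro borel_closed closed_Times) auto
    ultimately show ?thesis unfolding I_def by (intro nn_integral_cmult) blast
  qed
  finally have F: "ennreal ((\<theta> / (2 * r * d)) ^ d * (\<theta> / 2)) \<le> ennreal (fact (d + 1) / m1 ^ (d + 1)) * I" .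
  define L where "L = (2 * r * d) ^ d * 2 / \<kappa> ^ (d + 1)"
  have L: "L \<ge> 0" using r \<kappa> by (simp add: L_def)
  have sL: "s ^ (d + 1) = L * ((\<theta> / (2 * r * d)) ^ d * (\<theta> / 2))"
    using r d \<kappa> by (simp add: L_def \<theta>_def power_mult_distrib power_divide)
  have "ennreal (s ^ (d + 1)) = ennreal L * ennreal ((\<theta> / (2 * r * d)) ^ d * (\<theta> / 2))"
    unfolding sL by (rule ennreal_mult) (use L th r in auto)
  also have "\<dots> \<le> ennreal L * (ennreal (fact (d + 1) / m1 ^ (d + 1)) * I)" using F by (intro mult_left_mono) auto
  also have "\<dots> = ennreal (L * (fact (d + 1) / m1 ^ (d + 1))) * I"
  proof -
    have "ennreal (L * (fact (d + 1) / m1 ^ (d + 1))) = ennreal L * ennreal (fact (d + 1) / m1 ^ (d + 1))"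
      by (rule ennreal_mult) (use L m1 in auto)
    then show ?thesis by (simp only: mult.assoc)
  qed
  also have "L * (fact (d + 1) / m1 ^ (d + 1)) = abp_const d T r m0 M"
    by (simp add: L_def abp_const_def \<kappa>_def m1_def power_mult_distrib del: power_Suc)
  finally show ?thesis unfolding I_def d_def .
qed

text \<open>The penalty is \<open>s / 2\<close> at time 0 and 0 at time \<open>T\<close>. So half of
  the height survives at \<open>(x0, 0)\<close>, while off \<open>K\<close> the penalized function
  is at most 0; a maximum over the compact cylinder is therefore global. The slope of the penalty is
  the reserve that absorbs the error terms of the local estimate.\<close>

lemma parabolic_max_point:
  fixes u :: "(real^'n) \<times> real \<Rightarrow> real"
  assumes cont: "continuous_on UNIV u" and K: "compact K" and T: "T > 0" and s: "s > 0"
    and out: "\<And>x t. x \<notin> K \<Longrightarrow> t \<in> {0..T} \<Longrightarrow> u (x, t) \<le> 0" and x0: "s \<le> u (x0, 0)"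
  obtains x1 t1 where "x1 \<in> K" "t1 \<in> {0..T}"
    "\<And>x t. t \<in> {0..T} \<Longrightarrow> u (x, t) - s / (2 * T) * (T - t) \<le> u (x1, t1) - s / (2 * T) * (T - t1)"
    "s / 2 \<le> u (x1, t1) - s / (2 * T) * (T - t1)"
proof -
  define \<psi> where "\<psi> p = u p - s / (2 * T) * (T - snd p)" for p
  have x0K: "x0 \<in> K" using out[of x0 0] x0 s T by auto
  have "continuous_on (K \<times> {0..T}) \<psi>"
    unfolding \<psi>_def by (intro continuous_intros continuous_on_subset[OF cont]) auto
  moreover have "compact (K \<times> {0..T})" using K by (intro compact_Times) auto
  moreover have "K \<times> {0..T} \<noteq> {}" using x0K T by auto
  ultimately obtain q where q: "q \<in> K \<times> {0..T}" "\<And>p. p \<in> K \<times> {0..T} \<Longrightarrow> \<psi> p \<le> \<psi> q"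
    using continuous_attains_sup by metis
  have "s / 2 \<le> \<psi> (x0, 0)" using x0 T by (simp add: \<psi>_def)
  also have "\<dots> \<le> \<psi> q" using q(2) x0K T by auto
  finally have val: "s / 2 \<le> \<psi> q" .
  have "\<psi> (x, t) \<le> \<psi> q" if t: "t \<in> {0..T}" for x t
  proof (cases "x \<in> K")
    case True then show ?thesis using q(2) t by auto
  next
    case False
    have "0 \<le> s / (2 * T) * (T - t)" using t s T by simp
    then have "\<psi> (x, t) \<le> 0" using out[OF False t] by (simp add: \<psi>_def)
    then show ?thesis using val s by simp
  qed
  then show ?thesis using that[of "fst q" "snd q"] q(1) val by (auto simp: \<psi>_def)
qed

section \<open>Test functions\<close>

lemma has_real_derivative_pd:
  assumes "(\<lambda>s. f (x + s *\<^sub>R axis i 1)) differentiable (at 0)"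
  shows "((\<lambda>s. f (x + s *\<^sub>R axis i 1)) has_real_derivative pd i f x) (at 0)"
  using assms unfolding pd_def by (simp add: DERIV_deriv_iff_real_differentiable)

lemma smooth_fun_pd:
  assumes "smooth_fun \<phi>"
  shows "continuous_on UNIV \<phi>" "continuous_on UNIV (pd i \<phi>)" "continuous_on UNIV (pd j (pd i \<phi>))"
    and "((\<lambda>s. \<phi> (x + s *\<^sub>R axis i 1)) has_real_derivative pd i \<phi> x) (at 0)"
    and "((\<lambda>s. pd i \<phi> (x + s *\<^sub>R axis j 1)) has_real_derivative pd j (pd i \<phi>) x) (at 0)"
proof -
  have A: "continuous_on UNIV (iter_pd is \<phi>)" "(\<lambda>s. iter_pd is \<phi> (x + s *\<^sub>R axis i 1)) differentiable (at 0)" for "is" i x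
    using assms unfolding smooth_fun_def by auto
  show "continuous_on UNIV \<phi>" "continuous_on UNIV (pd i \<phi>)" "continuous_on UNIV (pd j (pd i \<phi>))"
    using A(1)[of "[]"] A(1)[of "[i]"] A(1)[of "[j, i]"] by simp_all
  show "((\<lambda>s. \<phi> (x + s *\<^sub>R axis i 1)) has_real_derivative pd i \<phi> x) (at 0)"
    using A(2)[of "[]"] by (intro has_real_derivative_pd) simp
  show "((\<lambda>s. pd i \<phi> (x + s *\<^sub>R axis j 1)) has_real_derivative pd j (pd i \<phi>) x) (at 0)"
    using A(2)[of "[i]"] by (intro has_real_derivative_pd) simp
qed

lemma parabolic_reg_product:
  fixes \<phi> :: "real^'n \<Rightarrow> real"
  assumes sm: "smooth_fun \<phi>" and Z: "\<And>t. (\<zeta> has_real_derivative \<zeta>' t) (at t)" and Zc: "continuous_on UNIV \<zeta>'"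
  shows "parabolic_reg (\<lambda>p. \<zeta> (snd p) * \<phi> (fst p)) (\<lambda>p. \<zeta> (snd p) *\<^sub>R (\<chi> i. pd i \<phi> (fst p)))
     (\<lambda>p. \<zeta> (snd p) *\<^sub>R (\<chi> i j. pd j (pd i \<phi>) (fst p))) (\<lambda>p. \<zeta>' (snd p) * \<phi> (fst p))
     (\<lambda>p. \<zeta>' (snd p) *\<^sub>R (\<chi> i. pd i \<phi> (fst p)))"
proof -
  note sp = smooth_fun_pd[OF sm]
  have D0: "(\<phi> has_derivative (\<lambda>h. (\<chi> i. pd i \<phi> x) \<bullet> h)) (at x)" for x
    using has_derivative_continuous_partials[of \<phi> "\<lambda>i. pd i \<phi>", OF sp(4) sp(2)] by (simp add: inner_vec_def)
  have D1i: "(pd i \<phi> has_derivative (\<lambda>h. ((\<chi> i j. pd j (pd i \<phi>) x) *v h) $ i)) (at x)" for i x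
    using has_derivative_continuous_partials[of "pd i \<phi>" "\<lambda>j. pd j (pd i \<phi>)", OF sp(5) sp(3)]
    by (simp add: matrix_vector_mult_def)
  have D1: "((\<lambda>x. \<chi> i. pd i \<phi> x) has_derivative (\<lambda>h. (\<chi> i j. pd j (pd i \<phi>) x) *v h)) (at x)" for x
    by (subst has_derivative_componentwise_within) (use D1i in \<open>auto simp: Basis_vec_def inner_axis\<close>)
  have DZ: "((\<lambda>p :: (real^'n) \<times> real. \<zeta> (snd p)) has_derivative (\<lambda>q. \<zeta>' (snd p) * snd q)) (at p)" for p
    using Z[of "snd p"] unfolding has_field_derivative_def
    by (rule has_derivative_compose[OF has_derivative_snd[OF has_derivative_ident]])
  note Df = has_derivative_compose[OF has_derivative_fst[OF has_derivative_ident]]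
  have Zcont: "continuous_on UNIV \<zeta>" using Z by (meson DERIV_isCont continuous_at_imp_continuous_on)
  note [continuous_intros] = continuous_on_compose2[OF Zcont] continuous_on_compose2[OF Zc]
    continuous_on_compose2[OF sp(1)] continuous_on_compose2[OF sp(2)] continuous_on_compose2[OF sp(3)]
  show ?thesis
    unfolding parabolic_reg_def
  proof (intro conjI allI)
    fix p :: "(real^'n) \<times> real"
    show "((\<lambda>p. \<zeta> (snd p) * \<phi> (fst p)) has_derivative
      (\<lambda>q. (\<zeta> (snd p) *\<^sub>R (\<chi> i. pd i \<phi> (fst p))) \<bullet> fst q + \<zeta>' (snd p) * \<phi> (fst p) * snd q)) (at p)"
      by (rule has_derivative_eq_rhs[OF has_derivative_mult[OF DZ Df[OF D0]]]) (simp add: fun_eq_iff algebra_simps)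
    show "((\<lambda>p. \<zeta> (snd p) *\<^sub>R (\<chi> i. pd i \<phi> (fst p))) has_derivative
      (\<lambda>q. (\<zeta> (snd p) *\<^sub>R (\<chi> i j. pd j (pd i \<phi>) (fst p))) *v fst q + snd q *\<^sub>R \<zeta>' (snd p) *\<^sub>R (\<chi> i. pd i \<phi> (fst p)))) (at p)"
      by (rule has_derivative_eq_rhs[OF has_derivative_scaleR[OF DZ Df[OF D1]]])
        (simp add: fun_eq_iff algebra_simps scaleR_matrix_vector_assoc[symmetric])
    fix i j
    show "(\<zeta> (snd p) *\<^sub>R (\<chi> i j. pd j (pd i \<phi>) (fst p))) $ i $ j = (\<zeta> (snd p) *\<^sub>R (\<chi> i j. pd j (pd i \<phi>) (fst p))) $ j $ i"
      using mixed_partials_commute[of \<phi> "\<lambda>i. pd i \<phi>" "\<lambda>i j. pd j (pd i \<phi>)", OF sp(4) sp(5) sp(3)] by simp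
  qed (auto intro!: continuous_intros)
qed

lemma backward_op_product:
  fixes \<phi> :: "real^'n \<Rightarrow> real"
  assumes sm: "smooth_fun \<phi>"
  shows "backward_op a b c (\<lambda>p. \<zeta> (snd p) * \<phi> (fst p)) (\<lambda>p. \<zeta> (snd p) *\<^sub>R (\<chi> i. pd i \<phi> (fst p)))
     (\<lambda>p. \<zeta> (snd p) *\<^sub>R (\<chi> i j. pd j (pd i \<phi>) (fst p))) (\<lambda>p. \<zeta>' (snd p) * \<phi> (fst p)) (x, t)
    = \<zeta>' t * \<phi> x + \<zeta> t * Lop a b c \<phi> x t"
proof -
  note sp = smooth_fun_pd[OF sm]
  \<comment> \<open>\<open>Lop\<close> takes the second derivatives in the opposite order.\<close>
  have "pd j (pd i \<phi>) x = pd i (pd j \<phi>) x" for i j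
    using mixed_partials_commute[of \<phi> "\<lambda>i. pd i \<phi>" "\<lambda>i j. pd j (pd i \<phi>)", OF sp(4) sp(5) sp(3)] .
  then show ?thesis
    unfolding backward_op_def Lop_def by (simp add: sum_distrib_left algebra_simps)
qed

lemma pd_zero_outside:
  assumes "x \<notin> closure {x. f x \<noteq> 0}"
  shows "pd i f x = 0"
proof -
  have "open ((\<lambda>s::real. x + s *\<^sub>R axis i 1) -` (- closure {x. f x \<noteq> 0}))"
    by (intro open_vimage continuous_intros) auto
  then have "\<forall>\<^sub>F s in nhds 0. s \<in> (\<lambda>s::real. x + s *\<^sub>R axis i 1) -` (- closure {x. f x \<noteq> 0})"
    by (rule eventually_nhds_in_open) (use assms in auto)
  then have "\<forall>\<^sub>F s in nhds (0::real). f (x + s *\<^sub>R axis i 1) = 0"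
    by (rule eventually_mono) (use closure_subset[of "{x. f x \<noteq> 0}"] in blast)
  then have "deriv (\<lambda>s. f (x + s *\<^sub>R axis i 1)) 0 = deriv (\<lambda>s. 0) 0" by (intro deriv_cong_ev) auto
  then show ?thesis by (simp add: pd_def)
qed

lemma Lop_zero_outside:
  assumes "x \<notin> closure {x. \<phi> x \<noteq> 0}"
  shows "Lop a b c \<phi> x t = 0"
proof -
  have "pd i (pd j \<phi>) x = 0" for i j
  proof (rule pd_zero_outside)
    have "{x. pd j \<phi> x \<noteq> 0} \<subseteq> closure {x. \<phi> x \<noteq> 0}" using pd_zero_outside by blast
    then have "closure {x. pd j \<phi> x \<noteq> 0} \<subseteq> closure {x. \<phi> x \<noteq> 0}" by (simp add: closure_minimal)
    then show "x \<notin> closure {x. pd j \<phi> x \<noteq> 0}" using assms by blast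
  qed
  moreover have "\<phi> x = 0" using assms closure_subset[of "{x. \<phi> x \<noteq> 0}"] by blast
  ultimately show ?thesis using pd_zero_outside[OF assms] by (simp add: Lop_def)
qed

text \<open>Let the positive and negative parts of \<open>f\<close> be densities of \<open>P\<close>
  and \<open>N\<close>. Continuous functions increasing to the indicator of an open set give
  \<open>P\<close> at most \<open>N\<close> on open sets, and outer regularity of \<open>N\<close>
  extends this to the set where \<open>f\<close> is positive. There \<open>N\<close> vanishes, hence
  so does \<open>P\<close>.\<close>

lemma AE_nonpos_of_continuous_tests:
  fixes f :: "real \<Rightarrow> real"
  assumes f: "integrable lborel f"
    and test: "\<And>\<psi>. continuous_on UNIV \<psi> \<Longrightarrow> (\<And>t. 0 \<le> \<psi> t) \<Longrightarrow> (\<And>t. \<psi> t \<le> 1) \<Longrightarrow> (\<integral>t. \<psi> t * f t \<partial>lborel) \<le> 0"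
  shows "AE t in lborel. f t \<le> 0"
proof -
  have [measurable]: "f \<in> borel_measurable borel" using f by auto
  define P N where "P = density lborel (\<lambda>t. ennreal (max 0 (f t)))" and "N = density lborel (\<lambda>t. ennreal (max 0 (- f t)))"
  have ip: "integrable lborel (\<lambda>t. max 0 (f t))" and jn: "integrable lborel (\<lambda>t. max 0 (- f t))"
    using f by auto
  have em: "emeasure (density lborel (\<lambda>t. ennreal (g t))) A = ennreal (LINT t:A|lborel. g t)"
    if [measurable]: "A \<in> sets borel" and g: "integrable lborel g" "\<And>t. 0 \<le> g t" for A and g :: "real \<Rightarrow> real"
  proof -
    have "emeasure (density lborel (\<lambda>t. ennreal (g t))) A = (\<integral>\<^sup>+t. ennreal (g t) * indicator A t \<partial>lborel)"
      using g(1) by (subst emeasure_density) auto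
    also have "\<dots> = (\<integral>\<^sup>+t. ennreal (indicator A t *\<^sub>R g t) \<partial>lborel)"
      by (intro nn_integral_cong) (simp split: split_indicator)
    also have "\<dots> = ennreal (LINT t:A|lborel. g t)"
      unfolding set_lebesgue_integral_def
      by (rule nn_integral_eq_integral) (use g in \<open>auto intro!: integrable_mult_indicator simp del: real_scaleR_def split: split_indicator\<close>)
    finally show ?thesis .
  qed
  have emP: "emeasure P A = ennreal (LINT t:A|lborel. max 0 (f t))"
    and emN: "emeasure N A = ennreal (LINT t:A|lborel. max 0 (- f t))" if "A \<in> sets borel" for A
    unfolding P_def N_def by (rule em[OF that ip], simp, rule em[OF that jn], simp)
  have opn: "emeasure P U \<le> emeasure N U" if U: "open U" for U
  proof -
    have [measurable]: "U \<in> sets borel" using U by simp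
    \<comment> \<open>The separate case is due to the default value of \<open>infdist\<close>, which
      is 0 for the empty set.\<close>
    define \<psi> where "\<psi> n t = (if U = UNIV then 1 else min 1 (real n * infdist t (- U)))" for n t
    have c: "continuous_on UNIV (\<psi> n)" for n
      unfolding \<psi>_def by (cases "U = UNIV") (auto intro!: continuous_intros)
    have b: "0 \<le> \<psi> n t" "\<psi> n t \<le> 1" for n t by (auto simp: \<psi>_def infdist_nonneg)
    have lim: "(\<lambda>n. \<psi> n t) \<longlonglongrightarrow> indicator U t" for t
    proof (cases "U = UNIV \<or> t \<notin> U")
      case True
      then have "\<psi> n t = indicator U t" for n by (cases "U = UNIV") (auto simp: \<psi>_def infdist_zero)
      then show ?thesis by simp
    next
      case False
      then have "infdist t (- U) > 0"
        using U by (intro infdist_pos_not_in_closed) auto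
      then obtain k :: nat where "real k * infdist t (- U) > 1" using ex_less_of_nat_mult by blast
      moreover have "real k * infdist t (- U) \<le> real n * infdist t (- U)" if "n \<ge> k" for n
        using that by (intro mult_right_mono) (auto simp: infdist_nonneg)
      ultimately have "\<psi> n t = 1" if "n \<ge> k" for n
        using that False unfolding \<psi>_def by force
      then have "\<forall>\<^sub>F n in sequentially. \<psi> n t = 1" unfolding eventually_sequentially by blast
      then show ?thesis using False by (simp add: tendsto_eventually)
    qed
    have "(\<lambda>n. \<integral>t. \<psi> n t * f t \<partial>lborel) \<longlonglongrightarrow> (\<integral>t. indicator U t * f t \<partial>lborel)"
    proof (rule integral_dominated_convergence[where w = "\<lambda>t. \<bar>f t\<bar>"])
      show "AE t in lborel. (\<lambda>n. \<psi> n t * f t) \<longlonglongrightarrow> indicator U t * f t" by (intro AE_I2 tendsto_intros lim)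
      show "AE t in lborel. norm (\<psi> n t * f t) \<le> \<bar>f t\<bar>" for n
        using b by (auto simp: abs_mult intro!: mult_left_le_one_le)
      show "(\<lambda>t. \<psi> n t * f t) \<in> borel_measurable lborel" for n
        using borel_measurable_continuous_onI[OF c] by measurable
      show "(\<lambda>t. indicator U t * f t) \<in> borel_measurable lborel" by measurable
    qed (use f in auto)
    then have "(\<integral>t. indicator U t * f t \<partial>lborel) \<le> 0"
      by (rule tendsto_upperbound) (auto intro!: always_eventually test c b)
    moreover have "(\<integral>t. indicator U t * f t \<partial>lborel)
       = (LINT t:U|lborel. max 0 (f t)) - (LINT t:U|lborel. max 0 (- f t))"
    proof -
      have "integrable lborel (\<lambda>t. indicator U t *\<^sub>R max 0 (f t))" "integrable lborel (\<lambda>t. indicator U t *\<^sub>R max 0 (- f t))"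
        by (rule integrable_mult_indicator[OF _ ip], simp, rule integrable_mult_indicator[OF _ jn], simp)
      moreover have "(\<lambda>t. indicator U t * f t)
          = (\<lambda>t. indicator U t *\<^sub>R max 0 (f t) - indicator U t *\<^sub>R max 0 (- f t))"
        by (auto simp: fun_eq_iff max_def split: split_indicator)
      ultimately show ?thesis
        unfolding set_lebesgue_integral_def by (simp only: Bochner_Integration.integral_diff)
    qed
    ultimately show ?thesis using U emP[of U] emN[of U] by (auto intro!: ennreal_leI)
  qed
  define E where "E = {t. f t > 0}"
  have [measurable]: "E \<in> sets borel" unfolding E_def by measurable
  have "emeasure P E \<le> emeasure N E"
  proof -
    have "emeasure N E = (INF U\<in>{U. E \<subseteq> U \<and> open U}. emeasure N U)"
    proof (rule outer_regular)
      show "sets N = sets borel" by (simp add: N_def)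
      have "space N = UNIV" by (simp add: N_def)
      then show "emeasure N (space N) \<noteq> \<infinity>" using emN[of UNIV] by simp
    qed simp
    moreover have "emeasure P E \<le> (INF U\<in>{U. E \<subseteq> U \<and> open U}. emeasure N U)"
    proof (rule INF_greatest, safe)
      fix U assume "E \<subseteq> U" "open U"
      then show "emeasure P E \<le> emeasure N U"
        using emeasure_mono[of E U P] opn[of U] by (auto simp: P_def intro: order_trans)
    qed
    ultimately show ?thesis by simp
  qed
  also have "emeasure N E = 0"
  proof -
    have "(LINT t:E|lborel. max 0 (- f t)) = 0"
      unfolding set_lebesgue_integral_def by (rule integral_eq_zero_AE) (auto simp: E_def indicator_def)
    then show ?thesis using emN[of E] by simp
  qed
  finally have "(\<integral>\<^sup>+t. ennreal (max 0 (f t)) * indicator E t \<partial>lborel) = 0"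
    unfolding P_def by (subst (asm) emeasure_density) auto
  then have "AE t in lborel. ennreal (max 0 (f t)) * indicator E t = 0" by (subst (asm) nn_integral_0_iff_AE) auto
  then show ?thesis by (rule AE_mp) (auto simp: E_def indicator_def max_def ennreal_eq_0_iff split: if_splits)
qed

section \<open>The weighted estimate on the whole domain\<close>

locale elliptic_cauchy_data =
  fixes D :: "(real^'n::finite) set" and Dk :: "nat \<Rightarrow> (real^'n) set" and T :: real
    and a :: "real^'n \<Rightarrow> real \<Rightarrow> 'n \<Rightarrow> 'n \<Rightarrow> real"
    and b :: "real^'n \<Rightarrow> real \<Rightarrow> 'n \<Rightarrow> real"
    and c :: "real^'n \<Rightarrow> real \<Rightarrow> real"
    and \<nu> :: "(real^'n) measure"
  assumes T_pos: "T > 0"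
    and D_open: "open D"
    and Dk_open: "\<And>k. open (Dk k)"
    and Dk_bounded: "\<And>k. bounded (Dk k)"
    and Dk_incr: "\<And>k. closure (Dk k) \<subseteq> Dk (Suc k)"
    and Dk_union: "(\<Union>k. Dk k) = D"
    and a_borel: "\<And>i j. (\<lambda>p. a (fst p) (snd p) i j) \<in> borel_measurable (restrict_space borel (D \<times> {0..T}))"
    and b_borel: "\<And>i. (\<lambda>p. b (fst p) (snd p) i) \<in> borel_measurable (restrict_space borel (D \<times> {0..T}))"
    and c_borel: "(\<lambda>p. c (fst p) (snd p)) \<in> borel_measurable (restrict_space borel (D \<times> {0..T}))"
    and c_nonpos: "\<And>x t. x \<in> D \<Longrightarrow> t \<in> {0..T} \<Longrightarrow> c x t \<le> 0"
    and a_bdd: "\<And>k i j. \<exists>C. \<forall>x\<in>Dk k. \<forall>t\<in>{0..T}. \<bar>a x t i j\<bar> \<le> C"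
    and b_bdd: "\<And>k i. \<exists>C. \<forall>x\<in>Dk k. \<forall>t\<in>{0..T}. \<bar>b x t i\<bar> \<le> C"
    and c_bdd: "\<And>k. \<exists>C. \<forall>x\<in>Dk k. \<forall>t\<in>{0..T}. \<bar>c x t\<bar> \<le> C"
    and ellipt: "\<And>k. \<exists>m M. m > 0 \<and> M > 0 \<and> (\<forall>x\<in>Dk k. \<forall>t\<in>{0..T}. \<forall>y::real^'n.
                    m * (norm y)\<^sup>2 \<le> (\<Sum>i\<in>UNIV. \<Sum>j\<in>UNIV. a x t i j * y $ j * y $ i)
                  \<and> (\<Sum>i\<in>UNIV. \<Sum>j\<in>UNIV. a x t i j * y $ j * y $ i) \<le> M * (norm y)\<^sup>2)"
    and nu_sets: "sets \<nu> = sets (restrict_space borel D)"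
    and nu_prob: "prob_space \<nu>"
begin

lemma space_nu: "space \<nu> = D"
  using sets_eq_imp_space_eq[OF nu_sets] by (simp add: space_restrict_space)

lemma Dk_Suc: "Dk k \<subseteq> Dk (Suc k)"
  using Dk_incr closure_subset by blast

lemma Dk_mono: "i \<le> j \<Longrightarrow> Dk i \<subseteq> Dk j"
  by (rule lift_Suc_mono_le[of Dk, OF Dk_Suc])

lemma Dk_sub: "Dk k \<subseteq> D"
  using Dk_union by blast

lemma Dk_borel [measurable]: "Dk k \<in> sets borel"
  using Dk_open by simp

lemma D_borel [measurable]: "D \<in> sets borel"
  using D_open by simp

definition Q :: "((real^'n) \<times> real) set" where "Q = D \<times> {0..T}"
definition Qk :: "nat \<Rightarrow> ((real^'n) \<times> real) set" where "Qk k = Dk k \<times> {0..T}"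

lemma Q_borel [measurable]: "Q \<in> sets borel" and Qk_borel [measurable]: "Qk k \<in> sets borel"
  unfolding Q_def Qk_def by (intro borel_Times; simp)+

lemma Qk_sub: "Qk k \<subseteq> Q"
  using Dk_sub by (auto simp: Q_def Qk_def)

lemma compact_subset_Dk:
  assumes "compact K" "K \<subseteq> D" obtains k where "K \<subseteq> Dk k"
proof -
  obtain F where F: "finite F" "K \<subseteq> (\<Union>k\<in>F. Dk k)"
    using compactE_image[OF assms(1), of UNIV Dk] Dk_open assms(2) Dk_union by metis
  have "Dk k \<subseteq> Dk (Max (insert 0 F))" if "k \<in> F" for k using that F(1) by (intro Dk_mono) simp
  then show ?thesis using F(2) that by blast
qed

lemma closure_Dk_sub: "closure (Dk k) \<subseteq> D"
  using Dk_incr Dk_sub by blast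

section \<open>Levels of the exhaustion and the constants attached to them\<close>

definition level :: "real^'n \<Rightarrow> nat" where "level x = (LEAST k. x \<in> Dk k)"

lemma level_in: "x \<in> D \<Longrightarrow> x \<in> Dk (level x)"
  unfolding level_def using Dk_union by (metis LeastI UN_E)

lemma level_le: "x \<in> Dk k \<Longrightarrow> level x \<le> k"
  unfolding level_def by (rule Least_le)

lemma level_measurable [measurable]: "level \<in> borel \<rightarrow>\<^sub>M count_space UNIV"
  unfolding level_def by measurable

lemma borel_measurable_level [measurable]:
  "(\<lambda>p :: (real^'n) \<times> real. F (level (fst p)) :: real) \<in> borel_measurable borel"
proof -
  have "(fst :: (real^'n) \<times> real \<Rightarrow> _) \<in> borel_measurable borel"
    by (intro borel_measurable_continuous_onI continuous_intros)
  from measurable_compose[OF this level_measurable]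
  show ?thesis by (rule measurable_compose) simp
qed

lemma Dk_radius: "\<exists>r>0. \<forall>x\<in>Dk k. cball x r \<subseteq> Dk (Suc k)"
proof -
  have "compact (closure (Dk k))" using Dk_bounded by simp
  then obtain e where e: "e > 0" "(\<Union>x\<in>closure (Dk k). cball x e) \<subseteq> Dk (Suc k)"
    by (rule compact_subset_open_imp_cball_epsilon_subset[OF _ Dk_open Dk_incr])
  then show ?thesis using closure_subset by (intro exI[of _ e]) blast
qed

lemma coeff_bound: "\<exists>M\<ge>0. \<forall>x\<in>Dk k. \<forall>t\<in>{0..T}. (\<forall>i j. \<bar>a x t i j\<bar> \<le> M) \<and> (\<forall>i. \<bar>b x t i\<bar> \<le> M) \<and> \<bar>c x t\<bar> \<le> M"
proof -
  obtain A where A: "\<And>i j. \<forall>x\<in>Dk k. \<forall>t\<in>{0..T}. \<bar>a x t i j\<bar> \<le> A i j" using a_bdd[of k] by metis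
  obtain B where B: "\<And>i. \<forall>x\<in>Dk k. \<forall>t\<in>{0..T}. \<bar>b x t i\<bar> \<le> B i" using b_bdd[of k] by metis
  obtain C where C: "\<forall>x\<in>Dk k. \<forall>t\<in>{0..T}. \<bar>c x t\<bar> \<le> C" using c_bdd[of k] by metis
  define M where "M = (\<Sum>i\<in>UNIV. \<Sum>j\<in>UNIV. \<bar>A i j\<bar>) + (\<Sum>i\<in>UNIV. \<bar>B i\<bar>) + \<bar>C\<bar>"
  have s: "0 \<le> (\<Sum>i\<in>UNIV. \<Sum>j\<in>UNIV. \<bar>A i j\<bar>)" "0 \<le> (\<Sum>i\<in>UNIV. \<bar>B i\<bar>)" by (auto intro!: sum_nonneg)
  have "\<bar>A i j\<bar> \<le> M" for i j
  proof -
    have "\<bar>A i j\<bar> \<le> (\<Sum>j\<in>UNIV. \<bar>A i j\<bar>)" by (rule member_le_sum) auto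
    also have "\<dots> \<le> (\<Sum>i\<in>UNIV. \<Sum>j\<in>UNIV. \<bar>A i j\<bar>)" by (rule member_le_sum) (auto intro!: sum_nonneg)
    finally show ?thesis unfolding M_def using s by linarith
  qed
  then have "A i j \<le> M" for i j by (meson abs_ge_self order_trans)
  moreover have "\<bar>B i\<bar> \<le> M" for i
    using member_le_sum[of i UNIV "\<lambda>i. \<bar>B i\<bar>"] s by (simp add: M_def)
  then have "B i \<le> M" for i by (meson abs_ge_self order_trans)
  moreover have "C \<le> M" "0 \<le> M" unfolding M_def using s abs_ge_self[of C] by linarith+
  ultimately show ?thesis using A B C by (intro exI[of _ M]) (meson order_trans)
qed

lemma ellipticity: "\<exists>m>0. \<forall>x\<in>Dk k. \<forall>t\<in>{0..T}. \<forall>y. m * (\<Sum>i\<in>UNIV. y i * y i) \<le> quad_form (a x t) y"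
proof -
  obtain m where m: "m > 0" "\<And>x t y. x \<in> Dk k \<Longrightarrow> t \<in> {0..T} \<Longrightarrow>
     m * (norm (y :: real^'n))\<^sup>2 \<le> (\<Sum>i\<in>UNIV. \<Sum>j\<in>UNIV. a x t i j * y $ j * y $ i)" using ellipt[of k] by blast
  have "m * (\<Sum>i\<in>UNIV. y i * y i) \<le> quad_form (a x t) y" if "x \<in> Dk k" "t \<in> {0..T}" for x t y
    using m(2)[OF that, of "\<chi> i. y i"]
    by (simp add: quad_form_def power2_norm_eq_inner inner_vec_def mult.assoc mult.commute[of "y _" "y _"])
  then show ?thesis using m(1) by blast
qed

definition radius :: "nat \<Rightarrow> real" where
  "radius = (SOME r. \<forall>k. r k > 0 \<and> (\<forall>x\<in>Dk k. cball x (r k) \<subseteq> Dk (Suc k)))"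
definition bound :: "nat \<Rightarrow> real" where
  "bound = (SOME M. \<forall>k. M k \<ge> 0 \<and> (\<forall>x\<in>Dk k. \<forall>t\<in>{0..T}. (\<forall>i j. \<bar>a x t i j\<bar> \<le> M k) \<and> (\<forall>i. \<bar>b x t i\<bar> \<le> M k) \<and> \<bar>c x t\<bar> \<le> M k))"
definition ellip :: "nat \<Rightarrow> real" where
  "ellip = (SOME m. \<forall>k. m k > 0 \<and> (\<forall>x\<in>Dk k. \<forall>t\<in>{0..T}. \<forall>y. m k * (\<Sum>i\<in>UNIV. y i * y i) \<le> quad_form (a x t) y))"

lemma radius: "radius k > 0" "x \<in> Dk k \<Longrightarrow> cball x (radius k) \<subseteq> Dk (Suc k)"
proof -
  have "\<exists>r. \<forall>k. r k > 0 \<and> (\<forall>x\<in>Dk k. cball x (r k) \<subseteq> Dk (Suc k))" using Dk_radius by metis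
  then have "\<forall>k. radius k > 0 \<and> (\<forall>x\<in>Dk k. cball x (radius k) \<subseteq> Dk (Suc k))"
    unfolding radius_def by (rule someI_ex)
  then show "radius k > 0" "x \<in> Dk k \<Longrightarrow> cball x (radius k) \<subseteq> Dk (Suc k)" by auto
qed

lemma bound: "bound k \<ge> 0"
  and bound_coeff: "x \<in> Dk k \<Longrightarrow> t \<in> {0..T} \<Longrightarrow> \<bar>a x t i j\<bar> \<le> bound k"
    "x \<in> Dk k \<Longrightarrow> t \<in> {0..T} \<Longrightarrow> \<bar>b x t i\<bar> \<le> bound k" "x \<in> Dk k \<Longrightarrow> t \<in> {0..T} \<Longrightarrow> \<bar>c x t\<bar> \<le> bound k"
proof -
  have "\<exists>M. \<forall>k. M k \<ge> 0 \<and> (\<forall>x\<in>Dk k. \<forall>t\<in>{0..T}. (\<forall>i j. \<bar>a x t i j\<bar> \<le> M k) \<and> (\<forall>i. \<bar>b x t i\<bar> \<le> M k) \<and> \<bar>c x t\<bar> \<le> M k)"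
    using coeff_bound by metis
  then have "\<forall>k. bound k \<ge> 0 \<and> (\<forall>x\<in>Dk k. \<forall>t\<in>{0..T}. (\<forall>i j. \<bar>a x t i j\<bar> \<le> bound k) \<and> (\<forall>i. \<bar>b x t i\<bar> \<le> bound k) \<and> \<bar>c x t\<bar> \<le> bound k)"
    unfolding bound_def by (rule someI_ex)
  then show "bound k \<ge> 0" "x \<in> Dk k \<Longrightarrow> t \<in> {0..T} \<Longrightarrow> \<bar>a x t i j\<bar> \<le> bound k"
    "x \<in> Dk k \<Longrightarrow> t \<in> {0..T} \<Longrightarrow> \<bar>b x t i\<bar> \<le> bound k" "x \<in> Dk k \<Longrightarrow> t \<in> {0..T} \<Longrightarrow> \<bar>c x t\<bar> \<le> bound k" by auto
qed

lemma ellip: "ellip k > 0" "x \<in> Dk k \<Longrightarrow> t \<in> {0..T} \<Longrightarrow> ellip k * (\<Sum>i\<in>UNIV. y i * y i) \<le> quad_form (a x t) y"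
proof -
  have "\<exists>m. \<forall>k. m k > 0 \<and> (\<forall>x\<in>Dk k. \<forall>t\<in>{0..T}. \<forall>y. m k * (\<Sum>i\<in>UNIV. y i * y i) \<le> quad_form (a x t) y)"
    using ellipticity by metis
  then have "\<forall>k. ellip k > 0 \<and> (\<forall>x\<in>Dk k. \<forall>t\<in>{0..T}. \<forall>y. ellip k * (\<Sum>i\<in>UNIV. y i * y i) \<le> quad_form (a x t) y)"
    unfolding ellip_def by (rule someI_ex)
  then show "ellip k > 0" "x \<in> Dk k \<Longrightarrow> t \<in> {0..T} \<Longrightarrow> ellip k * (\<Sum>i\<in>UNIV. y i * y i) \<le> quad_form (a x t) y" by auto
qed

text \<open>Decreasing radii: a ball of radius \<open>radius_min k\<close> around a point of
  level \<open>k\<close> contains no point of level below \<open>k - 1\<close>. This is why a locally bounded weight suffices.\<close>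

definition radius_min :: "nat \<Rightarrow> real" where "radius_min k = Min (radius ` {..k})"

lemma radius_min: "radius_min k > 0" "i \<le> k \<Longrightarrow> radius_min k \<le> radius i"
  using radius(1) by (auto simp: radius_min_def)

text \<open>The ball around a maximum point of level \<open>k\<close> lies in
  \<open>Dk (Suc k)\<close>, so ellipticity and coefficient bounds are those of the next
  set.\<close>

definition layer_const :: "nat \<Rightarrow> real" where
  "layer_const k = abp_const CARD('n) T (radius_min k) (ellip (Suc k)) (bound (Suc k))"

text \<open>A ball around a point of level \<open>i\<close> can contain points of level
  \<open>i - 1\<close>, so the weight at level \<open>k\<close> has to dominate the constants up to
  index \<open>k + 1\<close>. A sum of nonnegative constants does so.\<close>

definition weight :: "nat \<Rightarrow> real" where "weight k = (\<Sum>i\<le>Suc k. layer_const i)"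

lemma layer_const_nonneg: "0 \<le> layer_const k"
proof -
  have "0 \<le> abp_slope CARD('n) T (radius_min k) (bound (Suc k))"
    unfolding abp_slope_def using T_pos radius_min(1)[of k] bound[of "Suc k"] by simp
  then show ?thesis
    unfolding layer_const_def abp_const_def using radius_min(1)[of k] ellip(1)[of "Suc k"] by simp
qed

lemma layer_const_le_weight: "i \<le> Suc k \<Longrightarrow> layer_const i \<le> weight k"
  unfolding weight_def using layer_const_nonneg by (intro member_le_sum) auto

lemma weight_nonneg: "0 \<le> weight k"
  unfolding weight_def using layer_const_nonneg by (intro sum_nonneg)

text \<open>Where the maximum is attained is not known in advance, and the local constant depends on
  it. But the weight at each point of the ball around the maximum dominates the constant belonging
  to its centre, so the constant can be moved under the integral.\<close>

lemma weighted_estimate: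
  assumes reg: "parabolic_reg u G H ut Gt" and K: "compact K" "K \<subseteq> D"
    and out: "\<And>x t. x \<notin> K \<Longrightarrow> t \<in> {0..T} \<Longrightarrow> u (x, t) \<le> 0" and final: "\<And>x. u (x, T) \<le> 0"
    and s: "s > 0" "s \<le> u (x0, 0)" and g[measurable]: "g \<in> borel_measurable borel"
    and gle: "\<And>x t. x \<in> D \<Longrightarrow> t \<in> {0..T} \<Longrightarrow> - backward_op a b c u G H ut (x, t) \<le> g (x, t)"
  shows "ennreal (s ^ (CARD('n) + 1))
    \<le> (\<integral>\<^sup>+p. ennreal (weight (level (fst p)) * (max 0 (g p)) ^ (CARD('n) + 1)) * indicator Q p \<partial>lborel)"
proof -
  obtain x1 t1 where x1: "x1 \<in> K" and t1: "t1 \<in> {0..T}"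
    and max: "\<And>x t. t \<in> {0..T} \<Longrightarrow> u (x, t) - s / (2 * T) * (T - t) \<le> u (x1, t1) - s / (2 * T) * (T - t1)"
    and val: "s / 2 \<le> u (x1, t1) - s / (2 * T) * (T - t1)"
    using parabolic_max_point[OF parabolic_reg_continuous(1)[OF reg] K(1) T_pos s(1) out s(2)] by metis
  define k where "k = level x1"
  have x1D: "x1 \<in> D" using x1 K by auto
  have x1k: "x1 \<in> Dk k" using level_in[OF x1D] by (simp add: k_def)
  let ?r = "radius_min k"
  have ball: "cball x1 ?r \<subseteq> Dk (Suc k)"
    using radius(2)[OF x1k] radius_min(2)[of k k] by (meson order_refl order_trans subset_cball)
  \<comment> \<open>Distance is symmetric: if \<open>x\<close> had level below \<open>k - 1\<close>,
    then \<open>x1\<close> would lie in the ball of radius \<open>radius (level x)\<close> around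
    \<open>x\<close>, hence in \<open>Dk (Suc (level x))\<close>, against the minimality of
    \<open>k\<close>.\<close>
  have lev: "k \<le> Suc (level x)" if x: "x \<in> cball x1 ?r" for x
  proof (rule ccontr)
    assume "\<not> k \<le> Suc (level x)"
    then have lt: "Suc (level x) < k" by simp
    have xD: "x \<in> D" using x ball Dk_sub by blast
    have "x1 \<in> cball x (radius (level x))"
      using x radius_min(2)[of "level x" k] lt by (simp add: dist_commute)
    then have "x1 \<in> Dk (Suc (level x))" using radius(2)[OF level_in[OF xD]] by blast
    then show False using level_le[of x1 "Suc (level x)"] lt by (simp add: k_def)
  qed
  have inD: "x \<in> D" "x \<in> Dk (Suc k)" if "x \<in> cball x1 ?r" for x using that ball Dk_sub by blast+
  have "ennreal (s ^ (CARD('n) + 1)) \<le> ennreal (layer_const k)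
     * (\<integral>\<^sup>+p. ennreal ((max 0 (g p)) ^ (CARD('n) + 1)) * indicator (cball x1 ?r \<times> {0..T}) p \<partial>lborel)"
    unfolding layer_const_def
    by (rule parabolic_estimate_at_max[OF reg radius_min(1) T_pos ellip(1) bound s(1) t1 max val final _ _ _ _ gle g])
      (auto intro!: ellip(2) bound_coeff c_nonpos inD)
  also have "\<dots> = (\<integral>\<^sup>+p. ennreal (layer_const k) * (ennreal ((max 0 (g p)) ^ (CARD('n) + 1)) * indicator (cball x1 ?r \<times> {0..T}) p) \<partial>lborel)"
  proof -
    have "(\<lambda>p. ennreal ((max 0 (g p)) ^ (CARD('n) + 1)) * indicator B p) \<in> borel_measurable lborel"
      if [measurable]: "B \<in> sets borel" for B by measurable
    moreover have "cball x1 ?r \<times> {0..T} \<in> sets borel" by (intro borel_closed closed_Times) auto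
    ultimately show ?thesis by (intro nn_integral_cmult[symmetric]) blast
  qed
  also have "\<dots> \<le> (\<integral>\<^sup>+p. ennreal (weight (level (fst p)) * (max 0 (g p)) ^ (CARD('n) + 1)) * indicator Q p \<partial>lborel)"
  proof (intro nn_integral_mono, goal_cases)
    case (1 p)
    show ?case
    proof (cases "p \<in> cball x1 ?r \<times> {0..T}")
      case True
      then have "p \<in> Q" using inD by (auto simp: Q_def)
      moreover have "layer_const k \<le> weight (level (fst p))"
        using True by (intro layer_const_le_weight lev) auto
      then have "ennreal (layer_const k * (max 0 (g p)) ^ (CARD('n) + 1)) \<le> ennreal (weight (level (fst p)) * (max 0 (g p)) ^ (CARD('n) + 1))"
        by (intro ennreal_leI mult_right_mono) auto
      ultimately show ?thesis using True layer_const_nonneg[of k]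
        by (simp add: ennreal_mult[symmetric] del: power_Suc)
    qed simp
  qed
  finally show ?thesis .
qed

text \<open>Test functions are divided by \<open>damp\<close>, which turns the locally finite reference
  measure with density \<open>weight\<close> into the finite measure \<open>\<kappa>\<close>.\<close>

definition damp :: "nat \<Rightarrow> real" where
  "damp k = 1 / (1 + weight k * (1 + measure lborel (Dk k)) * 2 ^ k)"

text \<open>Weight, volume and \<open>2 ^ k\<close> in the denominator make the contributions of the
  levels a geometric series.\<close>

lemma damp: "0 < damp k" "damp k \<le> 1" "weight k * damp k * measure lborel (Dk k) \<le> (1/2) ^ k"
proof -
  define w m where "w = weight k" and "m = measure lborel (Dk k)"
  have wm: "0 \<le> w" "0 \<le> m" using weight_nonneg by (auto simp: w_def m_def)
  have p: "1 + w * (1 + m) * 2 ^ k \<ge> 1" using wm by simp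
  then show "0 < damp k" "damp k \<le> 1" unfolding damp_def w_def m_def by (auto simp: divide_le_eq_1)
  have "w * m * 2 ^ k \<le> w * (1 + m) * 2 ^ k" using wm by (intro mult_right_mono mult_left_mono) auto
  also have "\<dots> \<le> 1 + w * (1 + m) * 2 ^ k" by simp
  finally have "w * m / (1 + w * (1 + m) * 2 ^ k) \<le> 1 / 2 ^ k" using p by (simp add: field_simps)
  then show "weight k * damp k * measure lborel (Dk k) \<le> (1/2) ^ k"
    by (simp add: damp_def w_def[symmetric] m_def[symmetric] power_divide)
qed

text \<open>The power of \<open>damp\<close> is the exponent of the estimate: substituting
  \<open>g = - damp * f\<close> turns the weighted integral of the positive part of \<open>g\<close>
  into the integral of the negative part of \<open>f\<close> against this measure.\<close>

definition \<kappa> :: "((real^'n) \<times> real) measure" where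
  "\<kappa> = density lborel (\<lambda>p. ennreal (weight (level (fst p)) * damp (level (fst p)) ^ (CARD('n) + 1)) * indicator Q p)"

lemma sets_kappa [simp, measurable_cong]: "sets \<kappa> = sets borel" and space_kappa [simp]: "space \<kappa> = UNIV"
  by (simp_all add: \<kappa>_def)

text \<open>The sets \<open>Qk k\<close> are nested, not disjoint. Each point of \<open>Q\<close>
  lies in the one belonging to its level, so the sum over all of them majorizes the density, and it
  is a geometric series.\<close>

lemma finite_kappa: "finite_measure \<kappa>"
proof (rule finite_measureI)
  define h where "h k = weight k * damp k ^ (CARD('n) + 1)" for k
  have h: "0 \<le> h k" for k using weight_nonneg damp(1)[of k] by (simp add: h_def)
  have emD: "emeasure lborel (Dk k) = ennreal (measure lborel (Dk k))" for k
    using emeasure_bounded_finite[OF Dk_bounded[of k]] by (intro emeasure_eq_ennreal_measure) auto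
  have "emeasure \<kappa> (space \<kappa>) = (\<integral>\<^sup>+p. ennreal (h (level (fst p))) * indicator Q p \<partial>lborel)"
  proof -
    have "(\<lambda>p. ennreal (h (level (fst p))) * indicator Q p) \<in> borel_measurable borel" by measurable
    then show ?thesis unfolding \<kappa>_def h_def by (subst emeasure_density) auto
  qed
  also have "\<dots> \<le> (\<integral>\<^sup>+p. (\<Sum>k. ennreal (h k) * indicator (Qk k) p) \<partial>lborel)"
  proof (intro nn_integral_mono, goal_cases)
    case (1 p)
    show ?case
    proof (cases "p \<in> Q")
      case True
      then have "p \<in> Qk (level (fst p))" using level_in by (auto simp: Q_def Qk_def)
      then have "ennreal (h (level (fst p))) * indicator Q p = ennreal (h (level (fst p))) * indicator (Qk (level (fst p))) p"
        using True by simp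
      also have "\<dots> \<le> (\<Sum>k. ennreal (h k) * indicator (Qk k) p)"
      proof -
        define F where "F k = ennreal (h k) * indicator (Qk k) p" for k
        have "F (level (fst p)) \<le> (\<Sum>k. F k)" using sum_le_suminf[of F "{level (fst p)}"] by simp
        then show ?thesis by (simp only: F_def)
      qed
      finally show ?thesis .
    qed simp
  qed
  also have "\<dots> = (\<Sum>k. \<integral>\<^sup>+p. ennreal (h k) * indicator (Qk k) p \<partial>lborel)"
    by (rule nn_integral_suminf) measurable
  also have "\<dots> \<le> (\<Sum>k. ennreal (T * (1/2) ^ k))"
  proof (rule suminf_le)
    fix k
    have "(\<integral>\<^sup>+p. ennreal (h k) * indicator (Qk k) p \<partial>lborel) = ennreal (h k) * emeasure lborel (Qk k)"
      by (simp add: nn_integral_cmult_indicator)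
    also have "emeasure lborel (Qk k) = ennreal (measure lborel (Dk k)) * ennreal T"
    proof -
      have "emeasure lborel (Qk k) = emeasure (lborel \<Otimes>\<^sub>M lborel) (Dk k \<times> {0..T})" by (simp add: lborel_prod Qk_def)
      also have "\<dots> = ennreal (measure lborel (Dk k)) * ennreal T"
        using T_pos by (subst lborel.emeasure_pair_measure_Times) (auto simp: emD)
      finally show ?thesis .
    qed
    also have "ennreal (h k) * \<dots> = ennreal (h k * (measure lborel (Dk k) * T))"
      using h[of k] T_pos by (simp add: ennreal_mult)
    also have "\<dots> \<le> ennreal (T * (1/2) ^ k)"
    proof (rule ennreal_leI)
      have "damp k ^ (CARD('n) + 1) \<le> damp k"
        using damp(1,2)[of k] power_decreasing[of 1 "CARD('n) + 1" "damp k"] by simp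
      then have "h k \<le> weight k * damp k" unfolding h_def using weight_nonneg by (intro mult_left_mono)
      then have "h k * measure lborel (Dk k) \<le> weight k * damp k * measure lborel (Dk k)" by (intro mult_right_mono) auto
      also note damp(3)
      finally have "h k * measure lborel (Dk k) * T \<le> (1/2) ^ k * T" using T_pos by (intro mult_right_mono) auto
      then show "h k * (measure lborel (Dk k) * T) \<le> T * (1/2) ^ k" by (simp add: mult_ac)
    qed
    finally show "(\<integral>\<^sup>+p. ennreal (h k) * indicator (Qk k) p \<partial>lborel) \<le> ennreal (T * (1/2) ^ k)" .
  qed auto
  also have "\<dots> = ennreal (\<Sum>k. T * (1/2) ^ k)"
    using T_pos by (intro suminf_ennreal2 summable_mult summable_geometric) auto
  finally show "emeasure \<kappa> (space \<kappa>) \<noteq> \<infinity>" by (auto simp: top_unique)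
qed

end

section \<open>Duality\<close>

lemma backward_op_add:
  "backward_op a b c (\<lambda>p. u p + u' p) (\<lambda>p. G p + G' p) (\<lambda>p. H p + H' p) (\<lambda>p. ut p + ut' p) p
    = backward_op a b c u G H ut p + backward_op a b c u' G' H' ut' p"
  unfolding backward_op_def by (simp add: algebra_simps sum.distrib)

lemma backward_op_scale:
  "backward_op a b c (\<lambda>p. s * u p) (\<lambda>p. s *\<^sub>R G p) (\<lambda>p. s *\<^sub>R H p) (\<lambda>p. s * ut p) p
    = s * backward_op a b c u G H ut p"
  unfolding backward_op_def by (simp add: algebra_simps sum_distrib_left)

context elliptic_cauchy_data
begin

text \<open>Requiring only \<open>u \<le> 0\<close> outside a compact set admits nonpositive functions of
  time alone, which encode the mass inequality.\<close>

definition admissible ::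
  "((real^'n) \<times> real \<Rightarrow> real) \<Rightarrow> ((real^'n) \<times> real \<Rightarrow> real^'n) \<Rightarrow> ((real^'n) \<times> real \<Rightarrow> real^'n^'n)
    \<Rightarrow> ((real^'n) \<times> real \<Rightarrow> real) \<Rightarrow> bool" where
  "admissible u G H ut \<longleftrightarrow> (\<exists>Gt. parabolic_reg u G H ut Gt)
     \<and> (\<exists>K. compact K \<and> K \<subseteq> D \<and> (\<forall>x t. x \<notin> K \<longrightarrow> t \<in> {0..T} \<longrightarrow> u (x, t) \<le> 0))
     \<and> (\<forall>x. u (x, T) \<le> 0) \<and> integrable \<nu> (\<lambda>x. u (x, 0))"

lemma admissible_add:
  assumes "admissible u G H ut" "admissible u' G' H' ut'"
  shows "admissible (\<lambda>p. u p + u' p) (\<lambda>p. G p + G' p) (\<lambda>p. H p + H' p) (\<lambda>p. ut p + ut' p)"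
proof -
  obtain Gt K Gt' K' where *: "parabolic_reg u G H ut Gt" "compact K" "K \<subseteq> D"
    "\<And>x t. x \<notin> K \<Longrightarrow> t \<in> {0..T} \<Longrightarrow> u (x, t) \<le> 0" "\<And>x. u (x, T) \<le> 0" "integrable \<nu> (\<lambda>x. u (x, 0))"
    "parabolic_reg u' G' H' ut' Gt'" "compact K'" "K' \<subseteq> D"
    "\<And>x t. x \<notin> K' \<Longrightarrow> t \<in> {0..T} \<Longrightarrow> u' (x, t) \<le> 0" "\<And>x. u' (x, T) \<le> 0" "integrable \<nu> (\<lambda>x. u' (x, 0))"
    using assms unfolding admissible_def by blast
  show ?thesis
    unfolding admissible_def
  proof (intro conjI)
    show "\<exists>Gt. parabolic_reg (\<lambda>p. u p + u' p) (\<lambda>p. G p + G' p) (\<lambda>p. H p + H' p) (\<lambda>p. ut p + ut' p) Gt"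
      using parabolic_reg_add[OF *(1,7)] by blast
    show "\<exists>K. compact K \<and> K \<subseteq> D \<and> (\<forall>x t. x \<notin> K \<longrightarrow> t \<in> {0..T} \<longrightarrow> u (x, t) + u' (x, t) \<le> 0)"
      using * by (intro exI[of _ "K \<union> K'"]) (auto intro!: add_nonpos_nonpos)
  qed (use * in \<open>auto intro!: add_nonpos_nonpos\<close>)
qed

lemma admissible_scale:
  assumes "admissible u G H ut" "s > 0"
  shows "admissible (\<lambda>p. s * u p) (\<lambda>p. s *\<^sub>R G p) (\<lambda>p. s *\<^sub>R H p) (\<lambda>p. s * ut p)"
proof -
  obtain Gt K where *: "parabolic_reg u G H ut Gt" "compact K" "K \<subseteq> D"
    "\<And>x t. x \<notin> K \<Longrightarrow> t \<in> {0..T} \<Longrightarrow> u (x, t) \<le> 0" "\<And>x. u (x, T) \<le> 0" "integrable \<nu> (\<lambda>x. u (x, 0))"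
    using assms unfolding admissible_def by blast
  show ?thesis
    unfolding admissible_def
  proof (intro conjI)
    show "\<exists>Gt. parabolic_reg (\<lambda>p. s * u p) (\<lambda>p. s *\<^sub>R G p) (\<lambda>p. s *\<^sub>R H p) (\<lambda>p. s * ut p) Gt"
      using parabolic_reg_scale[OF *(1)] by blast
    show "\<exists>K. compact K \<and> K \<subseteq> D \<and> (\<forall>x t. x \<notin> K \<longrightarrow> t \<in> {0..T} \<longrightarrow> s * u (x, t) \<le> 0)"
      using * assms(2) by (intro exI[of _ K]) (auto intro!: mult_nonneg_nonpos)
  qed (use * assms(2) in \<open>auto intro!: mult_nonneg_nonpos\<close>)
qed

lemma admissible_zero: "admissible (\<lambda>_. 0) (\<lambda>_. 0) (\<lambda>_. 0) (\<lambda>_. 0)"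
  using parabolic_reg_time[of "\<lambda>_. 0" "\<lambda>_. 0"] unfolding admissible_def
  by (auto intro!: exI[of _ "{}"])

text \<open>The pair \<open>(f, r)\<close> stands for the constraint that the integral of \<open>f\<close> is at most \<open>r\<close>,
  imposed on the measure \<open>damp * \<mu>\<close>.\<close>

definition dual_cone :: "(((real^'n) \<times> real \<Rightarrow> real) \<times> real) set" where
  "dual_cone = {(f, r). f \<in> bounded_measurable \<kappa> \<and> (\<exists>u G H ut. admissible u G H ut \<and> - (\<integral>x. u (x, 0) \<partial>\<nu>) \<le> r
     \<and> (\<forall>x\<in>D. \<forall>t\<in>{0..T}. damp (level x) * f (x, t) \<le> backward_op a b c u G H ut (x, t)))}"

lemma dual_coneI:
  assumes "f \<in> bounded_measurable \<kappa>" "admissible u G H ut" "- (\<integral>x. u (x, 0) \<partial>\<nu>) \<le> r"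
    and "\<And>x t. x \<in> D \<Longrightarrow> t \<in> {0..T} \<Longrightarrow> damp (level x) * f (x, t) \<le> backward_op a b c u G H ut (x, t)"
  shows "(f, r) \<in> dual_cone"
  unfolding dual_cone_def using assms by blast

lemma dual_coneE:
  assumes "(f, r) \<in> dual_cone"
  obtains u G H ut where "f \<in> bounded_measurable \<kappa>" "admissible u G H ut" "- (\<integral>x. u (x, 0) \<partial>\<nu>) \<le> r"
    "\<And>x t. x \<in> D \<Longrightarrow> t \<in> {0..T} \<Longrightarrow> damp (level x) * f (x, t) \<le> backward_op a b c u G H ut (x, t)"
  using assms unfolding dual_cone_def by blast

lemma dual_cone_add:
  assumes "(f, r) \<in> dual_cone" "(g, s) \<in> dual_cone" shows "((\<lambda>x. f x + g x), r + s) \<in> dual_cone"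
proof -
  obtain u G H ut where 1: "f \<in> bounded_measurable \<kappa>" "admissible u G H ut" "- (\<integral>x. u (x, 0) \<partial>\<nu>) \<le> r"
    "\<And>x t. x \<in> D \<Longrightarrow> t \<in> {0..T} \<Longrightarrow> damp (level x) * f (x, t) \<le> backward_op a b c u G H ut (x, t)"
    by (rule dual_coneE[OF assms(1)]) (rule that)
  obtain u' G' H' ut' where 2: "g \<in> bounded_measurable \<kappa>" "admissible u' G' H' ut'" "- (\<integral>x. u' (x, 0) \<partial>\<nu>) \<le> s"
    "\<And>x t. x \<in> D \<Longrightarrow> t \<in> {0..T} \<Longrightarrow> damp (level x) * g (x, t) \<le> backward_op a b c u' G' H' ut' (x, t)"
    by (rule dual_coneE[OF assms(2)]) (rule that)
  show ?thesis
  proof (rule dual_coneI[OF bounded_measurable_add[OF 1(1) 2(1)] admissible_add[OF 1(2) 2(2)]])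
    show "- (\<integral>x. u (x, 0) + u' (x, 0) \<partial>\<nu>) \<le> r + s"
      using 1(2,3) 2(2,3) unfolding admissible_def by (subst Bochner_Integration.integral_add) auto
    show "damp (level x) * (f (x, t) + g (x, t)) \<le> backward_op a b c (\<lambda>p. u p + u' p) (\<lambda>p. G p + G' p) (\<lambda>p. H p + H' p) (\<lambda>p. ut p + ut' p) (x, t)"
      if "x \<in> D" "t \<in> {0..T}" for x t
      using 1(4)[OF that] 2(4)[OF that] unfolding backward_op_add distrib_left by (rule add_mono)
  qed
qed

lemma dual_cone_scale:
  assumes "(f, r) \<in> dual_cone" "s > 0" shows "((\<lambda>x. s * f x), s * r) \<in> dual_cone"
proof -
  obtain u G H ut where 1: "f \<in> bounded_measurable \<kappa>" "admissible u G H ut" "- (\<integral>x. u (x, 0) \<partial>\<nu>) \<le> r"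
    "\<And>x t. x \<in> D \<Longrightarrow> t \<in> {0..T} \<Longrightarrow> damp (level x) * f (x, t) \<le> backward_op a b c u G H ut (x, t)"
    by (rule dual_coneE[OF assms(1)]) (rule that)
  show ?thesis
  proof (rule dual_coneI[OF bounded_measurable_scale[OF 1(1)] admissible_scale[OF 1(2) assms(2)]])
    show "- (\<integral>x. s * u (x, 0) \<partial>\<nu>) \<le> s * r"
      using mult_left_mono[OF 1(3), of s] assms(2) by simp
    show "damp (level x) * (s * f (x, t)) \<le> backward_op a b c (\<lambda>p. s * u p) (\<lambda>p. s *\<^sub>R G p) (\<lambda>p. s *\<^sub>R H p) (\<lambda>p. s * ut p) (x, t)"
      if "x \<in> D" "t \<in> {0..T}" for x t
      using mult_left_mono[OF 1(4)[OF that], of s] assms(2) unfolding backward_op_scale by (simp add: mult_ac)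
  qed
qed

lemma dual_cone_zero: "((\<lambda>_. 0), 0) \<in> dual_cone"
  by (rule dual_coneI[OF _ admissible_zero]) (auto simp: bounded_measurable_def backward_op_def)

text \<open>As \<nu> is a probability measure and the integral of \<open>u\<close> at time 0 is at
  least \<open>- r\<close>, some \<open>x0\<close> satisfies \<open>u (x0, 0) >= - r\<close>. So the
  weighted estimate for the supremum of \<open>u\<close> applies with
  \<open>s = - r\<close>.\<close>

lemma dual_cone_key:
  assumes "(f, r) \<in> dual_cone" "r < 0"
  shows "(- r) ^ Suc CARD('n) \<le> pos_power_integral \<kappa> (Suc CARD('n)) (\<lambda>x. - f x)"
proof -
  interpret \<nu>: prob_space \<nu> by (rule nu_prob)
  interpret \<kappa>: finite_measure \<kappa> by (rule finite_kappa)
  obtain u G H ut where 1: "f \<in> bounded_measurable \<kappa>" "admissible u G H ut" "- (\<integral>x. u (x, 0) \<partial>\<nu>) \<le> r"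
    "\<And>x t. x \<in> D \<Longrightarrow> t \<in> {0..T} \<Longrightarrow> damp (level x) * f (x, t) \<le> backward_op a b c u G H ut (x, t)"
    by (rule dual_coneE[OF assms(1)]) (rule that)
  have fm [measurable]: "f \<in> borel_measurable borel" using 1(1) unfolding bounded_measurable_def measurable_cong_sets[OF sets_kappa refl] by blast
  obtain Gt K where *: "parabolic_reg u G H ut Gt" "compact K" "K \<subseteq> D"
    "\<And>x t. x \<notin> K \<Longrightarrow> t \<in> {0..T} \<Longrightarrow> u (x, t) \<le> 0" "\<And>x. u (x, T) \<le> 0" "integrable \<nu> (\<lambda>x. u (x, 0))"
    using 1(2) unfolding admissible_def by blast
  have "\<exists>x0. - r \<le> u (x0, 0)"
  proof (rule ccontr)
    assume "\<not> (\<exists>x0. - r \<le> u (x0, 0))"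
    then have "(\<integral>x. u (x, 0) \<partial>\<nu>) < (\<integral>x. - r \<partial>\<nu>)"
      by (intro \<nu>.integral_less_AE_space *(6) \<nu>.integrable_const) (auto simp: not_le \<nu>.emeasure_space_1)
    then show False using 1(3) by (simp add: \<nu>.prob_space)
  qed
  then obtain x0 where x0: "- r \<le> u (x0, 0)" by blast
  define g where "g p = - (damp (level (fst p)) * f p)" for p
  have [measurable]: "g \<in> borel_measurable borel" unfolding g_def by measurable
  have "ennreal ((- r) ^ (CARD('n) + 1))
    \<le> (\<integral>\<^sup>+p. ennreal (weight (level (fst p)) * (max 0 (g p)) ^ (CARD('n) + 1)) * indicator Q p \<partial>lborel)"
    by (rule weighted_estimate[OF *(1,2,3,4,5) _ x0]) (use assms(2) 1(4) in \<open>auto simp: g_def\<close>)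
  also have "\<dots> = (\<integral>\<^sup>+p. (ennreal (weight (level (fst p)) * damp (level (fst p)) ^ (CARD('n) + 1)) * indicator Q p) * ennreal ((max 0 (- f p)) ^ (CARD('n) + 1)) \<partial>lborel)"
  proof (intro nn_integral_cong, goal_cases)
    case (1 p)
    have "max 0 (g p) = damp (level (fst p)) * max 0 (- f p)"
      unfolding g_def using damp(1)[of "level (fst p)"] by (auto simp: max_def mult_le_0_iff zero_le_mult_iff)
    then show ?case using weight_nonneg damp(1)[of "level (fst p)"]
      by (simp add: power_mult_distrib ennreal_mult[symmetric] mult_ac less_imp_le del: power_Suc split: split_indicator)
  qed
  also have "\<dots> = (\<integral>\<^sup>+p. ennreal ((max 0 (- f p)) ^ (CARD('n) + 1)) \<partial>\<kappa>)"
    unfolding \<kappa>_def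
  proof (rule nn_integral_density[symmetric])
    show "(\<lambda>p. ennreal (weight (level (fst p)) * damp (level (fst p)) ^ (CARD('n) + 1)) * indicator Q p) \<in> borel_measurable lborel"
      unfolding measurable_lborel2 by measurable
  qed measurable
  also have "\<dots> = ennreal (pos_power_integral \<kappa> (Suc CARD('n)) (\<lambda>x. - f x))"
    unfolding pos_power_integral_def Suc_eq_plus1
    by (intro nn_integral_eq_integral \<kappa>.integrable_pos_power AE_I2 zero_le_power)
      (use bounded_measurable_scale[OF 1(1), of "-1"] in auto)
  finally have "ennreal ((- r) ^ Suc CARD('n)) \<le> ennreal (pos_power_integral \<kappa> (Suc CARD('n)) (\<lambda>x. - f x))"
    unfolding Suc_eq_plus1 .
  then show ?thesis by (rule iffD1[OF ennreal_le_iff[OF pos_power_integral_nonneg]])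
qed

end

text \<open>\<rho> is the density of the solution in space and time, and \<open>rho_test\<close> is
  the constraint of the cone with the damping removed. Since \<open>backward_op\<close> itself need
  not be integrable against \<rho>, it is replaced by a bounded minorant \<open>f\<close> that
  vanishes off some \<open>Qk k\<close>.\<close>

locale solution_density = elliptic_cauchy_data D Dk T a b c \<nu>
  for D :: "(real^'n::finite) set" and Dk :: "nat \<Rightarrow> (real^'n) set" and T :: real
    and a :: "real^'n \<Rightarrow> real \<Rightarrow> 'n \<Rightarrow> 'n \<Rightarrow> real"
    and b :: "real^'n \<Rightarrow> real \<Rightarrow> 'n \<Rightarrow> real"
    and c :: "real^'n \<Rightarrow> real \<Rightarrow> real"
    and \<nu> :: "(real^'n) measure" +
  fixes \<rho> :: "(real^'n) \<times> real \<Rightarrow> real"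
  assumes rho_borel [measurable]: "\<rho> \<in> borel_measurable borel" and rho_nonneg: "\<And>p. 0 \<le> \<rho> p"
    and rho_zero: "\<And>p. p \<notin> Q \<Longrightarrow> \<rho> p = 0"
    and rho_local: "\<And>k. integrable lborel (\<lambda>p. \<rho> p * indicator (Qk k) p)"
    and rho_test: "\<And>u G H ut f B k. admissible u G H ut \<Longrightarrow> f \<in> borel_measurable borel \<Longrightarrow> (\<And>p. \<bar>f p\<bar> \<le> B) \<Longrightarrow>
       (\<And>p. p \<notin> Qk k \<Longrightarrow> f p = 0) \<Longrightarrow>
       (\<And>x t. x \<in> D \<Longrightarrow> t \<in> {0..T} \<Longrightarrow> f (x, t) \<le> backward_op a b c u G H ut (x, t)) \<Longrightarrow>
       (\<integral>p. \<rho> p * f p \<partial>lborel) \<le> - (\<integral>x. u (x, 0) \<partial>\<nu>)"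

context elliptic_cauchy_data
begin

text \<open>Hahn-Banach yields a finite measure \<open>N\<close> standing for \<open>damp\<close>
  times the solution, so its Lebesgue density is divided by \<open>damp\<close>. For
  \<open>f\<close> supported in \<open>Qk k\<close> the quotient of \<open>f\<close> by
  \<open>damp\<close> is bounded, hence a legitimate first component of the cone.\<close>

lemma exists_solution_density: "\<exists>\<rho>. solution_density D Dk T a b c \<nu> \<rho>"
proof -
  interpret \<kappa>: finite_measure \<kappa> by (rule finite_kappa)
  obtain N where N: "sets N = sets \<kappa>" "finite_measure N" "absolutely_continuous \<kappa> N"
    "\<And>f r. (f, r) \<in> dual_cone \<Longrightarrow> (\<integral>x. f x \<partial>N) \<le> r"
  proof (rule \<kappa>.exists_dominated_measure[where K = dual_cone and n = "CARD('n)"])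
    show "f \<in> bounded_measurable \<kappa>" if "(f, r) \<in> dual_cone" for f r using dual_coneE[OF that] by blast
    show "(- r) ^ Suc CARD('n) \<le> pos_power_integral \<kappa> (Suc CARD('n)) (\<lambda>x. - f x)"
      if "(f, r) \<in> dual_cone" "r < 0" for f r by (rule dual_cone_key[OF that])
  qed (auto intro: dual_cone_zero dual_cone_add dual_cone_scale)
  interpret N: finite_measure N by (rule N(2))
  have setsN [simp, measurable_cong]: "sets N = sets borel" using N(1) by simp
  have "absolutely_continuous lborel \<kappa>"
  proof -
    have "(\<lambda>p. ennreal (weight (level (fst p)) * damp (level (fst p)) ^ (CARD('n) + 1)) * indicator Q p) \<in> borel_measurable lborel"
      unfolding measurable_lborel2 by measurable
    then show ?thesis unfolding \<kappa>_def by (rule absolutely_continuousI_density)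
  qed
  then have ac: "absolutely_continuous lborel N" using N(3) unfolding absolutely_continuous_def by blast
  obtain h0 where h0: "h0 \<in> borel_measurable lborel" "density lborel h0 = N"
    using sigma_finite_measure.Radon_Nikodym[OF sigma_finite_lborel ac] by auto
  \<comment> \<open>\<open>N\<close> is finite, so its density is finite almost everywhere and may
    be taken real.\<close>
  define h where "h p = enn2real (h0 p)" for p
  have hm [measurable]: "h \<in> borel_measurable borel" using h0(1) unfolding h_def by measurable
  have Nh: "N = density lborel (\<lambda>p. ennreal (h p))"
  proof -
    have "(\<integral>\<^sup>+p. h0 p \<partial>lborel) = emeasure N (space N)"
      unfolding h0(2)[symmetric] using h0(1) by (subst emeasure_density) auto
    then have "(\<integral>\<^sup>+p. h0 p \<partial>lborel) \<noteq> \<infinity>" using N.emeasure_finite by simp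
    then have "AE p in lborel. h0 p \<noteq> \<infinity>" by (rule nn_integral_PInf_AE[OF h0(1)])
    then have "AE p in lborel. h0 p = ennreal (h p)" unfolding h_def by (auto simp: less_top)
    then show ?thesis unfolding h0(2)[symmetric] using h0(1) by (subst density_cong[where f' = "\<lambda>p. ennreal (h p)"]) auto
  qed
  have h_nn: "0 \<le> h p" for p by (simp add: h_def)
  define v where "v p = damp (level (fst p))" for p :: "(real^'n) \<times> real"
  have v: "0 < v p" for p by (simp add: v_def damp)
  have [measurable]: "v \<in> borel_measurable borel" unfolding v_def by measurable
  define \<rho> where "\<rho> p = h p / v p * indicator Q p" for p
  have \<rho>m: "\<rho> \<in> borel_measurable borel" unfolding \<rho>_def by measurable
  \<comment> \<open>Only levels up to \<open>k\<close> occur in \<open>Qk k\<close>, so finitely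
    many values of \<open>damp\<close> are involved.\<close>
  have v_lower: "\<exists>C. \<forall>p\<in>Qk k. 1 / v p \<le> C" for k
  proof -
    have "1 / v p \<le> (\<Sum>i\<le>k. 1 / damp i)" if "p \<in> Qk k" for p
    proof -
      have "level (fst p) \<le> k" using that level_le by (auto simp: Qk_def)
      then show ?thesis unfolding v_def using damp(1) by (intro member_le_sum) (auto intro: less_imp_le)
    qed
    then show ?thesis by blast
  qed
  have quot: "(\<lambda>p. f p / v p) \<in> bounded_measurable \<kappa>"
    if [measurable]: "f \<in> borel_measurable borel" and B: "\<And>p. \<bar>f p\<bar> \<le> B" and zero: "\<And>p. p \<notin> Qk k \<Longrightarrow> f p = 0" for f B k
  proof -
    obtain C where C: "\<And>p. p \<in> Qk k \<Longrightarrow> 1 / v p \<le> C" using v_lower by blast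
    have "\<bar>f p / v p\<bar> \<le> B * \<bar>C\<bar>" for p
    proof (cases "p \<in> Qk k")
      case True
      have "\<bar>f p\<bar> * (1 / v p) \<le> B * \<bar>C\<bar>"
        using C[OF True] B[of p] v[of p] by (intro mult_mono) (auto intro: order_trans[OF abs_ge_zero])
      then show ?thesis using v[of p] by (simp add: abs_divide)
    next
      case False then show ?thesis using zero[OF False] order_trans[OF abs_ge_zero B[of p]] by simp
    qed
    then show ?thesis unfolding bounded_measurable_def by (auto intro!: exI[of _ "B * \<bar>C\<bar>"])
  qed
  have eq: "\<rho> p * f p = h p * (f p / v p)" if "\<And>p. p \<notin> Qk k \<Longrightarrow> f p = 0" for f k p
    using that[of p] Qk_sub[of k] by (cases "p \<in> Qk k") (auto simp: \<rho>_def)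
  have intN: "integrable N f" if "f \<in> bounded_measurable \<kappa>" for f
    using that
    by (intro N.integrable_bounded_measurable) (simp only: bounded_measurable_def measurable_cong_sets[OF N(1) refl])
  show ?thesis
  proof (intro exI[of _ \<rho>] solution_density.intro solution_density_axioms.intro elliptic_cauchy_data_axioms)
    show "\<rho> \<in> borel_measurable borel" by (rule \<rho>m)
    show "0 \<le> \<rho> p" for p unfolding \<rho>_def using h_nn[of p] v[of p] by simp
    show "\<rho> p = 0" if "p \<notin> Q" for p using that by (simp add: \<rho>_def)
    show "integrable lborel (\<lambda>p. \<rho> p * indicator (Qk k) p)" for k
    proof -
      have b: "(\<lambda>p. indicator (Qk k) p / v p) \<in> bounded_measurable \<kappa>"
        by (rule quot[where B = 1 and k = k]) (auto simp: indicator_def)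
      have "integrable lborel (\<lambda>p. h p *\<^sub>R (indicator (Qk k) p / v p))"
        using intN[OF b] unfolding Nh by (subst (asm) integrable_density) (auto simp: h_nn)
      then show ?thesis by (subst eq[of k]) auto
    qed
    fix u G H ut f B k
    assume A: "admissible u G H ut" and [measurable]: "f \<in> borel_measurable borel" and B: "\<And>p. \<bar>f p\<bar> \<le> B"
      and zero: "\<And>p. p \<notin> Qk k \<Longrightarrow> f p = 0"
      and le: "\<And>x t. x \<in> D \<Longrightarrow> t \<in> {0..T} \<Longrightarrow> f (x, t) \<le> backward_op a b c u G H ut (x, t)"
    have fb: "(\<lambda>p. f p / v p) \<in> bounded_measurable \<kappa>" by (rule quot[OF _ B zero]) auto
    have "(\<lambda>p. f p / v p, - (\<integral>x. u (x, 0) \<partial>\<nu>)) \<in> dual_cone"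
      by (rule dual_coneI[OF fb A]) (use le damp(1) in \<open>auto simp: v_def less_imp_neq[symmetric]\<close>)
    then have "(\<integral>p. f p / v p \<partial>N) \<le> - (\<integral>x. u (x, 0) \<partial>\<nu>)" by (rule N(4))
    also have "(\<integral>p. f p / v p \<partial>N) = (\<integral>p. h p *\<^sub>R (f p / v p) \<partial>lborel)"
      unfolding Nh by (rule integral_density) (auto simp: h_nn)
    also have "\<dots> = (\<integral>p. \<rho> p * f p \<partial>lborel)" using eq[where k = k and f = f, OF zero] by simp
    finally show "(\<integral>p. \<rho> p * f p \<partial>lborel) \<le> - (\<integral>x. u (x, 0) \<partial>\<nu>)" .
  qed
qed

end

section \<open>The flow of measures\<close>

text \<open>Fubini on the triangle of pairs \<open>s <= t\<close> in \<open>{0..T}\<close>, with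
  \<open>P T - P s\<close> written as the integral of \<psi> from \<open>s\<close> to
  \<open>T\<close>. It trades a test function vanishing at \<open>T\<close> for an arbitrary
  continuous one and brings in the primitive of \<open>I\<close>, so that relations can be read off
  at almost every time.\<close>

lemma integral_primitive_swap:
  fixes P \<psi> I :: "real \<Rightarrow> real"
  assumes P: "\<And>t. (P has_real_derivative \<psi> t) (at t)" and \<psi>: "continuous_on UNIV \<psi>"
    and b: "\<And>t. \<bar>\<psi> t\<bar> \<le> 1"
    and I: "integrable lborel I" and I0: "\<And>s. s \<notin> {0..T} \<Longrightarrow> I s = 0"
  shows "(\<integral>s. (P T - P s) * I s \<partial>lborel)
      = (\<integral>t. \<psi> t * (indicator {0..T} t * (\<integral>s. indicator {0..t} s * I s \<partial>lborel)) \<partial>lborel)"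
    and "integrable lborel (\<lambda>t. indicator {0..T} t * (\<integral>s. indicator {0..t} s * I s \<partial>lborel))"
proof -
  have [measurable]: "I \<in> borel_measurable borel" using I by auto
  have \<psi>m [measurable]: "\<psi> \<in> borel_measurable borel" by (rule borel_measurable_continuous_onI[OF \<psi>])
  have one: "integrable lborel (\<lambda>t. indicator {0..T} t :: real)"
    by (auto intro!: integrable_real_indicator simp: emeasure_lborel_Icc_eq)
  define F0 where "F0 z = indicator {0..T} (fst z) * I (snd z)" for z :: "real \<times> real"
  have dom: "integrable (lborel \<Otimes>\<^sub>M lborel) F0"
  proof (rule lborel_pair.Fubini_integrable)
    show "F0 \<in> borel_measurable (lborel \<Otimes>\<^sub>M lborel)" unfolding F0_def by measurable
    show "integrable lborel (\<lambda>t. \<integral>s. norm (F0 (t, s)) \<partial>lborel)"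
      using one by (simp add: F0_def abs_mult)
    show "AE t in lborel. integrable lborel (\<lambda>s. F0 (t, s))"
      using I by (simp add: F0_def)
  qed
  \<comment> \<open>Stated for every \<open>g\<close> bounded by 1: \<psi> gives the identity, the
    constant 1 the integrability of the primitive.\<close>
  have J: "integrable (lborel \<Otimes>\<^sub>M lborel) (\<lambda>(t, s). g t * (indicator {0..T} t * I s) * (if s \<le> t then 1 else 0))"
    if [measurable]: "g \<in> borel_measurable borel" and gb: "\<And>t. \<bar>g t\<bar> \<le> 1" for g :: "real \<Rightarrow> real"
  proof (rule Bochner_Integration.integrable_bound[OF dom])
    have "norm (g t * (indicator {0..T} t * I s) * (if s \<le> t then 1 else 0)) \<le> norm (F0 (t, s))" for t s
    proof -
      have "\<bar>g t\<bar> * \<bar>F0 (t, s)\<bar> \<le> 1 * \<bar>F0 (t, s)\<bar>" by (intro mult_right_mono gb) auto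
      then show ?thesis by (simp add: F0_def abs_mult)
    qed
    then have "norm (case z of (t, s) \<Rightarrow> (g t * (indicator {0..T} t * I s) * (if s \<le> t then 1 else 0))) \<le> norm (F0 z)" for z
      by (cases z) (simp only: prod.case)
    then show "AE z in lborel \<Otimes>\<^sub>M lborel. norm (case z of (t, s) \<Rightarrow> (g t * (indicator {0..T} t * I s) * (if s \<le> t then 1 else 0)))
       \<le> norm (F0 z)" by (rule AE_I2)
  qed measurable
  have inner: "(\<integral>s. g t * (indicator {0..T} t * I s) * (if s \<le> t then 1 else 0) \<partial>lborel)
     = g t * (indicator {0..T} t * (\<integral>s. indicator {0..t} s * I s \<partial>lborel))" for g :: "real \<Rightarrow> real" and t
  proof -
    have "(\<lambda>s. g t * (indicator {0..T} t * I s) * (if s \<le> t then 1 else 0))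
      = (\<lambda>s. (g t * indicator {0..T} t) * (indicator {0..t} s * I s))"
      using I0 by (auto simp: fun_eq_iff indicator_def)
    then show ?thesis by simp
  qed
  show "integrable lborel (\<lambda>t. indicator {0..T} t * (\<integral>s. indicator {0..t} s * I s \<partial>lborel))"
    using lborel_pair.integrable_fst'[OF J[of "\<lambda>_. 1"]] inner[of "\<lambda>_. 1"] by simp
  have outer: "(\<integral>t. \<psi> t * (indicator {0..T} t * I s) * (if s \<le> t then 1 else 0) \<partial>lborel) = (P T - P s) * I s" for s
  proof (cases "s \<in> {0..T}")
    case True
    have "(\<integral>t. \<psi> t * indicator {s..T} t \<partial>lborel) = P T - P s"
      using True P \<psi> by (intro integral_FTC_Icc_real) (auto simp: continuous_on_eq_continuous_at)
    moreover have "(\<lambda>t. \<psi> t * (indicator {0..T} t * I s) * (if s \<le> t then 1 else 0)) = (\<lambda>t. (\<psi> t * indicator {s..T} t) * I s)"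
      using True by (auto simp: fun_eq_iff indicator_def)
    ultimately show ?thesis by simp
  next
    case False then show ?thesis using I0[OF False] by simp
  qed
  show "(\<integral>s. (P T - P s) * I s \<partial>lborel)
      = (\<integral>t. \<psi> t * (indicator {0..T} t * (\<integral>s. indicator {0..t} s * I s \<partial>lborel)) \<partial>lborel)"
    using lborel_pair.Fubini_integral[OF J[OF \<psi>m b]] unfolding inner outer by simp
qed

lemma antiderivative_exists:
  fixes \<psi> :: "real \<Rightarrow> real"
  assumes "continuous_on UNIV \<psi>"
  obtains P where "\<And>t. (P has_real_derivative \<psi> t) (at t)"
proof -
  have "\<exists>F. \<forall>x :: real. - \<infinity> < ereal x \<longrightarrow> ereal x < \<infinity> \<longrightarrow> (F has_vector_derivative \<psi> x) (at x)"
    using assms by (intro einterval_antiderivative) (auto simp: continuous_on_eq_continuous_at)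
  then show ?thesis using that by (auto simp: has_real_derivative_iff_has_vector_derivative)
qed

lemma continuous_bounded_on_bounded:
  fixes f :: "real^'n \<Rightarrow> real"
  assumes "continuous_on UNIV f" "bounded S" shows "\<exists>B. \<forall>x\<in>S. \<bar>f x\<bar> \<le> B"
proof -
  have "compact (f ` closure S)"
    using assms by (intro compact_continuous_image) (auto intro: continuous_on_subset)
  then obtain B where "\<And>y. y \<in> f ` closure S \<Longrightarrow> norm y \<le> B" using compact_imp_bounded bounded_iff by metis
  then show ?thesis using closure_subset[of S] by (intro exI[of _ B]) auto
qed

context solution_density
begin

lemma rho_borel2 [measurable]: "\<rho> \<in> borel_measurable (borel \<Otimes>\<^sub>M borel)"
  using rho_borel by (simp add: borel_prod)

text \<open>One representative of \<rho> fixes all slices, so measurability in time comes from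
  Tonelli. Slices of infinite mass may occur, but only for a null set of times.\<close>

definition flow :: "real \<Rightarrow> (real^'n) measure" where
  "flow t = density (restrict_space lborel D) (\<lambda>x. ennreal (\<rho> (x, t)))"

lemma slice_measurable [measurable]:
  fixes F :: "(real^'n) \<times> real \<Rightarrow> 'b::topological_space"
  assumes "F \<in> borel_measurable borel" shows "(\<lambda>x. F (x, t)) \<in> borel_measurable borel"
proof -
  have "F \<in> borel_measurable (borel \<Otimes>\<^sub>M borel)" using assms by (simp add: borel_prod)
  then show ?thesis by measurable
qed

lemma sets_flow: "sets (flow t) = sets (restrict_space borel D)"
  by (simp add: flow_def sets_restrict_space)

lemma space_flow: "space (flow t) = D"
  by (simp add: flow_def space_restrict_space)

lemma nn_integral_flow:
  assumes [measurable]: "g \<in> borel_measurable borel"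
  shows "(\<integral>\<^sup>+x. g x \<partial>flow t) = (\<integral>\<^sup>+x. ennreal (\<rho> (x, t)) * g x \<partial>lborel)"
proof -
  have "(\<integral>\<^sup>+x. g x \<partial>flow t) = (\<integral>\<^sup>+x. ennreal (\<rho> (x, t)) * g x \<partial>restrict_space lborel D)"
    unfolding flow_def by (rule nn_integral_density) (auto intro!: measurable_restrict_space1)
  also have "\<dots> = (\<integral>\<^sup>+x. ennreal (\<rho> (x, t)) * g x * indicator D x \<partial>lborel)"
    by (rule nn_integral_restrict_space) simp
  also have "\<dots> = (\<integral>\<^sup>+x. ennreal (\<rho> (x, t)) * g x \<partial>lborel)"
    using rho_zero by (intro nn_integral_cong) (auto simp: Q_def split: split_indicator)
  finally show ?thesis .
qed

lemma integral_flow: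
  fixes g :: "real^'n \<Rightarrow> real"
  assumes [measurable]: "g \<in> borel_measurable borel"
  shows "(\<integral>x. g x \<partial>flow t) = (\<integral>x. \<rho> (x, t) * g x \<partial>lborel)"
proof -
  have "(\<integral>x. g x \<partial>flow t) = (\<integral>x. \<rho> (x, t) *\<^sub>R g x \<partial>restrict_space lborel D)"
    unfolding flow_def using rho_nonneg by (intro integral_density) (auto intro!: measurable_restrict_space1)
  also have "\<dots> = (\<integral>x. indicator D x *\<^sub>R (\<rho> (x, t) *\<^sub>R g x) \<partial>lborel)"
    by (rule integral_restrict_space) simp
  also have "\<dots> = (\<integral>x. \<rho> (x, t) * g x \<partial>lborel)"
    using rho_zero by (intro Bochner_Integration.integral_cong) (auto simp: Q_def split: split_indicator)
  finally show ?thesis .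
qed

lemma nn_integral_flow_Fubini:
  assumes "F \<in> borel_measurable borel"
  shows "(\<integral>\<^sup>+s. (\<integral>\<^sup>+x. F (x, s) \<partial>flow s) \<partial>lborel) = (\<integral>\<^sup>+p. ennreal (\<rho> p) * F p \<partial>lborel)"
proof -
  have [measurable]: "F \<in> borel_measurable (borel \<Otimes>\<^sub>M borel)" using assms by (simp add: borel_prod)
  have "(\<integral>\<^sup>+s. (\<integral>\<^sup>+x. F (x, s) \<partial>flow s) \<partial>lborel) = (\<integral>\<^sup>+s. (\<integral>\<^sup>+x. ennreal (\<rho> (x, s)) * F (x, s) \<partial>lborel) \<partial>lborel)"
    using assms by (simp add: nn_integral_flow)
  also have "\<dots> = (\<integral>\<^sup>+p. ennreal (\<rho> p) * F p \<partial>(lborel \<Otimes>\<^sub>M lborel))"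
    by (rule lborel_pair.nn_integral_snd) measurable
  finally show ?thesis by (simp add: lborel_prod)
qed

lemma integral_flow_Fubini:
  fixes F :: "(real^'n) \<times> real \<Rightarrow> real"
  assumes F: "F \<in> borel_measurable borel" and int: "integrable lborel (\<lambda>p. \<rho> p * F p)"
  shows "integrable lborel (\<lambda>s. \<integral>x. F (x, s) \<partial>flow s)"
    and "(\<integral>s. (\<integral>x. F (x, s) \<partial>flow s) \<partial>lborel) = (\<integral>p. \<rho> p * F p \<partial>lborel)"
proof -
  have int': "integrable (lborel \<Otimes>\<^sub>M lborel) (\<lambda>(x, s). \<rho> (x, s) * F (x, s))"
  proof -
    have "(\<lambda>(x, s). \<rho> (x, s) * F (x, s)) = (\<lambda>p. \<rho> p * F p)" by auto
    then show ?thesis using int by (simp add: lborel_prod)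
  qed
  have e: "(\<integral>x. F (x, s) \<partial>flow s) = (\<integral>x. \<rho> (x, s) * F (x, s) \<partial>lborel)" for s
    using F by (intro integral_flow) measurable
  show "integrable lborel (\<lambda>s. \<integral>x. F (x, s) \<partial>flow s)"
    unfolding e by (rule lborel_pair.integrable_snd[OF int'])
  show "(\<integral>s. (\<integral>x. F (x, s) \<partial>flow s) \<partial>lborel) = (\<integral>p. \<rho> p * F p \<partial>lborel)"
    unfolding e using lborel_pair.integral_snd[OF int'] by (simp add: lborel_prod case_prod_beta')
qed

lemma flow_zero_outside:
  assumes "t \<notin> {0..T}" and "g \<in> borel_measurable borel" shows "(\<integral>x. g x \<partial>flow t) = (0::real)"
  using assms rho_zero by (simp add: integral_flow Q_def)

text \<open>Extension by 0: coefficients measurable only on \<open>D \<times> {0..T}\<close> become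
  Borel functions on the whole space, as Fubini requires.\<close>

definition on_Q :: "(real^'n \<Rightarrow> real \<Rightarrow> real) \<Rightarrow> (real^'n) \<times> real \<Rightarrow> real" where
  "on_Q F p = indicator Q p * F (fst p) (snd p)"

lemma on_Q_eq: "x \<in> D \<Longrightarrow> t \<in> {0..T} \<Longrightarrow> on_Q F (x, t) = F x t"
  by (simp add: on_Q_def Q_def)

lemma on_Q_borel:
  assumes "(\<lambda>p. F (fst p) (snd p)) \<in> borel_measurable (restrict_space borel (D \<times> {0..T}))"
  shows "on_Q F \<in> borel_measurable borel"
proof -
  have "(\<lambda>p. indicator Q p *\<^sub>R F (fst p) (snd p)) \<in> borel_measurable borel"
    using assms unfolding Q_def[symmetric] by (subst (asm) borel_measurable_restrict_space_iff) auto
  then show ?thesis by (simp add: on_Q_def[abs_def])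
qed

lemma integral_flow_on_Q:
  assumes "t \<in> {0..T}" shows "(\<integral>x. F x t \<partial>flow t) = (\<integral>x. on_Q F (x, t) \<partial>flow t)"
  using assms by (intro Bochner_Integration.integral_cong) (auto simp: space_flow on_Q_eq)

text \<open>The closure of \<open>Dk k\<close> lies in \<open>Dk (Suc k)\<close>, where the
  coefficients are bounded and \<rho> is integrable. The bound is applied before Fubini, so that
  only a constant times an indicator has to be jointly measurable.\<close>

lemma nn_integral_flow_local_finite:
  fixes h :: "real^'n \<Rightarrow> real \<Rightarrow> ennreal"
  assumes h: "\<And>x s. x \<in> Dk (Suc k) \<Longrightarrow> s \<in> {0..T} \<Longrightarrow> h x s \<le> ennreal C" and \<alpha>\<beta>: "0 < \<alpha>" "\<beta> < T"
  shows "(\<integral>\<^sup>+s. (\<integral>\<^sup>+x. h x s * indicator (closure (Dk k)) x \<partial>flow s) * indicator {\<alpha>..\<beta>} s \<partial>lborel) < \<infinity>"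
proof -
  have "(\<integral>\<^sup>+s. (\<integral>\<^sup>+x. h x s * indicator (closure (Dk k)) x \<partial>flow s) * indicator {\<alpha>..\<beta>} s \<partial>lborel)
     \<le> (\<integral>\<^sup>+s. (\<integral>\<^sup>+x. ennreal C * indicator (Qk (Suc k)) (x, s) \<partial>flow s) \<partial>lborel)"
  proof (intro nn_integral_mono, goal_cases)
    case (1 s)
    show ?case
    proof (cases "s \<in> {\<alpha>..\<beta>}")
      case True
      then have s: "s \<in> {0..T}" using \<alpha>\<beta> by auto
      have "(\<integral>\<^sup>+x. h x s * indicator (closure (Dk k)) x \<partial>flow s) \<le> (\<integral>\<^sup>+x. ennreal C * indicator (Qk (Suc k)) (x, s) \<partial>flow s)"
      proof (intro nn_integral_mono, goal_cases)
        case (1 x)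
        show ?case using h[OF _ s, of x] Dk_incr[of k] s by (auto simp: Qk_def split: split_indicator)
      qed
      then show ?thesis using True by simp
    qed simp
  qed
  also have "\<dots> = (\<integral>\<^sup>+p. ennreal (\<rho> p) * (ennreal C * indicator (Qk (Suc k)) p) \<partial>lborel)"
    by (rule nn_integral_flow_Fubini[of "\<lambda>p. ennreal C * indicator (Qk (Suc k)) p"]) measurable
  also have "\<dots> = (\<integral>\<^sup>+p. ennreal C * ennreal (\<rho> p * indicator (Qk (Suc k)) p) \<partial>lborel)"
    by (intro nn_integral_cong) (auto simp: mult_ac split: split_indicator)
  also have "\<dots> = ennreal C * (\<integral>\<^sup>+p. ennreal (\<rho> p * indicator (Qk (Suc k)) p) \<partial>lborel)"
    by (rule nn_integral_cmult) measurable
  also have "(\<integral>\<^sup>+p. ennreal (\<rho> p * indicator (Qk (Suc k)) p) \<partial>lborel) = ennreal (\<integral>p. \<rho> p * indicator (Qk (Suc k)) p \<partial>lborel)"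
    by (rule nn_integral_eq_integral[OF rho_local]) (auto simp: rho_nonneg)
  finally show ?thesis by (simp add: ennreal_mult_less_top le_less_trans)
qed

lemma rho_integrable:
  assumes [measurable]: "f \<in> borel_measurable borel" and fb: "\<And>p. \<bar>f p\<bar> \<le> B" and f0: "\<And>p. p \<notin> Qk k \<Longrightarrow> f p = 0"
  shows "integrable lborel (\<lambda>p. \<rho> p * f p)"
proof (rule Bochner_Integration.integrable_bound[OF integrable_mult_right[OF rho_local[of k], of B]])
  have "norm (\<rho> p * f p) \<le> norm (B * (\<rho> p * indicator (Qk k) p))" for p
  proof (cases "p \<in> Qk k")
    case True
    have "0 \<le> B" using order_trans[OF abs_ge_zero fb[of p]] .
    then show ?thesis using True mult_left_mono[OF fb[of p] rho_nonneg[of p]] rho_nonneg[of p] by (simp add: abs_mult mult_ac)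
  qed (simp add: f0)
  then show "AE p in lborel. norm (\<rho> p * f p) \<le> norm (B * (\<rho> p * indicator (Qk k) p))" by simp
qed measurable

text \<open>\<open>rho_test\<close> admits only bounded functions supported in some
  \<open>Qk k\<close>. Cutting a nonnegative \<open>g\<close> off outside \<open>Qk k\<close> leaves
  it below \<open>backward_op\<close>, which is itself nonnegative, with a bound independent of
  \<open>k\<close>; monotone convergence then gives the integral over all of
  \<open>Q\<close>.\<close>

lemma rho_integral_le:
  assumes [measurable]: "g \<in> borel_measurable borel" and g0: "\<And>p. p \<in> Q \<Longrightarrow> 0 \<le> g p"
    and gb: "\<And>k. \<exists>B. \<forall>p\<in>Qk k. \<bar>g p\<bar> \<le> B"
    and adm: "admissible u G H ut"
    and le: "\<And>x t. x \<in> D \<Longrightarrow> t \<in> {0..T} \<Longrightarrow> g (x, t) \<le> backward_op a b c u G H ut (x, t)"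
  shows "(\<integral>\<^sup>+p. ennreal (\<rho> p * g p) \<partial>lborel) \<le> ennreal (- (\<integral>x. u (x, 0) \<partial>\<nu>))"
proof -
  have k: "(\<integral>\<^sup>+p. ennreal (\<rho> p * g p) * indicator (Qk k) p \<partial>lborel) \<le> ennreal (- (\<integral>x. u (x, 0) \<partial>\<nu>))" for k
  proof -
    obtain B where B: "\<And>p. p \<in> Qk k \<Longrightarrow> \<bar>g p\<bar> \<le> B" using gb by blast
    define f where "f p = g p * indicator (Qk k) p" for p
    have [measurable]: "f \<in> borel_measurable borel" unfolding f_def by measurable
    have fb: "\<bar>f p\<bar> \<le> \<bar>B\<bar>" for p using B[of p] by (auto simp: f_def split: split_indicator)
    have nn: "0 \<le> \<rho> p * f p" for p
      using rho_nonneg[of p] g0[of p] Qk_sub[of k] by (auto simp: f_def split: split_indicator)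
    have "(\<integral>p. \<rho> p * f p \<partial>lborel) \<le> - (\<integral>x. u (x, 0) \<partial>\<nu>)"
    proof (rule rho_test[OF adm _ fb])
      show "f p = 0" if "p \<notin> Qk k" for p using that by (simp add: f_def)
      show "f (x, t) \<le> backward_op a b c u G H ut (x, t)" if "x \<in> D" "t \<in> {0..T}" for x t
        using le[OF that] g0[of "(x, t)"] that by (auto simp: f_def Q_def split: split_indicator)
    qed measurable
    moreover have "integrable lborel (\<lambda>p. \<rho> p * f p)" by (rule rho_integrable[where k = k, OF _ fb]) (auto simp: f_def)
    ultimately have "(\<integral>\<^sup>+p. ennreal (\<rho> p * f p) \<partial>lborel) \<le> ennreal (- (\<integral>x. u (x, 0) \<partial>\<nu>))"
      by (subst nn_integral_eq_integral) (auto simp: nn intro!: ennreal_leI)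
    moreover have "ennreal (\<rho> p * f p) = ennreal (\<rho> p * g p) * indicator (Qk k) p" for p
      by (simp add: f_def split: split_indicator)
    ultimately show ?thesis by simp
  qed
  have "(\<integral>\<^sup>+p. ennreal (\<rho> p * g p) \<partial>lborel) = (\<integral>\<^sup>+p. (SUP k. ennreal (\<rho> p * g p) * indicator (Qk k) p) \<partial>lborel)"
  proof (intro nn_integral_cong, goal_cases)
    case (1 p)
    show ?case
    proof (cases "p \<in> Q")
      case True
      then have p: "p \<in> Qk (level (fst p))" using level_in by (auto simp: Q_def Qk_def)
      show ?thesis
      proof (rule antisym)
        show "ennreal (\<rho> p * g p) \<le> (SUP k. ennreal (\<rho> p * g p) * indicator (Qk k) p)"
          by (rule SUP_upper2[of "level (fst p)"]) (use p in auto)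
        show "(SUP k. ennreal (\<rho> p * g p) * indicator (Qk k) p) \<le> ennreal (\<rho> p * g p)"
          by (rule SUP_least) (auto split: split_indicator)
      qed
    next
      case False then show ?thesis by (simp add: rho_zero)
    qed
  qed
  also have "\<dots> = (SUP k. \<integral>\<^sup>+p. ennreal (\<rho> p * g p) * indicator (Qk k) p \<partial>lborel)"
  proof (rule nn_integral_monotone_convergence_SUP)
    show "incseq (\<lambda>k p. ennreal (\<rho> p * g p) * indicator (Qk k) p)"
      using Dk_mono unfolding incseq_def le_fun_def Qk_def by (fastforce split: split_indicator)
  qed measurable
  also have "\<dots> \<le> ennreal (- (\<integral>x. u (x, 0) \<partial>\<nu>))" by (rule SUP_least) (rule k)
  finally show ?thesis .
qed


lemma flow_emeasure_measurable:
  assumes "B \<in> sets (restrict_space borel D)"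
  shows "(\<lambda>t. emeasure (flow t) B) \<in> borel_measurable borel"
proof -
  have [measurable]: "B \<in> sets borel" using assms by (auto simp: sets_restrict_space)
  have "emeasure (flow t) B = (\<integral>\<^sup>+x. ennreal (\<rho> (x, t)) * indicator B x \<partial>lborel)" for t
    using assms nn_integral_flow[of "indicator B" t] by (simp add: nn_integral_indicator sets_flow)
  then show ?thesis by simp
qed

section \<open>Test functions of time alone and the mass inequality\<close>

lemma admissible_time:
  assumes "\<And>t. (f has_real_derivative f' t) (at t)" "continuous_on UNIV f'" "\<And>t. t \<in> {0..T} \<Longrightarrow> f t \<le> 0"
  shows "admissible (\<lambda>p. f (snd p)) (\<lambda>_. 0) (\<lambda>_. 0) (\<lambda>p. f' (snd p))"
proof -
  interpret \<nu>: prob_space \<nu> by (rule nu_prob)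
  show ?thesis
    unfolding admissible_def using parabolic_reg_time[OF assms(1,2)] assms(3) T_pos by (auto intro!: exI[of _ "{}"])
qed

lemma backward_op_time:
  "backward_op a b c (\<lambda>p. f (snd p)) (\<lambda>_. 0) (\<lambda>_. 0) (\<lambda>p. f' (snd p)) (x, t) = f' t + c x t * f t"
  by (simp add: backward_op_def)

lemma snd_borel: "\<psi> \<in> borel_measurable borel \<Longrightarrow> (\<lambda>p :: (real^'n) \<times> real. \<psi> (snd p)) \<in> borel_measurable borel"
  by (rule measurable_compose[of snd borel borel]) (auto intro!: borel_measurable_continuous_onI continuous_intros)

lemma fst_borel: "\<psi> \<in> borel_measurable borel \<Longrightarrow> (\<lambda>p :: (real^'n) \<times> real. \<psi> (fst p)) \<in> borel_measurable borel"
  by (rule measurable_compose[of fst borel borel]) (auto intro!: borel_measurable_continuous_onI continuous_intros)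

lemma on_Q_c_borel [measurable]: "on_Q c \<in> borel_measurable borel"
  by (rule on_Q_borel[OF c_borel])

lemma on_Q_c_nonpos: "on_Q c p \<le> 0"
  using c_nonpos[of "fst p" "snd p"] by (auto simp: on_Q_def Q_def split: split_indicator)

lemma on_Q_c_bounded: "p \<in> Qk k \<Longrightarrow> \<bar>on_Q c p\<bar> \<le> bound k"
  using bound_coeff(3)[of "fst p" k "snd p"] bound[of k] by (auto simp: on_Q_def Qk_def split: split_indicator)

text \<open>The test function is the constant -1: \<open>backward_op\<close> turns it into
  \<open>- c\<close>, and the right side is the mass of \<nu>.\<close>

lemma rho_c: "(\<integral>\<^sup>+p. ennreal (\<rho> p * (- on_Q c p)) \<partial>lborel) \<le> 1"
proof -
  interpret \<nu>: prob_space \<nu> by (rule nu_prob)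
  have "(\<integral>\<^sup>+p. ennreal (\<rho> p * (- on_Q c p)) \<partial>lborel) \<le> ennreal (- (\<integral>x. (\<lambda>_. - 1) (snd (x, 0 :: real)) \<partial>\<nu>))"
  proof (rule rho_integral_le[OF _ _ _ admissible_time[of "\<lambda>_. - 1" "\<lambda>_. 0"]])
    show "- on_Q c (x, t) \<le> backward_op a b c (\<lambda>p. - 1) (\<lambda>_. 0) (\<lambda>_. 0) (\<lambda>p. 0) (x, t)"
      if "x \<in> D" "t \<in> {0..T}" for x t
      using that by (simp add: backward_op_def on_Q_eq)
    show "\<exists>B. \<forall>p\<in>Qk k. \<bar>- on_Q c p\<bar> \<le> B" for k
      by (intro exI[of _ "bound k"] ballI) (simp add: on_Q_c_bounded)
  qed (use on_Q_c_nonpos in auto)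
  then show ?thesis by (simp add: \<nu>.prob_space)
qed

lemma rho_c_integrable: "integrable lborel (\<lambda>p. \<rho> p * on_Q c p)"
proof (rule integrableI_bounded)
  have "ennreal (norm (\<rho> p * on_Q c p)) = ennreal (\<rho> p * (- on_Q c p))" for p
    using on_Q_c_nonpos[of p] rho_nonneg[of p] by (simp add: abs_mult)
  then show "(\<integral>\<^sup>+p. ennreal (norm (\<rho> p * on_Q c p)) \<partial>lborel) < \<infinity>"
    using rho_c by (simp add: le_less_trans)
qed measurable

text \<open>The test function is \<open>t - T\<close>: since \<open>c\<close> and
  \<open>t - T\<close> are both nonpositive, \<open>backward_op\<close> is at least 1, and the total
  mass in space-time is at most \<open>T\<close>.\<close>

lemma rho_total_integrable: "integrable lborel \<rho>"
proof -
  interpret \<nu>: prob_space \<nu> by (rule nu_prob)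
  have "(\<integral>\<^sup>+p. ennreal (\<rho> p * 1) \<partial>lborel) \<le> ennreal (- (\<integral>x. (\<lambda>t. t - T) (snd (x, 0 :: real)) \<partial>\<nu>))"
  proof (rule rho_integral_le[OF _ _ _ admissible_time[of "\<lambda>t. t - T" "\<lambda>_. 1"]])
    show "1 \<le> backward_op a b c (\<lambda>p. snd p - T) (\<lambda>_. 0) (\<lambda>_. 0) (\<lambda>p. 1) (x, t)"
      if "x \<in> D" "t \<in> {0..T}" for x t
    proof -
      have "0 \<le> c x t * (t - T)" using c_nonpos[OF that] that by (simp add: mult_nonpos_nonpos)
      then show ?thesis by (simp add: backward_op_def)
    qed
  qed (auto intro!: derivative_eq_intros exI[of _ 1])
  then have "(\<integral>\<^sup>+p. ennreal (norm (\<rho> p)) \<partial>lborel) < \<infinity>" using rho_nonneg by (simp add: le_less_trans)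
  then show ?thesis by (intro integrableI_bounded) auto
qed

definition killed :: "real \<Rightarrow> real" where "killed t = (\<integral>x. on_Q c (x, t) \<partial>flow t)"
text \<open>A Bochner integral, hence 0 on slices of infinite mass, in agreement with
  \<open>measure\<close>.\<close>

definition mass :: "real \<Rightarrow> real" where "mass t = (\<integral>x. 1 \<partial>flow t)"

lemma integrable_killed: "integrable lborel killed"
  unfolding killed_def[abs_def] by (rule integral_flow_Fubini(1)[OF _ rho_c_integrable]) measurable

lemma integrable_mass: "integrable lborel mass"
  unfolding mass_def[abs_def] using integral_flow_Fubini(1)[of "\<lambda>_. 1"] rho_total_integrable by simp

text \<open>For a primitive \<open>P\<close> of an arbitrary \<psi> with values between 0 and 1, the
  function \<open>P t - P T\<close> is nonpositive on \<open>{0..T}\<close> and has derivative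
  \<psi>. Its image under \<open>backward_op\<close> has a part that integrates \<psi> against the
  mass and a part with \<open>c\<close>, which \<open>integral_primitive_swap\<close> turns into
  \<psi> against the accumulated killing. As \<psi> is arbitrary, the inequality holds at almost
  every time.\<close>

lemma mass_inequality:
  "AE t in lborel. t \<in> {0<..<T} \<longrightarrow> mass t \<le> 1 + (\<integral>s. indicator {0..t} s * killed s \<partial>lborel)"
proof -
  interpret \<nu>: prob_space \<nu> by (rule nu_prob)
  define J where "J t = indicator {0..T} t * (\<integral>s. indicator {0..t} s * killed s \<partial>lborel)" for t
  have killed0: "killed s = 0" if "s \<notin> {0..T}" for s
    unfolding killed_def using that by (intro flow_zero_outside) measurable
  have one: "integrable lborel (\<lambda>t. indicator {0..T} t :: real)"
    by (auto intro!: integrable_real_indicator simp: emeasure_lborel_Icc_eq)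
  have Ji: "integrable lborel J"
    unfolding J_def[abs_def]
    by (rule integral_primitive_swap(2)[of "\<lambda>_. 0" "\<lambda>_. 0"]) (auto intro: integrable_killed killed0)
  have "AE t in lborel. mass t - indicator {0..T} t - J t \<le> 0"
  proof (rule AE_nonpos_of_continuous_tests)
    show "integrable lborel (\<lambda>t. mass t - indicator {0..T} t - J t)"
      by (intro Bochner_Integration.integrable_diff integrable_mass one Ji)
    fix \<psi> :: "real \<Rightarrow> real"
    assume \<psi>: "continuous_on UNIV \<psi>" and p0: "\<And>t. 0 \<le> \<psi> t" and p1: "\<And>t. \<psi> t \<le> 1"
    have ab: "\<bar>\<psi> t\<bar> \<le> 1" for t using p0[of t] p1[of t] by simp
    have \<psi>m [measurable]: "\<psi> \<in> borel_measurable borel" by (rule borel_measurable_continuous_onI[OF \<psi>])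
    obtain P where P: "\<And>t. (P has_real_derivative \<psi> t) (at t)" using antiderivative_exists[OF \<psi>] by blast
    have Pc: "continuous_on UNIV P" using P by (meson DERIV_isCont continuous_at_imp_continuous_on)
    have Pm [measurable]: "P \<in> borel_measurable borel" by (rule borel_measurable_continuous_onI[OF Pc])
    have Pmono: "P s \<le> P t" if "s \<le> t" for s t
      using that P p0 by (intro DERIV_nonneg_imp_nondecreasing[of s t P]) auto
    note [measurable] = snd_borel[OF \<psi>m] snd_borel[OF Pm]
    \<comment> \<open>Subtracting \<open>P T\<close> makes the function nonpositive on
      \<open>{0..T}\<close>, hence admissible with the empty compact set.\<close>
    define f where "f t = P t - P T" for t
    have fm [measurable]: "(\<lambda>p :: (real^'n) \<times> real. f (snd p)) \<in> borel_measurable borel" unfolding f_def by measurable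
    have fneg: "f t \<le> 0" "\<bar>f t\<bar> \<le> P T - P 0" if "t \<in> {0..T}" for t
      using that Pmono[of t T] Pmono[of 0 t] by (auto simp: f_def)
    define g where "g p = \<psi> (snd p) + on_Q c p * f (snd p)" for p
    have i1: "integrable lborel (\<lambda>p. \<rho> p * \<psi> (snd p))"
      by (rule Bochner_Integration.integrable_bound[OF rho_total_integrable])
        (use ab rho_nonneg in \<open>auto simp: abs_mult intro!: mult_left_le\<close>)
    have i2: "integrable lborel (\<lambda>p. \<rho> p * (on_Q c p * f (snd p)))"
    proof (rule Bochner_Integration.integrable_bound[OF integrable_mult_right[OF rho_c_integrable, of "P T - P 0"]])
      have "norm (\<rho> p * (on_Q c p * f (snd p))) \<le> norm ((P T - P 0) * (\<rho> p * on_Q c p))" for p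
      proof (cases "p \<in> Q")
        case True
        then have "\<bar>f (snd p)\<bar> \<le> \<bar>P T - P 0\<bar>" using fneg(2)[of "snd p"] by (auto simp: Q_def)
        then have "\<bar>\<rho> p * on_Q c p\<bar> * \<bar>f (snd p)\<bar> \<le> \<bar>\<rho> p * on_Q c p\<bar> * \<bar>P T - P 0\<bar>" by (rule mult_left_mono) simp
        then show ?thesis by (simp add: abs_mult mult_ac)
      qed (simp add: rho_zero)
      then show "AE p in lborel. norm (\<rho> p * (on_Q c p * f (snd p))) \<le> norm ((P T - P 0) * (\<rho> p * on_Q c p))" by simp
    qed measurable
    have ig: "integrable lborel (\<lambda>p. \<rho> p * g p)"
      unfolding g_def distrib_left by (intro Bochner_Integration.integrable_add i1 i2)
    have gnn: "0 \<le> g p" if "p \<in> Q" for p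
      using that p0[of "snd p"] on_Q_c_nonpos[of p] fneg(1)[of "snd p"]
      by (auto simp: g_def Q_def intro!: add_nonneg_nonneg mult_nonpos_nonpos)
    have "(\<integral>\<^sup>+p. ennreal (\<rho> p * g p) \<partial>lborel) \<le> ennreal (- (\<integral>x. f (snd (x, 0 :: real)) \<partial>\<nu>))"
    proof (rule rho_integral_le[OF _ gnn _ admissible_time[of f \<psi>]])
      show "g \<in> borel_measurable borel" unfolding g_def by measurable
      show "\<exists>B. \<forall>p\<in>Qk k. \<bar>g p\<bar> \<le> B" for k
      proof (intro exI ballI)
        fix p assume p: "p \<in> Qk k"
        have "\<bar>on_Q c p\<bar> * \<bar>f (snd p)\<bar> \<le> bound k * (P T - P 0)"
          using p bound[of k] by (intro mult_mono on_Q_c_bounded fneg(2)) (auto simp: Qk_def)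
        then show "\<bar>g p\<bar> \<le> 1 + bound k * (P T - P 0)"
          using ab[of "snd p"] abs_triangle_ineq[of "\<psi> (snd p)" "on_Q c p * f (snd p)"] by (simp add: g_def abs_mult)
      qed
      show "(f has_real_derivative \<psi> t) (at t)" for t unfolding f_def using P[of t] by (auto intro!: derivative_eq_intros)
      show "g (x, t) \<le> backward_op a b c (\<lambda>p. f (snd p)) (\<lambda>_. 0) (\<lambda>_. 0) (\<lambda>p. \<psi> (snd p)) (x, t)"
        if "x \<in> D" "t \<in> {0..T}" for x t
        using that by (simp add: g_def backward_op_time on_Q_eq)
    qed (use \<psi> fneg in auto)
    moreover have "(\<integral>\<^sup>+p. ennreal (\<rho> p * g p) \<partial>lborel) = ennreal (\<integral>p. \<rho> p * g p \<partial>lborel)"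
    proof (rule nn_integral_eq_integral[OF ig AE_I2])
      show "0 \<le> \<rho> p * g p" for p using gnn[of p] rho_nonneg[of p] rho_zero[of p] by (cases "p \<in> Q") auto
    qed
    moreover have "f 0 \<le> 0" using fneg(1)[of 0] T_pos by simp
    ultimately have le: "(\<integral>p. \<rho> p * g p \<partial>lborel) \<le> P T - P 0"
      by (simp add: \<nu>.prob_space f_def)
    have e1: "(\<integral>p. \<rho> p * \<psi> (snd p) \<partial>lborel) = (\<integral>t. \<psi> t * mass t \<partial>lborel)"
      using integral_flow_Fubini(2)[of "\<lambda>p. \<psi> (snd p)", OF _ i1] by (simp add: mass_def mult.commute)
    have "(\<integral>p. \<rho> p * (on_Q c p * f (snd p)) \<partial>lborel) = (\<integral>t. f t * killed t \<partial>lborel)"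
      using integral_flow_Fubini(2)[of "\<lambda>p. on_Q c p * f (snd p)", OF _ i2] by (simp add: killed_def mult.commute)
    also have "\<dots> = - (\<integral>t. (P T - P t) * killed t \<partial>lborel)"
      by (simp add: f_def left_diff_distrib flip: Bochner_Integration.integral_minus)
    also have "(\<integral>t. (P T - P t) * killed t \<partial>lborel) = (\<integral>t. \<psi> t * J t \<partial>lborel)"
      unfolding J_def by (rule integral_primitive_swap(1)[OF P \<psi> ab integrable_killed killed0])
    finally have e2: "(\<integral>p. \<rho> p * (on_Q c p * f (snd p)) \<partial>lborel) = - (\<integral>t. \<psi> t * J t \<partial>lborel)" .
    have e3: "(\<integral>t. \<psi> t * indicator {0..T} t \<partial>lborel) = P T - P 0"
      using T_pos P \<psi> by (intro integral_FTC_Icc_real) (auto simp: continuous_on_eq_continuous_at)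
    have mult: "integrable lborel (\<lambda>t. \<psi> t * h t)" if "integrable lborel h" for h
      by (rule Bochner_Integration.integrable_bound[OF that])
        (use ab that in \<open>auto simp: abs_mult intro!: mult_left_le_one_le\<close>)
    have "(\<integral>t. \<psi> t * (mass t - indicator {0..T} t - J t) \<partial>lborel)
      = (\<integral>t. \<psi> t * mass t \<partial>lborel) - (\<integral>t. \<psi> t * indicator {0..T} t \<partial>lborel) - (\<integral>t. \<psi> t * J t \<partial>lborel)"
      unfolding right_diff_distrib
      by (simp only: Bochner_Integration.integral_diff Bochner_Integration.integrable_diff mult[OF integrable_mass] mult[OF one] mult[OF Ji])
    also have "\<dots> = (\<integral>p. \<rho> p * g p \<partial>lborel) - (P T - P 0)"
      unfolding g_def distrib_left using i1 i2 e1 e2 e3 by simp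
    finally show "(\<integral>t. \<psi> t * (mass t - indicator {0..T} t - J t) \<partial>lborel) \<le> 0" using le by simp
  qed
  then show ?thesis by (rule AE_mp) (auto simp: J_def)
qed

end

context solution_density
begin

section \<open>Spatial test functions and the weak equation\<close>

lemma Lop_borel:
  assumes "test_fun D \<phi>"
  shows "on_Q (Lop a b c \<phi>) \<in> borel_measurable borel"
proof (rule on_Q_borel)
  have sm: "smooth_fun \<phi>" using assms by (simp add: test_fun_def)
  note sp = smooth_fun_pd[OF sm]
  have R: "(\<lambda>p. g (fst p)) \<in> borel_measurable (restrict_space borel (D \<times> {0..T}))"
    if "continuous_on UNIV g" for g :: "real^'n \<Rightarrow> real"
    by (intro measurable_restrict_space1 fst_borel borel_measurable_continuous_onI that)
  show "(\<lambda>p. Lop a b c \<phi> (fst p) (snd p)) \<in> borel_measurable (restrict_space borel (D \<times> {0..T}))"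
    unfolding Lop_def
    by (intro borel_measurable_add borel_measurable_sum borel_measurable_times a_borel b_borel c_borel R sp(1-3))
qed

definition bounded_on_Qk :: "nat \<Rightarrow> ((real^'n) \<times> real \<Rightarrow> real) \<Rightarrow> bool" where
  "bounded_on_Qk k g \<longleftrightarrow> (\<exists>B. \<forall>p\<in>Qk k. \<bar>g p\<bar> \<le> B)"

lemma bounded_on_Qk_add: "bounded_on_Qk k f \<Longrightarrow> bounded_on_Qk k g \<Longrightarrow> bounded_on_Qk k (\<lambda>p. f p + g p)"
  unfolding bounded_on_Qk_def by (meson abs_triangle_ineq add_mono order_trans)

lemma bounded_on_Qk_mult:
  assumes "bounded_on_Qk k f" "bounded_on_Qk k g" shows "bounded_on_Qk k (\<lambda>p. f p * g p)"
proof -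
  obtain A B where "\<And>p. p \<in> Qk k \<Longrightarrow> \<bar>f p\<bar> \<le> A" "\<And>p. p \<in> Qk k \<Longrightarrow> \<bar>g p\<bar> \<le> B"
    using assms unfolding bounded_on_Qk_def by blast
  then have "\<bar>f p * g p\<bar> \<le> A * B" if "p \<in> Qk k" for p
    unfolding abs_mult using that order_trans[OF abs_ge_zero, of "f p" A] by (intro mult_mono) auto
  then show ?thesis unfolding bounded_on_Qk_def by blast
qed

lemma bounded_on_Qk_sum:
  "finite S \<Longrightarrow> (\<And>i. i \<in> S \<Longrightarrow> bounded_on_Qk k (f i)) \<Longrightarrow> bounded_on_Qk k (\<lambda>p. \<Sum>i\<in>S. f i p)"
proof (induction S rule: finite_induct)
  case empty then show ?case by (auto simp: bounded_on_Qk_def)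
next
  case (insert i S) then show ?case by (simp add: bounded_on_Qk_add)
qed

lemma Lop_bounded_on_Qk:
  assumes "test_fun D \<phi>" shows "bounded_on_Qk k (\<lambda>p. Lop a b c \<phi> (fst p) (snd p))"
    and "bounded_on_Qk k (\<lambda>p. \<phi> (fst p))"
proof -
  have sm: "smooth_fun \<phi>" using assms by (simp add: test_fun_def)
  note sp = smooth_fun_pd[OF sm]
  have C: "bounded_on_Qk k (\<lambda>p. g (fst p))" if "continuous_on UNIV g" for g :: "real^'n \<Rightarrow> real"
    using continuous_bounded_on_bounded[OF that Dk_bounded[of k]] unfolding bounded_on_Qk_def Qk_def by auto
  have "bounded_on_Qk k (\<lambda>p. a (fst p) (snd p) i j)" "bounded_on_Qk k (\<lambda>p. b (fst p) (snd p) i)"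
    "bounded_on_Qk k (\<lambda>p. c (fst p) (snd p))" for i j
    unfolding bounded_on_Qk_def Qk_def using bound_coeff by (auto intro!: exI[of _ "bound k"])
  then show "bounded_on_Qk k (\<lambda>p. Lop a b c \<phi> (fst p) (snd p))"
    unfolding Lop_def by (intro bounded_on_Qk_add bounded_on_Qk_sum bounded_on_Qk_mult C sp(1-3)) auto
  show "bounded_on_Qk k (\<lambda>p. \<phi> (fst p))" by (rule C[OF sp(1)])
qed

text \<open>The constraint is tested with a function of time times \<phi>, of either sign, and
  becomes an equality. With the time factor written as the integral of \<psi> from \<open>t\<close>
  to \<open>T\<close>, Fubini in time reduces it to an identity against \<psi>, which determines
  both sides at almost every time.\<close>

lemma test_fun_integral_equation:
  assumes \<phi>: "test_fun D \<phi>"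
  shows "integrable lborel (\<lambda>s. \<integral>x. on_Q (Lop a b c \<phi>) (x, s) \<partial>flow s)"
    and "AE t in lborel. t \<in> {0<..<T} \<longrightarrow> (\<integral>x. \<phi> x \<partial>flow t) - (\<integral>x. \<phi> x \<partial>\<nu>)
       = (\<integral>s. indicator {0..t} s * (\<integral>x. on_Q (Lop a b c \<phi>) (x, s) \<partial>flow s) \<partial>lborel)"
proof -
  interpret \<nu>: prob_space \<nu> by (rule nu_prob)
  define K where "K = closure {x. \<phi> x \<noteq> 0}"
  have sm: "smooth_fun \<phi>" and K: "compact K" "K \<subseteq> D" using \<phi> by (auto simp: test_fun_def K_def)
  have \<phi>K: "\<phi> x = 0" if "x \<notin> K" for x using that closure_subset[of "{x. \<phi> x \<noteq> 0}"] by (auto simp: K_def)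
  have LK: "Lop a b c \<phi> x t = 0" if "x \<notin> K" for x t using that by (intro Lop_zero_outside) (simp add: K_def)
  obtain k where k: "K \<subseteq> Dk k" using compact_subset_Dk[OF K] by blast
  define F1 where "F1 = on_Q (\<lambda>x t. \<phi> x)"
  define F2 where "F2 = on_Q (Lop a b c \<phi>)"
  have \<phi>m: "\<phi> \<in> borel_measurable borel" by (rule borel_measurable_continuous_onI[OF smooth_fun_pd(1)[OF sm]])
  have F1m [measurable]: "F1 \<in> borel_measurable borel"
    unfolding F1_def by (intro on_Q_borel measurable_restrict_space1 fst_borel \<phi>m)
  have F2m [measurable]: "F2 \<in> borel_measurable borel" unfolding F2_def by (rule Lop_borel[OF \<phi>])
  have zero: "F1 p = 0" "F2 p = 0" if "p \<notin> Qk k" for p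
  proof -
    have "fst p \<notin> K \<or> p \<notin> Q" using that k by (auto simp: Qk_def Q_def)
    then show "F1 p = 0" "F2 p = 0" using \<phi>K LK by (auto simp: F1_def F2_def on_Q_def)
  qed
  obtain B1 where B1: "\<And>p. p \<in> Qk k \<Longrightarrow> \<bar>\<phi> (fst p)\<bar> \<le> B1"
    using Lop_bounded_on_Qk(2)[OF \<phi>, of k] unfolding bounded_on_Qk_def by blast
  obtain B2 where B2: "\<And>p. p \<in> Qk k \<Longrightarrow> \<bar>Lop a b c \<phi> (fst p) (snd p)\<bar> \<le> B2"
    using Lop_bounded_on_Qk(1)[OF \<phi>, of k] unfolding bounded_on_Qk_def by blast
  have F1b: "\<bar>F1 p\<bar> \<le> \<bar>B1\<bar>" for p
    using B1[of p] zero(1)[of p] by (cases "p \<in> Qk k") (auto simp: F1_def on_Q_def split: split_indicator)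
  have F2b: "\<bar>F2 p\<bar> \<le> \<bar>B2\<bar>" for p
    using B2[of p] zero(2)[of p] by (cases "p \<in> Qk k") (auto simp: F2_def on_Q_def split: split_indicator)
  define m where "m t = (\<integral>x. F1 (x, t) \<partial>flow t)" for t
  define I where "I t = (\<integral>x. F2 (x, t) \<partial>flow t)" for t
  define J where "J t = indicator {0..T} t * (\<integral>s. indicator {0..t} s * I s \<partial>lborel)" for t
  define n where "n = (\<integral>x. \<phi> x \<partial>\<nu>)"
  have I0: "I s = 0" if "s \<notin> {0..T}" for s unfolding I_def using that by (intro flow_zero_outside) measurable
  have mi: "integrable lborel m" unfolding m_def[abs_def]
    by (rule integral_flow_Fubini(1)[OF F1m rho_integrable[OF F1m F1b zero(1)]])
  have Ii: "integrable lborel I" unfolding I_def[abs_def]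
    by (rule integral_flow_Fubini(1)[OF F2m rho_integrable[OF F2m F2b zero(2)]])
  then show "integrable lborel (\<lambda>s. \<integral>x. on_Q (Lop a b c \<phi>) (x, s) \<partial>flow s)"
    by (simp add: I_def[abs_def] F2_def)
  have one: "integrable lborel (\<lambda>t. n * indicator {0..T} t :: real)"
    by (auto intro!: integrable_real_indicator simp: emeasure_lborel_Icc_eq)
  have Ji: "integrable lborel J"
    unfolding J_def[abs_def]
    by (rule integral_primitive_swap(2)[of "\<lambda>_. 0" "\<lambda>_. 0"]) (auto intro: Ii I0)
  have test: "(\<integral>t. \<psi> t * (m t - n * indicator {0..T} t - J t) \<partial>lborel) = 0"
    if \<psi>: "continuous_on UNIV \<psi>" and p0: "\<And>t. 0 \<le> \<psi> t" and p1: "\<And>t. \<psi> t \<le> 1" for \<psi>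
  proof -
    have ab: "\<bar>\<psi> t\<bar> \<le> 1" for t using p0[of t] p1[of t] by simp
    have \<psi>m [measurable]: "\<psi> \<in> borel_measurable borel" by (rule borel_measurable_continuous_onI[OF \<psi>])
    obtain P where P: "\<And>t. (P has_real_derivative \<psi> t) (at t)" using antiderivative_exists[OF \<psi>] by blast
    have Pc: "continuous_on UNIV P" using P by (meson DERIV_isCont continuous_at_imp_continuous_on)
    have Pm [measurable]: "P \<in> borel_measurable borel" by (rule borel_measurable_continuous_onI[OF Pc])
    have Pmono: "P s \<le> P t" if "s \<le> t" for s t
      using that P p0 by (intro DERIV_nonneg_imp_nondecreasing[of s t P]) auto
    note [measurable] = snd_borel[OF \<psi>m] snd_borel[OF Pm]
    \<comment> \<open>The factor vanishes at \<open>T\<close>, as admissibility asks, and its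
      derivative is \<open>- \<psi>\<close>, so \<psi> itself ends up multiplying the integral of
      \<phi>.\<close>
    define \<zeta> where "\<zeta> t = P T - P t" for t
    have \<zeta>D: "(\<zeta> has_real_derivative (- \<psi> t)) (at t)" for t
      unfolding \<zeta>_def using P[of t] by (auto intro!: derivative_eq_intros)
    have [measurable]: "(\<lambda>p :: (real^'n) \<times> real. \<zeta> (snd p)) \<in> borel_measurable borel" unfolding \<zeta>_def by measurable
    have \<zeta>b: "\<bar>\<zeta> t\<bar> \<le> P T - P 0" if "t \<in> {0..T}" for t
      using that Pmono[of t T] Pmono[of 0 t] by (auto simp: \<zeta>_def)
    define g1 g2 where "g1 p = \<psi> (snd p) * F1 p" and "g2 p = \<zeta> (snd p) * F2 p" for p
    have g1m [measurable]: "g1 \<in> borel_measurable borel" and g2m [measurable]: "g2 \<in> borel_measurable borel"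
      unfolding g1_def g2_def by measurable
    have g1b: "\<bar>g1 p\<bar> \<le> 1 * \<bar>B1\<bar>" for p unfolding g1_def abs_mult by (intro mult_mono ab F1b) auto
    have g2b: "\<bar>g2 p\<bar> \<le> (P T - P 0) * \<bar>B2\<bar>" for p
    proof (cases "p \<in> Qk k")
      case True
      then have "\<bar>\<zeta> (snd p)\<bar> \<le> P T - P 0" by (intro \<zeta>b) (auto simp: Qk_def)
      then show ?thesis unfolding g2_def abs_mult using Pmono[of 0 T] T_pos by (intro mult_mono F2b) auto
    next
      case False then show ?thesis using zero(2)[OF False] Pmono[of 0 T] T_pos by (simp add: g2_def)
    qed
    have gz: "g1 p = 0" "g2 p = 0" if "p \<notin> Qk k" for p using zero[OF that] by (auto simp: g1_def g2_def)
    have i1: "integrable lborel (\<lambda>p. \<rho> p * g1 p)" by (rule rho_integrable[OF g1m g1b gz(1)])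
    have i2: "integrable lborel (\<lambda>p. \<rho> p * g2 p)" by (rule rho_integrable[OF g2m g2b gz(2)])
    let ?u = "\<lambda>p. \<zeta> (snd p) * \<phi> (fst p)" and ?G = "\<lambda>p. \<zeta> (snd p) *\<^sub>R (\<chi> i. pd i \<phi> (fst p))"
      and ?H = "\<lambda>p. \<zeta> (snd p) *\<^sub>R (\<chi> i j. pd j (pd i \<phi>) (fst p))" and ?ut = "\<lambda>p. - \<psi> (snd p) * \<phi> (fst p)"
    have reg: "\<exists>Gt. parabolic_reg ?u ?G ?H ?ut Gt"
      using parabolic_reg_product[OF sm \<zeta>D] \<psi> by (blast intro: continuous_intros)
    obtain B where B: "\<And>x. \<bar>\<phi> x\<bar> \<le> B"
    proof -
      obtain B where "\<forall>x\<in>K. \<bar>\<phi> x\<bar> \<le> B"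
        using continuous_bounded_on_bounded[OF smooth_fun_pd(1)[OF sm] compact_imp_bounded[OF K(1)]] by blast
      then have "\<bar>\<phi> x\<bar> \<le> \<bar>B\<bar>" for x using \<phi>K[of x] by (cases "x \<in> K") auto
      then show ?thesis by (rule that)
    qed
    have \<phi>\<nu>: "integrable \<nu> \<phi>"
    proof (rule \<nu>.integrable_const_bound[of _ B])
      show "\<phi> \<in> borel_measurable \<nu>"
        unfolding measurable_cong_sets[OF nu_sets refl] by (rule measurable_restrict_space1[OF \<phi>m])
    qed (use B in simp)
    \<comment> \<open>Any real \<sigma> is allowed, because \<phi> vanishes off \<open>K\<close> and
      \<zeta> at \<open>T\<close>; the values 1 and -1 together give equality.\<close>
    have half: "(\<integral>p. \<rho> p * (\<sigma> * (g2 p - g1 p)) \<partial>lborel) \<le> - (\<sigma> * (\<zeta> 0 * n))" for \<sigma>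
    proof -
      have "(\<integral>p. \<rho> p * (\<sigma> * (g2 p - g1 p)) \<partial>lborel) \<le> - (\<integral>x. \<sigma> * ?u (x, 0) \<partial>\<nu>)"
      proof (rule rho_test[where k = k and B = "\<bar>\<sigma>\<bar> * ((P T - P 0) * \<bar>B2\<bar> + 1 * \<bar>B1\<bar>)"])
        show "admissible (\<lambda>p. \<sigma> * ?u p) (\<lambda>p. \<sigma> *\<^sub>R ?G p) (\<lambda>p. \<sigma> *\<^sub>R ?H p) (\<lambda>p. \<sigma> * ?ut p)"
          unfolding admissible_def
        proof (intro conjI)
          show "\<exists>Gt. parabolic_reg (\<lambda>p. \<sigma> * ?u p) (\<lambda>p. \<sigma> *\<^sub>R ?G p) (\<lambda>p. \<sigma> *\<^sub>R ?H p) (\<lambda>p. \<sigma> * ?ut p) Gt"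
            using reg parabolic_reg_scale by blast
          show "\<exists>K. compact K \<and> K \<subseteq> D \<and> (\<forall>x t. x \<notin> K \<longrightarrow> t \<in> {0..T} \<longrightarrow> \<sigma> * ?u (x, t) \<le> 0)"
            using K \<phi>K by (intro exI[of _ K]) auto
          show "\<forall>x. \<sigma> * ?u (x, T) \<le> 0" by (simp add: \<zeta>_def)
          show "integrable \<nu> (\<lambda>x. \<sigma> * ?u (x, 0))" using \<phi>\<nu> by simp
        qed
        show "(\<lambda>p. \<sigma> * (g2 p - g1 p)) \<in> borel_measurable borel" by measurable
        show "\<bar>\<sigma> * (g2 p - g1 p)\<bar> \<le> \<bar>\<sigma>\<bar> * ((P T - P 0) * \<bar>B2\<bar> + 1 * \<bar>B1\<bar>)" for p
          unfolding abs_mult using g1b[of p] g2b[of p] by (intro mult_left_mono) auto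
        show "\<sigma> * (g2 p - g1 p) = 0" if "p \<notin> Qk k" for p using gz[OF that] by simp
        show "\<sigma> * (g2 (x, t) - g1 (x, t))
           \<le> backward_op a b c (\<lambda>p. \<sigma> * ?u p) (\<lambda>p. \<sigma> *\<^sub>R ?G p) (\<lambda>p. \<sigma> *\<^sub>R ?H p) (\<lambda>p. \<sigma> * ?ut p) (x, t)"
          if "x \<in> D" "t \<in> {0..T}" for x t
          unfolding backward_op_scale backward_op_product[OF sm, of a b c \<zeta> "\<lambda>t. - \<psi> t"]
          using that by (simp add: g1_def g2_def F1_def F2_def on_Q_eq)
      qed
      also have "(\<integral>x. \<sigma> * ?u (x, 0) \<partial>\<nu>) = \<sigma> * (\<zeta> 0 * n)" by (simp add: n_def)
      finally show ?thesis .
    qed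
    have eq: "(\<integral>p. \<rho> p * (g2 p - g1 p) \<partial>lborel) = - (\<zeta> 0 * n)"
    proof -
      have "- (\<integral>p. \<rho> p * (g2 p - g1 p) \<partial>lborel) \<le> - (- (\<zeta> 0 * n))"
        using half[of "- 1"] by (simp only: mult_minus_left mult_minus_right mult_1 Bochner_Integration.integral_minus)
      then show ?thesis using half[of 1] by (simp only: mult_1)
    qed
    have e1: "(\<integral>p. \<rho> p * g1 p \<partial>lborel) = (\<integral>t. \<psi> t * m t \<partial>lborel)"
      using integral_flow_Fubini(2)[OF g1m i1] by (simp add: g1_def m_def)
    have "(\<integral>p. \<rho> p * g2 p \<partial>lborel) = (\<integral>t. \<zeta> t * I t \<partial>lborel)"
      using integral_flow_Fubini(2)[OF g2m i2] by (simp add: g2_def I_def)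
    also have "\<dots> = (\<integral>t. \<psi> t * J t \<partial>lborel)"
      unfolding \<zeta>_def J_def by (rule integral_primitive_swap(1)[OF P \<psi> ab Ii I0])
    finally have e2: "(\<integral>p. \<rho> p * g2 p \<partial>lborel) = (\<integral>t. \<psi> t * J t \<partial>lborel)" .
    have "(\<integral>t. \<psi> t * indicator {0..T} t \<partial>lborel) = P T - P 0"
      using T_pos P \<psi> by (intro integral_FTC_Icc_real) (auto simp: continuous_on_eq_continuous_at)
    then have e3: "(\<integral>t. \<psi> t * (n * indicator {0..T} t) \<partial>lborel) = \<zeta> 0 * n"
      by (simp add: \<zeta>_def mult.left_commute[of _ n] mult.commute)
    have mult: "integrable lborel (\<lambda>t. \<psi> t * h t)" if "integrable lborel h" for h
      by (rule Bochner_Integration.integrable_bound[OF that])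
        (use ab that in \<open>auto simp: abs_mult intro!: mult_left_le_one_le\<close>)
    have "(\<integral>t. \<psi> t * (m t - n * indicator {0..T} t - J t) \<partial>lborel)
      = (\<integral>t. \<psi> t * m t \<partial>lborel) - (\<integral>t. \<psi> t * (n * indicator {0..T} t) \<partial>lborel) - (\<integral>t. \<psi> t * J t \<partial>lborel)"
      unfolding right_diff_distrib
      by (simp only: Bochner_Integration.integral_diff Bochner_Integration.integrable_diff mult[OF mi] mult[OF one] mult[OF Ji])
    also have "\<dots> = - (\<integral>p. \<rho> p * (g2 p - g1 p) \<partial>lborel) - \<zeta> 0 * n"
      unfolding right_diff_distrib e3 Bochner_Integration.integral_diff[OF i2 i1] e1 e2 by simp
    finally show ?thesis unfolding eq by simp
  qed
  have fi: "integrable lborel (\<lambda>t. m t - n * indicator {0..T} t - J t)"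
    by (intro Bochner_Integration.integrable_diff mi one Ji)
  have A: "AE t in lborel. m t - n * indicator {0..T} t - J t \<le> 0"
    by (rule AE_nonpos_of_continuous_tests[OF fi]) (simp add: test)
  have B: "AE t in lborel. - (m t - n * indicator {0..T} t - J t) \<le> 0"
  proof (rule AE_nonpos_of_continuous_tests)
    show "integrable lborel (\<lambda>t. - (m t - n * indicator {0..T} t - J t))" by (rule integrable_minus[OF fi])
    fix \<psi> :: "real \<Rightarrow> real"
    assume "continuous_on UNIV \<psi>" "\<And>t. 0 \<le> \<psi> t" "\<And>t. \<psi> t \<le> 1"
    then show "(\<integral>t. \<psi> t * - (m t - n * indicator {0..T} t - J t) \<partial>lborel) \<le> 0"
      unfolding mult_minus_right Bochner_Integration.integral_minus by (simp add: test)
  qed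
  show "AE t in lborel. t \<in> {0<..<T} \<longrightarrow> (\<integral>x. \<phi> x \<partial>flow t) - (\<integral>x. \<phi> x \<partial>\<nu>)
       = (\<integral>s. indicator {0..t} s * (\<integral>x. on_Q (Lop a b c \<phi>) (x, s) \<partial>flow s) \<partial>lborel)"
    using A B
  proof eventually_elim
    case (elim t)
    show ?case
    proof
      assume t: "t \<in> {0<..<T}"
      then have "m t = (\<integral>x. \<phi> x \<partial>flow t)"
        using integral_flow_on_Q[of t "\<lambda>x t. \<phi> x"] by (simp add: m_def F1_def)
      then show "(\<integral>x. \<phi> x \<partial>flow t) - (\<integral>x. \<phi> x \<partial>\<nu>)
       = (\<integral>s. indicator {0..t} s * (\<integral>x. on_Q (Lop a b c \<phi>) (x, s) \<partial>flow s) \<partial>lborel)"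
        using elim t by (simp add: J_def n_def I_def F2_def)
    qed
  qed
qed

text \<open>The integrand is integrable up to time 0, so the one-sided limit in the weak formulation
  is an ordinary integral, by dominated convergence along sequences.\<close>

lemma integral_from_eps_tendsto:
  fixes I :: "real \<Rightarrow> real"
  assumes I: "integrable lborel I" and t: "t > 0"
  shows "((\<lambda>\<epsilon>. LINT s:{\<epsilon>..t}|lborel. I s) \<longlongrightarrow> (\<integral>s. indicator {0..t} s * I s \<partial>lborel)) (at_right 0)"
proof (rule tendsto_at_right_sequentially[OF t])
  have [measurable]: "I \<in> borel_measurable borel" using I by auto
  fix S :: "nat \<Rightarrow> real"
  assume S: "\<And>n. 0 < S n" "S \<longlonglongrightarrow> 0"
  show "(\<lambda>n. LINT s:{S n..t}|lborel. I s) \<longlonglongrightarrow> (\<integral>s. indicator {0..t} s * I s \<partial>lborel)"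
    unfolding set_lebesgue_integral_def
  proof (rule integral_dominated_convergence[where w = "\<lambda>s. \<bar>I s\<bar>"])
    \<comment> \<open>At \<open>s = 0\<close> the indicators stay 0 while the limit indicator is 1;
      this single point is a null set.\<close>
    have "(\<lambda>n. indicator {S n..t} s *\<^sub>R I s) \<longlonglongrightarrow> indicator {0..t} s * I s" if "s \<noteq> 0" for s
    proof (cases "s > 0")
      case True
      have "\<forall>\<^sub>F n in sequentially. S n < s" using order_tendstoD(2)[OF S(2) True] .
      then have "\<forall>\<^sub>F n in sequentially. indicator {S n..t} s *\<^sub>R I s = indicator {0..t} s * I s"
        by eventually_elim (use True in \<open>auto split: split_indicator\<close>)
      then show ?thesis by (rule tendsto_eventually)
    next
      case False
      have "\<not> S n \<le> s" for n using False S(1)[of n] by simp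
      then have "indicator {S n..t} s *\<^sub>R I s = indicator {0..t} s * I s" for n
        using that False by (auto split: split_indicator)
      then show ?thesis by (simp only: tendsto_const)
    qed
    then show "AE s in lborel. (\<lambda>n. indicator {S n..t} s *\<^sub>R I s) \<longlonglongrightarrow> indicator {0..t} s * I s"
      using AE_lborel_singleton[of "0 :: real"] by (auto elim: AE_mp)
    show "AE s in lborel. norm (indicator {S n..t} s *\<^sub>R I s) \<le> \<bar>I s\<bar>" for n
      by (auto split: split_indicator)
  qed (use I in auto)
qed

text \<open>The class refers to the original coefficients, on which nothing is known off
  \<open>D \<times> {0..T}\<close>. As \<open>flow t\<close> lives on \<open>D\<close> and only
  times in that interval count, they can be exchanged under each integral with their extensions
  \<open>on_Q\<close>.\<close>

lemma flow_in_M_class: "in_M_class D Dk T a b c \<nu> flow"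
  unfolding in_M_class_def
proof (intro conjI allI ballI impI)
  interpret \<nu>: prob_space \<nu> by (rule nu_prob)
  show "sets (flow t) = sets (restrict_space borel D)" for t by (rule sets_flow)
  show "(\<lambda>t. emeasure (flow t) B) \<in> borel_measurable (restrict_space lborel {0<..<T})"
    if "B \<in> sets (restrict_space borel D)" for B
    using flow_emeasure_measurable[OF that] by (intro measurable_restrict_space1) simp
  have cl: "closure (Dk k) \<in> sets (restrict_space borel D)" for k
    using closure_Dk_sub[of k] by (auto simp: sets_restrict_space image_iff intro!: bexI[of _ "closure (Dk k)"])
  fix k \<alpha> \<beta> assume \<alpha>\<beta>: "0 < \<alpha>" "\<alpha> \<le> \<beta>" "\<beta> < T"
  show "(\<integral>\<^sup>+s. emeasure (flow s) (closure (Dk k)) * indicator {\<alpha>..\<beta>} s \<partial>lborel) < \<infinity>"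
    using nn_integral_flow_local_finite[of k "\<lambda>_ _. 1" 1 \<alpha> \<beta>] \<alpha>\<beta> cl[of k] by (simp add: sets_flow)
  show "(\<integral>\<^sup>+s. (\<integral>\<^sup>+x. ennreal \<bar>a x s i j\<bar> * indicator (closure (Dk k)) x \<partial>flow s) * indicator {\<alpha>..\<beta>} s \<partial>lborel) < \<infinity>" for i j
    by (rule nn_integral_flow_local_finite[where C = "bound (Suc k)"]) (auto intro!: ennreal_leI bound_coeff \<alpha>\<beta>)
  show "(\<integral>\<^sup>+s. (\<integral>\<^sup>+x. ennreal \<bar>b x s i\<bar> * indicator (closure (Dk k)) x \<partial>flow s) * indicator {\<alpha>..\<beta>} s \<partial>lborel) < \<infinity>" for i
    by (rule nn_integral_flow_local_finite[where C = "bound (Suc k)"]) (auto intro!: ennreal_leI bound_coeff \<alpha>\<beta>)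
  show "(\<integral>\<^sup>+s. (\<integral>\<^sup>+x. ennreal \<bar>c x s\<bar> * indicator (closure (Dk k)) x \<partial>flow s) * indicator {\<alpha>..\<beta>} s \<partial>lborel) < \<infinity>"
    by (rule nn_integral_flow_local_finite[where C = "bound (Suc k)"]) (auto intro!: ennreal_leI bound_coeff \<alpha>\<beta>)
next
  fix \<phi> assume \<phi>: "test_fun D \<phi>"
  show "AE t in lborel. t \<in> {0<..<T} \<longrightarrow>
     ((\<lambda>\<epsilon>. LINT s:{\<epsilon>..t}|lborel. (\<integral>x. Lop a b c \<phi> x s \<partial>flow s)) \<longlongrightarrow> (\<integral>x. \<phi> x \<partial>flow t) - (\<integral>x. \<phi> x \<partial>\<nu>)) (at_right 0)"
    using test_fun_integral_equation(2)[OF \<phi>]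
  proof eventually_elim
    case (elim t)
    show ?case
    proof
      assume t: "t \<in> {0<..<T}"
      have "((\<lambda>\<epsilon>. LINT s:{\<epsilon>..t}|lborel. (\<integral>x. on_Q (Lop a b c \<phi>) (x, s) \<partial>flow s)) \<longlongrightarrow> (\<integral>x. \<phi> x \<partial>flow t) - (\<integral>x. \<phi> x \<partial>\<nu>)) (at_right 0)"
        using integral_from_eps_tendsto[OF test_fun_integral_equation(1)[OF \<phi>], of t] elim t by simp
      moreover have "\<forall>\<^sub>F \<epsilon> in at_right 0. (LINT s:{\<epsilon>..t}|lborel. (\<integral>x. on_Q (Lop a b c \<phi>) (x, s) \<partial>flow s))
          = (LINT s:{\<epsilon>..t}|lborel. (\<integral>x. Lop a b c \<phi> x s \<partial>flow s))"
      proof -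
        have "(LINT s:{\<epsilon>..t}|lborel. (\<integral>x. on_Q (Lop a b c \<phi>) (x, s) \<partial>flow s))
          = (LINT s:{\<epsilon>..t}|lborel. (\<integral>x. Lop a b c \<phi> x s \<partial>flow s))" if "0 < \<epsilon>" for \<epsilon>
          unfolding set_lebesgue_integral_def
          using that t by (intro Bochner_Integration.integral_cong) (auto simp: integral_flow_on_Q split: split_indicator)
        then show ?thesis unfolding eventually_at_right_field by (intro exI[of _ 1]) auto
      qed
      ultimately show "((\<lambda>\<epsilon>. LINT s:{\<epsilon>..t}|lborel. (\<integral>x. Lop a b c \<phi> x s \<partial>flow s)) \<longlongrightarrow> (\<integral>x. \<phi> x \<partial>flow t) - (\<integral>x. \<phi> x \<partial>\<nu>)) (at_right 0)"
        by (rule Lim_transform_eventually)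
    qed
  qed
next
  have "(\<integral>\<^sup>+s. (\<integral>\<^sup>+x. ennreal \<bar>c x s\<bar> \<partial>flow s) * indicator {0<..<T} s \<partial>lborel)
    \<le> (\<integral>\<^sup>+s. (\<integral>\<^sup>+x. ennreal (- on_Q c (x, s)) \<partial>flow s) \<partial>lborel)"
  proof (intro nn_integral_mono, goal_cases)
    case (1 s)
    show ?case
    proof (cases "s \<in> {0<..<T}")
      case True
      then have "(\<integral>\<^sup>+x. ennreal \<bar>c x s\<bar> \<partial>flow s) = (\<integral>\<^sup>+x. ennreal (- on_Q c (x, s)) \<partial>flow s)"
        using c_nonpos by (intro nn_integral_cong) (auto simp: space_flow on_Q_eq)
      then show ?thesis using True by simp
    qed simp
  qed
  also have "\<dots> = (\<integral>\<^sup>+p. ennreal (\<rho> p) * ennreal (- on_Q c p) \<partial>lborel)"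
    by (rule nn_integral_flow_Fubini[of "\<lambda>p. ennreal (- on_Q c p)"]) measurable
  also have "\<dots> = (\<integral>\<^sup>+p. ennreal (\<rho> p * (- on_Q c p)) \<partial>lborel)"
    using rho_nonneg on_Q_c_nonpos by (intro nn_integral_cong ennreal_mult[symmetric]) simp_all
  finally show "(\<integral>\<^sup>+s. (\<integral>\<^sup>+x. ennreal \<bar>c x s\<bar> \<partial>flow s) * indicator {0<..<T} s \<partial>lborel) < \<infinity>"
    using rho_c by (simp add: order_le_less_trans)
next
  interpret \<nu>: prob_space \<nu> by (rule nu_prob)
  have em: "emeasure (flow t) D = (\<integral>\<^sup>+x. 1 \<partial>flow t)" for t
    by (simp add: space_flow)
  have meas: "measure (flow t) D = mass t" for t
    unfolding mass_def by (simp add: space_flow)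
  have "(\<integral>\<^sup>+s. emeasure (flow s) D \<partial>lborel) = (\<integral>\<^sup>+p. ennreal (\<rho> p) \<partial>lborel)"
    unfolding em using nn_integral_flow_Fubini[of "\<lambda>_. 1"] by simp
  also have "\<dots> \<noteq> \<infinity>"
    using rho_total_integrable rho_nonneg by (simp add: nn_integral_eq_integral)
  finally have fin: "AE t in lborel. emeasure (flow t) D \<noteq> \<infinity>"
  proof (intro nn_integral_PInf_AE)
    have "D \<in> sets (restrict_space borel D)"
      using sets.top[of "restrict_space borel D"] by (simp add: space_restrict_space)
    then show "(\<lambda>t. emeasure (flow t) D) \<in> borel_measurable lborel"
      using flow_emeasure_measurable by simp
  qed
  have km: "killed \<in> borel_measurable borel" using integrable_killed by auto
  \<comment> \<open>The condition \<open>t < T\<close> places all times of integration in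
    \<open>{0..T}\<close>, where \<open>c\<close> agrees with its extension; including the time 0
    changes a null set only.\<close>
  have killed_eq: "(LINT s:{0<..t}|lborel. (\<integral>x. c x s \<partial>flow s)) = (\<integral>s. indicator {0..t} s * killed s \<partial>lborel)" if t: "t < T" for t
  proof -
    have "(LINT s:{0<..t}|lborel. (\<integral>x. c x s \<partial>flow s)) = (\<integral>s. indicator {0<..t} s * killed s \<partial>lborel)"
      unfolding set_lebesgue_integral_def killed_def
      using t by (intro Bochner_Integration.integral_cong) (auto simp: integral_flow_on_Q split: split_indicator)
    also have "\<dots> = (\<integral>s. indicator {0..t} s * killed s \<partial>lborel)"
    proof (rule integral_cong_AE)
      show "AE s in lborel. indicator {0<..t} s * killed s = indicator {0..t} s * killed s"
        using AE_lborel_singleton[of "0 :: real"] by eventually_elim (auto split: split_indicator)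
    qed (use km in measurable)
    finally show ?thesis .
  qed
  show "AE t in lborel. t \<in> {0<..<T} \<longrightarrow> emeasure (flow t) D < \<infinity> \<and>
     measure (flow t) D \<le> measure \<nu> D + (LINT s:{0<..t}|lborel. (\<integral>x. c x s \<partial>flow s))"
    using mass_inequality fin
  proof eventually_elim
    case (elim t)
    show ?case
    proof (intro impI conjI)
      assume t: "t \<in> {0<..<T}"
      show "emeasure (flow t) D < \<infinity>" using elim(2) by (simp add: less_top)
      have "measure \<nu> D = 1" using \<nu>.prob_space by (simp add: space_nu)
      then show "measure (flow t) D \<le> measure \<nu> D + (LINT s:{0<..t}|lborel. (\<integral>x. c x s \<partial>flow s))"
        using elim(1) t by (simp add: meas killed_eq)
    qed
  qed
qed

end

theorem theorem1:
  fixes D :: "(real^'n::finite) set" and Dk :: "nat \<Rightarrow> (real^'n) set" and T :: real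
    and a :: "real^'n \<Rightarrow> real \<Rightarrow> 'n \<Rightarrow> 'n \<Rightarrow> real"
    and b :: "real^'n \<Rightarrow> real \<Rightarrow> 'n \<Rightarrow> real"
    and c :: "real^'n \<Rightarrow> real \<Rightarrow> real"
    and \<nu> :: "(real^'n) measure"
  assumes T_pos: "T > 0"
    and D_open: "open D"
    and Dk_open: "\<And>k. open (Dk k)"
    and Dk_bounded: "\<And>k. bounded (Dk k)"
    and Dk_incr: "\<And>k. closure (Dk k) \<subseteq> Dk (Suc k)"
    and Dk_union: "(\<Union>k. Dk k) = D"
    and a_borel: "\<And>i j. (\<lambda>p. a (fst p) (snd p) i j) \<in> borel_measurable (restrict_space borel (D \<times> {0..T}))"
    and b_borel: "\<And>i. (\<lambda>p. b (fst p) (snd p) i) \<in> borel_measurable (restrict_space borel (D \<times> {0..T}))"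
    and c_borel: "(\<lambda>p. c (fst p) (snd p)) \<in> borel_measurable (restrict_space borel (D \<times> {0..T}))"
    and a_sym: "\<And>x t i j. x \<in> D \<Longrightarrow> t \<in> {0..T} \<Longrightarrow> a x t i j = a x t j i"
    and c_nonpos: "\<And>x t. x \<in> D \<Longrightarrow> t \<in> {0..T} \<Longrightarrow> c x t \<le> 0"
    and a_bdd: "\<And>k i j. \<exists>C. \<forall>x\<in>Dk k. \<forall>t\<in>{0..T}. \<bar>a x t i j\<bar> \<le> C"
    and b_bdd: "\<And>k i. \<exists>C. \<forall>x\<in>Dk k. \<forall>t\<in>{0..T}. \<bar>b x t i\<bar> \<le> C"
    and c_bdd: "\<And>k. \<exists>C. \<forall>x\<in>Dk k. \<forall>t\<in>{0..T}. \<bar>c x t\<bar> \<le> C"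
    and ellipt: "\<And>k. \<exists>m M. m > 0 \<and> M > 0 \<and> (\<forall>x\<in>Dk k. \<forall>t\<in>{0..T}. \<forall>y::real^'n.
                    m * (norm y)\<^sup>2 \<le> (\<Sum>i\<in>UNIV. \<Sum>j\<in>UNIV. a x t i j * y $ j * y $ i)
                  \<and> (\<Sum>i\<in>UNIV. \<Sum>j\<in>UNIV. a x t i j * y $ j * y $ i) \<le> M * (norm y)\<^sup>2)"
    and nu_sets: "sets \<nu> = sets (restrict_space borel D)"
    and nu_prob: "prob_space \<nu>"
  shows "\<exists>\<mu>. in_M_class D Dk T a b c \<nu> \<mu>"
proof -
  interpret elliptic_cauchy_data D Dk T a b c \<nu>
    by (rule elliptic_cauchy_data.intro) (fact T_pos D_open Dk_open Dk_bounded Dk_incr Dk_union a_borel b_borel c_borel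
      c_nonpos a_bdd b_bdd c_bdd ellipt nu_sets nu_prob)+
  obtain \<rho> where "solution_density D Dk T a b c \<nu> \<rho>" using exists_solution_density by blast
  then interpret solution_density D Dk T a b c \<nu> \<rho> .
  show ?thesis using flow_in_M_class by blast
qed

end
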